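(* Let $T>0$ and let $(T(t))_{t\in[0,T]}$ be a strongly continuous semigroup on a (separable) Hilbert space $V$. Assume that there exist an orthonormal basis $(e_k)_{k\in\mathbb N}$ of $V$ and $(\gamma_k)_{k\in\mathbb N}\subseteq\mathbb R$ such that $$T^*(t)e_k=e^{\gamma_kt}e_k\qquad\text{for all }t\in[0,T],\ k\in\mathbb N.$$ Let the cylindrical Lévy process $L$ in $V$ be of the form $$L(t)v^*=\sum_{k=1}^\infty\langle e_k,v^*\rangle\ell_k(t)\qquad\text{for all }v^*\in V^*,\ t\ge0,$$ where $(\ell_k)_{k\in\mathbb N}$ is a sequence of independent, symmetric Lévy processes in $\mathbb R$ with characteristics $(0,0,\nu_k)$. Then the semigroup $(T(t))_{t\in[0,T]}$ is stochastically integrable with respect to $L$ if and only if $$\sum_{k=1}^\infty\int_0^T\int_{\mathbb R}\big(e^{2\gamma_ks}|\beta|^2\wedge1\big)\,\nu_k(d\beta)\,ds<\infty .$$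
   Context: Characteristics $(0,0,\nu_k)$ of the real symmetric Lévy process $\ell_k$ means $E[e^{i\beta\ell_k(1)}]=\exp(\int_{\mathbb R}(e^{i\beta x}-1-i\beta x1_{[-1,1]}(x))\nu_k(dx))$. The series defining $L(t)v^*$ converges $P$-a.s. for all $v^*$ and $t$, and $L$ is assumed to be a cylindrical Lévy process. Cylindrical objects. $\langle\cdot,\cdot\rangle$ is the dual pairing of $V$ and $V^*$ ($V^*$ identified with $V$ where needed); $B_{\mathbb R}=[-1,1]$; $(\Omega,\mathcal A,P)$ is a probability space; $L^0_P(\Omega;\cdot)$ denotes (classes of) random variables with the topology of convergence in probability. Cylindrical sets are sets $\{v\in V:(\langle v,v_1^*\rangle,\dots,\langle v,v_n^*\rangle)\in B\}$, $v_i^*\in V^*$, $B\in\mathcal B(\mathbb R^n)$; they form the algebra $\mathcal Z(V)$. A cylindrical measure on $\mathcal Z(V)$ is a map $\mathcal Z(V)\to[0,\infty]$ whose restriction to the $\sigma$-algebra generated by the cylindrical sets with $v_i^*\in\Gamma$ is a measure for every finite $\Gamma\subseteq V^*$. It is a cylindrical Lévy measure if $\int_V(\langle v,v^*\rangle^2\wedge1)\mu(dv)<\infty$ for all $v^*$. A cylindrical random variable in $V$ is a linear continuous map $V^*\to L^0_P(\Omega;\mathbb R)$. A family $(L(t):t\ge0)$ of cylindrical random variables is a cylindrical Lévy process in $V$ if $((L(t)v_1^*,\dots,L(t)v_n^* ):t\ge0)$ is a Lévy process in $\mathbb R^n$ for all $v_1^*,\dots,v_n^*\in V^*$, $n\in\mathbb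 N$. Then $E[e^{iL(t)v^*}]=e^{t\Psi(v^* )}$, where $\Psi(v^* )=ia(v^* )-\tfrac12\langle v^*,Qv^*\rangle+\int_V(e^{i\langle v,v^*\rangle}-1-i\langle v,v^*\rangle1_{B_{\mathbb R}}(\langle v,v^*\rangle))\mu(dv)$; $(a,Q,\mu)$ are the cylindrical characteristics, with $\mu$ a cylindrical Lévy measure. Standing assumption: $L(t)=W(t)+P(t)$ with $W(t),P(t):V^*\to L^0_P(\Omega;\mathbb R)$ continuous, $W$ and $P$ independent cylindrical Lévy processes with characteristics $(0,Q,0)$ and $(a,0,\mu)$. Stochastic integrability. $\mathcal G([0,T];V^* )$ is the space of regulated functions $g:[0,T]\to V^*$ (one-sided limits exist everywhere), with supremum norm. $f:[0,T]\to\mathcal L(V,V)$ (bounded linear operators) is weakly in $\mathcal G([0,T];V^* )$ if $f^*(\cdot)v^*\in\mathcal G([0,T];V^* )$ for each $v^*\in V^*$, where $f^*(s)$ is the adjoint of $f(s)$. For a simple function $g$ with value $v_k^*$ on $(t_k,t_{k+1})$, $0=t_0\le\dots\le t_m=T$, put $J(g)=\sum_{k=0}^{m-1}(L(t_{k+1})-L(t_k))v_k^*$. $J$ is extended to $\mathcal G([0,T];V^* )$ by continuity: $J(g)=\lim_nJ(g_n)$ in probability for simple $g_n\to g$ uniformly. As part of the setting it is asserted that $\tau g\in\mathcal G([0,T];V^* )$ for every bounded measurable $\tau:[0,T]\to\mathbb R$ and $g\in\mathcal G([0,T];V^* )$; accordingly $1_A(\cdot)f^*(\cdot)v^*$ is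 taken as an element of $\mathcal G([0,T];V^* )$ for each $A\in\mathcal B([0,T])$. The cylindrical integral of $f$ on $A$ is $Z_A:V^*\to L^0_P(\Omega;\mathbb R)$, $Z_Av^*=J(1_A(\cdot)f^*(\cdot)v^* )$; it is a cylindrical random variable with $E[e^{iZ_Av^*}]=\exp(\int_A\Psi(f^*(s)v^* )ds)$. $f$ is stochastically integrable w.r.t. $L$ if it is weakly in $\mathcal G([0,T];V^* )$ and for each $A\in\mathcal B([0,T])$ there is $I_A\in L^0_P(\Omega;V)$ with $\langle I_A,v^*\rangle=Z_Av^*$ for all $v^*\in V^*$. The semigroup is stochastically integrable if $f(t)=T(t)$ is.
   Formalization: Since 1_A(·)f*(·)v* need not be regulated for Borel A (e.g. A the rationals in [0,T]), J is extended from regulated functions to limits of uniformly bounded, Lebesgue-a.e. convergent sequences of regulated functions, with convergence of the integrals in probability. *)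

theory Defs
  imports "HOL-Probability.Probability"
begin

text \<open>
  Elements of $L^0$ are represented by measurable functions, and identities in $L^0$ are
  almost-sure identities. The dual $V^*$ of the real Hilbert space $V$ is identified with $V$
  by Riesz' theorem, so that the dual pairing is the inner product.
\<close>

definition tendsto_in_prob ::
    "'w measure \<Rightarrow> ('i \<Rightarrow> 'w \<Rightarrow> real) \<Rightarrow> ('w \<Rightarrow> real) \<Rightarrow> 'i filter \<Rightarrow> bool" where
  "tendsto_in_prob M X Y F \<longleftrightarrow>
     (\<forall>\<epsilon>>0. ((\<lambda>i. measure M {\<omega> \<in> space M. \<epsilon> < \<bar>X i \<omega> - Y \<omega>\<bar>}) \<longlongrightarrow> 0) F)"


subsection \<open>Levy processes\<close>

text \<open>
  Levy processes in $R^I$ for a finite index set $I$ (\<open>X i t\<close> is the $i$-th coordinate at time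
  $t$). As processes are only given up to modification here, no path regularity is demanded:
  stochastic continuity is equivalent to the existence of a cadlag modification.
\<close>

definition levy_process_in ::
    "'w measure \<Rightarrow> 'i set \<Rightarrow> ('i \<Rightarrow> real \<Rightarrow> 'w \<Rightarrow> real) \<Rightarrow> bool" where
  "levy_process_in M I X \<longleftrightarrow>
     (\<forall>i\<in>I. \<forall>t\<ge>0. X i t \<in> borel_measurable M) \<and>
     (\<forall>i\<in>I. AE \<omega> in M. X i 0 \<omega> = 0) \<and>
     (\<forall>(m::nat) (t::nat \<Rightarrow> real). 0 \<le> t 0 \<longrightarrow> (\<forall>j<m. t j \<le> t (Suc j)) \<longrightarrow>
        prob_space.indep_vars M (\<lambda>_. \<Pi>\<^sub>M i\<in>I. borel)
          (\<lambda>j \<omega>. \<lambda>i\<in>I. X i (t (Suc j)) \<omega> - X i (t j) \<omega>) {..<m}) \<and>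
     (\<forall>s t. 0 \<le> s \<longrightarrow> s \<le> t \<longrightarrow>
        distr M (\<Pi>\<^sub>M i\<in>I. borel) (\<lambda>\<omega>. \<lambda>i\<in>I. X i t \<omega> - X i s \<omega>) =
        distr M (\<Pi>\<^sub>M i\<in>I. borel) (\<lambda>\<omega>. \<lambda>i\<in>I. X i (t - s) \<omega> - X i 0 \<omega>)) \<and>
     (\<forall>i\<in>I. \<forall>t\<ge>0. tendsto_in_prob M (X i) (X i t) (at t within {0..}))"

text \<open>The real-valued case, as $R = R^{\{()\}}$.\<close>

abbreviation levy_process :: "'w measure \<Rightarrow> (real \<Rightarrow> 'w \<Rightarrow> real) \<Rightarrow> bool" where
  "levy_process M X \<equiv> levy_process_in M {()} (\<lambda>_. X)"

definition symmetric_process :: "'w measure \<Rightarrow> (real \<Rightarrow> 'w \<Rightarrow> real) \<Rightarrow> bool" where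
  "symmetric_process M X \<longleftrightarrow>
     (\<forall>t\<ge>0. distr M borel (X t) = distr M borel (\<lambda>\<omega>. - X t \<omega>))"

definition levy_measure :: "real measure \<Rightarrow> bool" where
  "levy_measure \<nu> \<longleftrightarrow> sets \<nu> = sets borel \<and> emeasure \<nu> {0} = 0 \<and>
     (\<integral>\<^sup>+x. ennreal (min (x\<^sup>2) 1) \<partial>\<nu>) < \<infinity>"

text \<open>Characteristics $(0,0,\nu)$, with the truncation function $x 1_{[-1,1]}(x)$.\<close>

definition pure_jump_characteristics ::
    "'w measure \<Rightarrow> (real \<Rightarrow> 'w \<Rightarrow> real) \<Rightarrow> real measure \<Rightarrow> bool" where
  "pure_jump_characteristics M X \<nu> \<longleftrightarrow> levy_measure \<nu> \<and>
     (\<forall>\<beta>. char (distr M borel (X 1)) \<beta> =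
        exp (CLINT x|\<nu>. iexp (\<beta> * x) - 1 - \<i> * complex_of_real (\<beta> * x * indicator {-1..1} x)))"

definition independent_processes ::
    "'w measure \<Rightarrow> ('k \<Rightarrow> real \<Rightarrow> 'w \<Rightarrow> real) \<Rightarrow> bool" where
  "independent_processes M X \<longleftrightarrow>
     prob_space.indep_vars M (\<lambda>_. \<Pi>\<^sub>M t\<in>{0..}. borel) (\<lambda>k \<omega>. \<lambda>t\<in>{0..}. X k t \<omega>) UNIV"


subsection \<open>Cylindrical Levy processes\<close>

definition cylindrical_rv :: "'w measure \<Rightarrow> ('v::real_inner \<Rightarrow> 'w \<Rightarrow> real) \<Rightarrow> bool" where
  "cylindrical_rv M Z \<longleftrightarrow>
     (\<forall>v. Z v \<in> borel_measurable M) \<and>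
     (\<forall>a b v w. AE \<omega> in M. Z (a *\<^sub>R v + b *\<^sub>R w) \<omega> = a * Z v \<omega> + b * Z w \<omega>) \<and>
     (\<forall>u v. u \<longlonglongrightarrow> v \<longrightarrow> tendsto_in_prob M (\<lambda>n. Z (u n)) (Z v) sequentially)"

definition cylindrical_levy_process ::
    "'w measure \<Rightarrow> (real \<Rightarrow> 'v::real_inner \<Rightarrow> 'w \<Rightarrow> real) \<Rightarrow> bool" where
  "cylindrical_levy_process M L \<longleftrightarrow>
     (\<forall>t\<ge>0. cylindrical_rv M (L t)) \<and>
     (\<forall>(n::nat) v. levy_process_in M {..<n} (\<lambda>i t. L t (v i)))"


subsection \<open>The cylindrical integral\<close>

definition regulated :: "real \<Rightarrow> (real \<Rightarrow> 'v::real_normed_vector) \<Rightarrow> bool" where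
  "regulated T g \<longleftrightarrow>
     (\<forall>t\<in>{0..<T}. \<exists>l. (g \<longlongrightarrow> l) (at_right t)) \<and>
     (\<forall>t\<in>{0<..T}. \<exists>l. (g \<longlongrightarrow> l) (at_left t))"

text \<open>
  \<open>g\<close> is simple: it takes the value \<open>v k\<close> on the open interval from \<open>t k\<close> to \<open>t (k + 1)\<close>; the
  values at the partition points are arbitrary and do not enter the integral.
\<close>

definition is_simple ::
    "real \<Rightarrow> nat \<Rightarrow> (nat \<Rightarrow> real) \<Rightarrow> (nat \<Rightarrow> 'v) \<Rightarrow> (real \<Rightarrow> 'v) \<Rightarrow> bool" where
  "is_simple T m t v g \<longleftrightarrow> t 0 = 0 \<and> t m = T \<and>
     (\<forall>k<m. t k \<le> t (Suc k) \<and> (\<forall>s\<in>{t k<..<t (Suc k)}. g s = v k))"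

definition simple_integral ::
    "(real \<Rightarrow> 'v \<Rightarrow> 'w \<Rightarrow> real) \<Rightarrow> nat \<Rightarrow> (nat \<Rightarrow> real) \<Rightarrow> (nat \<Rightarrow> 'v) \<Rightarrow> 'w \<Rightarrow> real" where
  "simple_integral L m t v \<omega> = (\<Sum>k<m. L (t (Suc k)) (v k) \<omega> - L (t k) (v k) \<omega>)"

text \<open>
  \<open>X\<close> is (a version of) $J(g)$ for a regulated \<open>g\<close>.
\<close>

definition has_regulated_integral ::
    "'w measure \<Rightarrow> (real \<Rightarrow> 'v::real_inner \<Rightarrow> 'w \<Rightarrow> real) \<Rightarrow> real \<Rightarrow> (real \<Rightarrow> 'v) \<Rightarrow> ('w \<Rightarrow> real) \<Rightarrow> bool"
  where
  "has_regulated_integral M L T g X \<longleftrightarrow> regulated T g \<and> X \<in> borel_measurable M \<and>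
     (\<exists>m t v h. (\<forall>n. is_simple T (m n) (t n) (v n) (h n)) \<and>
        uniform_limit {0..T} h g sequentially \<and>
        tendsto_in_prob M (\<lambda>n. simple_integral L (m n) (t n) (v n)) X sequentially)"

text \<open>
  The functions $1_A g$ with \<open>g\<close> regulated and \<open>A\<close> Borel that occur in the definition of
  stochastic integrability are in general not regulated, so $J$ has to be extended further.
  The continuous extension along uniformly bounded, Lebesgue almost everywhere convergent
  sequences of regulated functions reaches all of them, coincides with $J$ on regulated
  functions (see \<open>has_regulated_integral_imp\<close> below) and preserves the formula
  $E \exp(i J(g)) = \exp(\int_0^T \Psi(g(s)) ds)$.
\<close>

definition has_cylindrical_integral ::
    "'w measure \<Rightarrow> (real \<Rightarrow> 'v::real_inner \<Rightarrow> 'w \<Rightarrow> real) \<Rightarrow> real \<Rightarrow> (real \<Rightarrow> 'v) \<Rightarrow> ('w \<Rightarrow> real) \<Rightarrow> bool"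
  where
  "has_cylindrical_integral M L T g X \<longleftrightarrow> X \<in> borel_measurable M \<and>
     (\<exists>h Y. (\<forall>n. has_regulated_integral M L T (h n) (Y n)) \<and>
        (\<exists>C. \<forall>n. \<forall>s\<in>{0..T}. norm (h n s) \<le> C) \<and>
        (AE s in lborel. s \<in> {0..T} \<longrightarrow> (\<lambda>n. h n s) \<longlonglongrightarrow> g s) \<and>
        tendsto_in_prob M Y X sequentially)"

lemma is_simple_cases:
  assumes "is_simple T m t v h" "s \<in> {0..T}"
  shows "s \<in> t ` {..m} \<or> h s \<in> v ` {..<m}"
proof -
  have *: "k \<le> m \<Longrightarrow> 0 \<le> s \<Longrightarrow> s \<le> t k \<Longrightarrow> s \<in> t ` {..m} \<or> h s \<in> v ` {..<m}" for k
  proof (induction k)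
    case 0
    then show ?case using assms(1) by (auto simp: is_simple_def intro!: image_eqI[of _ _ 0])
  next
    case (Suc k)
    consider "s \<le> t k" | "s = t (Suc k)" | "s \<in> {t k<..<t (Suc k)}"
      using Suc.prems by fastforce
    then show ?case
    proof cases
      case 3
      then have "h s = v k" using assms(1) Suc.prems by (auto simp: is_simple_def)
      then show ?thesis using Suc.prems by auto
    qed (use Suc in auto)
  qed
  show ?thesis using *[of m] assms by (auto simp: is_simple_def)
qed

lemma has_regulated_integral_imp:
  assumes "has_regulated_integral M L T g X"
  shows "has_cylindrical_integral M L T g X"
proof -
  from assms obtain m t v h where h: "\<And>n::nat. is_simple T (m n) (t n) (v n) (h n)"
    and u: "uniform_limit {0..T} h g sequentially"
    unfolding has_regulated_integral_def by blast
  from u have "\<forall>\<^sub>F n in sequentially. \<forall>s\<in>{0..T}. dist (h n s) (g s) < 1"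
    by (rule uniform_limitD) simp
  then obtain n where n: "\<And>s. s \<in> {0..T} \<Longrightarrow> dist (h n s) (g s) < 1"
    unfolding eventually_sequentially by blast
  let ?S = "h n ` t n ` {..m n} \<union> v n ` {..<m n}"
  have "bounded ?S" by (intro finite_imp_bounded) auto
  then obtain C where C: "\<And>x. x \<in> ?S \<Longrightarrow> norm x \<le> C" unfolding bounded_iff by blast
  have "norm (g s) \<le> C + 1" if s: "s \<in> {0..T}" for s
  proof -
    have "h n s \<in> ?S" using is_simple_cases[OF h s, of n] by auto
    then have "norm (h n s) \<le> C" by (rule C)
    moreover have "norm (g s) \<le> norm (h n s) + dist (h n s) (g s)"
      by (metis dist_norm norm_minus_commute norm_triangle_sub)
    ultimately show ?thesis using n[OF s] by linarith
  qed
  moreover have "tendsto_in_prob M (\<lambda>_::nat. X) X sequentially"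
    by (simp add: tendsto_in_prob_def)
  ultimately show ?thesis
    unfolding has_cylindrical_integral_def using assms
    by (intro conjI exI[of _ "\<lambda>_. g"] exI[of _ "\<lambda>_. X"] exI[of _ "C + 1"])
       (auto simp: has_regulated_integral_def)
qed


subsection \<open>Stochastic integrability\<close>

definition weakly_regulated :: "real \<Rightarrow> (real \<Rightarrow> 'v::real_inner \<Rightarrow>\<^sub>L 'v) \<Rightarrow> bool" where
  "weakly_regulated T f \<longleftrightarrow> (\<forall>v. regulated T (\<lambda>s. adjoint (blinfun_apply (f s)) v))"

definition stochastically_integrable ::
    "'w measure \<Rightarrow> (real \<Rightarrow> 'v::real_inner \<Rightarrow> 'w \<Rightarrow> real) \<Rightarrow> real \<Rightarrow> (real \<Rightarrow> 'v \<Rightarrow>\<^sub>L 'v) \<Rightarrow> bool" where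
  "stochastically_integrable M L T f \<longleftrightarrow> weakly_regulated T f \<and>
     (\<forall>A\<in>sets borel. A \<subseteq> {0..T} \<longrightarrow>
        (\<exists>I. I \<in> borel_measurable M \<and>
          (\<forall>v. has_cylindrical_integral M L T
             (\<lambda>s. indicator A s *\<^sub>R adjoint (blinfun_apply (f s)) v) (\<lambda>\<omega>. I \<omega> \<bullet> v))))"


subsection \<open>Semigroups and bases\<close>

definition strongly_continuous_semigroup_on ::
    "real \<Rightarrow> (real \<Rightarrow> 'v::real_normed_vector \<Rightarrow>\<^sub>L 'v) \<Rightarrow> bool" where
  "strongly_continuous_semigroup_on T S \<longleftrightarrow>
     S 0 = id_blinfun \<and>
     (\<forall>s\<ge>0. \<forall>t\<ge>0. s + t \<le> T \<longrightarrow> S (s + t) = S s o\<^sub>L S t) \<and>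
     (\<forall>v. continuous_on {0..T} (\<lambda>t. blinfun_apply (S t) v))"

definition orthonormal_basis :: "(nat \<Rightarrow> 'v::real_inner) \<Rightarrow> bool" where
  "orthonormal_basis e \<longleftrightarrow>
     (\<forall>i j. e i \<bullet> e j = (if i = j then 1 else 0)) \<and> closure (span (range e)) = UNIV"

end

theory Submission
  imports Defs
begin

text \<open>
  The semigroup is diagonal, so $S(s)^* = S(s)$ and the cylindrical integral of $1_A S(\cdot) v$ has the
  characteristic function $u \mapsto \exp(-\int_A \sum_k \theta_k(u e^{\gamma_k s} \langle v, e_k\rangle) ds)$
  with $\theta_k(y) = \int (1 - \cos(y \beta)) \nu_k(d\beta)$. Its coordinates $X_k$ along the basis
  are therefore independent, and an integral with values in $V$ exists iff
  $\sum_k X_k^2 < \infty$ almost surely. Averaging over an independent Gaussian frequency turns $\cos(u x)$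
  into $\exp(-x^2/2)$ and $1 - \cos(u y)$ into $1 - \exp(-y^2/2)$, which is comparable to $y^2 \wedge 1$.
  Hence $E(X_k^2 \wedge 1)$ is at most three times the $k$-th term $m_k$ of the series, which gives
  sufficiency. Conversely $E \exp(-\frac12 \sum_{k<N} X_k^2)$ is a product of Gaussian averages $a_k$
  that stays bounded away from 0, so that $\sum_k (1 - a_k) < \infty$, while $m_k \wedge 1 \le 432 (1 - a_k)$.
\<close>

subsection \<open>Orthonormal bases\<close>

text \<open>The cylindrical integral of \<open>1_A S v\<close> is not given but has to be
  constructed. The only quantitative hold on a simple integral is its characteristic function. This
  gives the Gaussian average a second task: it bounds tails by characteristic functions, so that
  characteristic functions tending to 1 yield convergence to 0 in probability, and hence the Cauchy
  property. Averaging matters because at one fixed frequency \<open>1 - cos (u * y)\<close> vanishes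
  for many large \<open>y\<close> and cannot dominate \<open>min (y^2) 1\<close>. The integral
  obtained is linear in \<open>v\<close> only almost surely, with an exceptional set depending on
  \<open>v\<close>. The vector \<open>I\<close> is therefore assembled from the countably many
  coordinates along the basis and afterwards matched with each \<open>v\<close> separately. Symmetry
  makes all exponents real and nonnegative: partial sums over \<open>k\<close> are monotone, and
  cutting the time set down to \<open>A\<close> can only decrease an exponent, so the estimates are
  uniform in \<open>A\<close>. Independence of the coordinates enters as additivity of the exponent
  over \<open>k\<close>, which factorises the joint characteristic function.\<close>

definition basis_proj :: "(nat \<Rightarrow> 'v::real_inner) \<Rightarrow> nat \<Rightarrow> 'v \<Rightarrow> 'v" where
  "basis_proj e N v = (\<Sum>k<N. (v \<bullet> e k) *\<^sub>R e k)"

text \<open>The two sorts together say separable Hilbert space: \<open>polish_space\<close> supplies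
  completeness and second countability.\<close>

locale onb =
  fixes e :: "nat \<Rightarrow> 'v::{real_inner, polish_space}"
  assumes onb: "orthonormal_basis e"
begin

lemma inner_basis: "e i \<bullet> e j = (if i = j then 1 else 0)"
  using onb by (simp add: orthonormal_basis_def)

lemma inner_sum_basis: "finite A \<Longrightarrow> (\<Sum>k\<in>A. c k *\<^sub>R e k) \<bullet> e j = (if j \<in> A then c j else 0)"
  by (simp add: inner_sum_left inner_basis if_distrib[of "(*) _"] cong: if_cong)

lemma norm_sum_basis: "finite A \<Longrightarrow> (norm (\<Sum>k\<in>A. c k *\<^sub>R e k))\<^sup>2 = (\<Sum>k\<in>A. (c k)\<^sup>2)"
proof -
  assume A: "finite A"
  have "(norm (\<Sum>k\<in>A. c k *\<^sub>R e k))\<^sup>2 = (\<Sum>k\<in>A. c k * ((\<Sum>k\<in>A. c k *\<^sub>R e k) \<bullet> e k))"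
    unfolding power2_norm_eq_inner by (subst inner_sum_right) simp
  also have "\<dots> = (\<Sum>k\<in>A. (c k)\<^sup>2)"
    by (intro sum.cong) (auto simp: inner_sum_basis[OF A] power2_eq_square)
  finally show ?thesis .
qed

lemma inner_basis_proj_left: "basis_proj e N v \<bullet> e j = (if j < N then v \<bullet> e j else 0)"
  unfolding basis_proj_def by (subst inner_sum_basis) auto

lemma basis_proj_residual_orthogonal:
  assumes "w \<in> span (e ` {..<N})"
  shows "(v - basis_proj e N v) \<bullet> w = 0"
  using assms
proof (induction w rule: span_induct)
  case base
  then show ?case by (simp add: subspace_def inner_add_right)
next
  case (step x)
  then show ?case by (auto simp: inner_diff_left inner_basis_proj_left)
qed

lemma basis_proj_in_span: "basis_proj e N v \<in> span (e ` {..<N})"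
  unfolding basis_proj_def by (intro span_sum span_scale span_base) auto

lemma norm_residual_le:
  assumes "w \<in> span (e ` {..<N})"
  shows "norm (v - basis_proj e N v) \<le> norm (v - w)"
proof -
  let ?p = "basis_proj e N v"
  have "?p - w \<in> span (e ` {..<N})" by (intro span_diff basis_proj_in_span assms)
  then have "(v - ?p) \<bullet> (?p - w) = 0" by (rule basis_proj_residual_orthogonal)
  then have "(norm (v - w))\<^sup>2 = (norm (v - ?p))\<^sup>2 + (norm (?p - w))\<^sup>2"
    using norm_add_Pythagorean[of "v - ?p" "?p - w"] by (simp add: orthogonal_def)
  then have "(norm (v - ?p))\<^sup>2 \<le> (norm (v - w))\<^sup>2" by simp
  then show ?thesis by (rule power2_le_imp_le) simp
qed

lemma norm_residual_le_norm: "norm (v - basis_proj e N v) \<le> norm v"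
  using norm_residual_le[of 0 N v] by (simp add: span_zero)

text \<open>Density gives one finite combination of basis vectors close to \<open>v\<close>.
  Projections are best approximations, so every projection onto a span containing that combination
  is at least as close.\<close>

lemma basis_proj_tendsto: "(\<lambda>N. basis_proj e N v) \<longlonglongrightarrow> v"
proof (rule LIMSEQ_I)
  fix r :: real assume "r > 0"
  have "v \<in> closure (span (range e))" using onb by (simp add: orthonormal_basis_def)
  then obtain w where w: "w \<in> span (range e)" "dist w v < r"
    using \<open>r > 0\<close> closure_approachable by blast
  from w(1) obtain t c where t: "finite t" "t \<subseteq> range e" "w = (\<Sum>a\<in>t. c a *\<^sub>R a)"
    by (auto simp: span_explicit)
  from finite_subset_image[OF t(1,2)] obtain K where K: "finite K" "t = e ` K" by blast
  obtain M where M: "K \<subseteq> {..<M}" using K(1) finite_nat_iff_bounded by blast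
  have "norm (basis_proj e N v - v) < r" if "N \<ge> M" for N
  proof -
    have "w \<in> span (e ` {..<N})"
      unfolding t(3) using K M that by (intro span_sum span_scale span_base) auto
    then have "norm (v - basis_proj e N v) \<le> norm (v - w)" by (rule norm_residual_le)
    with w(2) show ?thesis by (simp add: dist_norm norm_minus_commute)
  qed
  then show "\<exists>no. \<forall>n\<ge>no. norm (basis_proj e n v - v) < r" by blast
qed

lemma eqI_coeffs: "(\<And>k. v \<bullet> e k = w \<bullet> e k) \<Longrightarrow> v = w"
  using LIMSEQ_unique[OF basis_proj_tendsto[of v], of w] basis_proj_tendsto[of w]
  by (simp add: basis_proj_def)

lemma sums_inner: "(\<lambda>k. (x \<bullet> e k) * (y \<bullet> e k)) sums (x \<bullet> y)"
proof -
  have "(\<lambda>N. basis_proj e N x \<bullet> y) \<longlonglongrightarrow> x \<bullet> y"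
    by (intro tendsto_intros basis_proj_tendsto)
  then show ?thesis
    unfolding sums_def basis_proj_def inner_sum_left by (simp add: inner_commute)
qed

lemma Bessel: "(\<Sum>k<N. (v \<bullet> e k)\<^sup>2) \<le> (norm v)\<^sup>2"
proof -
  have "(\<Sum>k<N. (v \<bullet> e k) * (v \<bullet> e k)) \<le> v \<bullet> v"
    using sums_inner[of v v] sum_le_suminf[of "\<lambda>k. (v \<bullet> e k) * (v \<bullet> e k)" "{..<N}"]
    by (auto simp: sums_iff)
  then show ?thesis unfolding power2_norm_eq_inner by (simp add: power2_eq_square)
qed

text \<open>Riesz-Fischer. Completeness of the space enters here, through
  \<open>Cauchy_convergent\<close>; both the adjoints and the vector-valued integral are obtained
  from this lemma.\<close>

lemma square_summable_convergent:
  assumes "summable (\<lambda>k. (c k)\<^sup>2)"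
  shows "convergent (\<lambda>N. \<Sum>k<N. c k *\<^sub>R e k)"
proof -
  have dist_le: "dist (\<Sum>k<m. c k *\<^sub>R e k) (\<Sum>k<n. c k *\<^sub>R e k) = sqrt (\<Sum>k=n..<m. (c k)\<^sup>2)"
    if "n \<le> m" for m n
  proof -
    have *: "(\<Sum>k<m. c k *\<^sub>R e k) = (\<Sum>k<n. c k *\<^sub>R e k) + (\<Sum>k=n..<m. c k *\<^sub>R e k)"
      using sum.atLeastLessThan_concat[of 0 n m "\<lambda>k. c k *\<^sub>R e k"] that
      by (simp add: atLeast0LessThan)
    show ?thesis
      by (simp add: * dist_norm norm_sum_basis[symmetric])
  qed
  have "Cauchy (\<lambda>N. \<Sum>k<N. c k *\<^sub>R e k)"
  proof (rule metric_CauchyI)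
    fix r :: real assume "r > 0"
    then have "r\<^sup>2 > 0" by simp
    with assms[unfolded summable_Cauchy] obtain N
      where N: "\<And>m n. m \<ge> N \<Longrightarrow> norm (\<Sum>k=m..<n. (c k)\<^sup>2) < r\<^sup>2"
      by meson
    have "dist (\<Sum>k<m. c k *\<^sub>R e k) (\<Sum>k<n. c k *\<^sub>R e k) < r" if "n \<ge> N" "n \<le> m" for m n
    proof -
      have "sqrt (\<Sum>k=n..<m. (c k)\<^sup>2) < r"
        using N[OF that(1), of m] \<open>r > 0\<close> by (intro real_less_lsqrt) (auto intro: sum_nonneg)
      then show ?thesis using dist_le[OF that(2)] by simp
    qed
    then show "\<exists>M. \<forall>m\<ge>M. \<forall>n\<ge>M. dist (\<Sum>k<m. c k *\<^sub>R e k) (\<Sum>k<n. c k *\<^sub>R e k) < r"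
      by (metis dist_commute nle_le)
  qed
  then show ?thesis by (rule Cauchy_convergent)
qed

text \<open>Since \<^const>\<open>adjoint\<close> is a Hilbert choice, nothing can be said about it before the
  existence of an adjoint is known.\<close>

lemma adjoint_blinfun:
  fixes A :: "'v \<Rightarrow>\<^sub>L 'v"
  shows "blinfun_apply A x \<bullet> y = x \<bullet> adjoint (blinfun_apply A) y"
proof -
  have "\<exists>z. \<forall>x. blinfun_apply A x \<bullet> y = x \<bullet> z" for y
  proof -
    define c where "c k = blinfun_apply A (e k) \<bullet> y" for k
    have bound: "(\<Sum>k<N. (c k)\<^sup>2) \<le> (norm A * norm y)\<^sup>2" for N
    proof -
      \<comment> \<open>Testing with the vector whose coordinates are the \<open>c k\<close>
        themselves makes its squared norm equal to the pairing of \<open>A s\<close> with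
        \<open>y\<close>. Cauchy-Schwarz and division by \<open>norm s\<close> then bound it
        independently of \<open>N\<close>.\<close>
      define s where "s = (\<Sum>k<N. c k *\<^sub>R e k)"
      have s: "(norm s)\<^sup>2 = (\<Sum>k<N. (c k)\<^sup>2)" unfolding s_def by (simp add: norm_sum_basis)
      have "(norm s)\<^sup>2 = blinfun_apply A s \<bullet> y"
        unfolding s by (simp add: s_def blinfun.sum_right blinfun.scaleR_right inner_sum_left
            c_def power2_eq_square)
      also have "\<dots> \<le> norm (blinfun_apply A s) * norm y" by (rule norm_cauchy_schwarz)
      also have "\<dots> \<le> (norm A * norm s) * norm y" by (intro mult_right_mono norm_blinfun) auto
      finally have "norm s * norm s \<le> (norm A * norm y) * norm s"
        by (simp add: power2_eq_square mult_ac)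
      then have "norm s \<le> norm A * norm y"
        by (cases "norm s = 0") (auto simp: mult_le_cancel_right)
      then show ?thesis using s by (metis norm_ge_zero power_mono)
    qed
    have "summable (\<lambda>k. (c k)\<^sup>2)"
      by (rule summableI_nonneg_bounded[OF _ bound]) auto
    from square_summable_convergent[OF this] obtain z
      where z: "(\<lambda>N. \<Sum>k<N. c k *\<^sub>R e k) \<longlonglongrightarrow> z" by (auto simp: convergent_def)
    have "blinfun_apply A x \<bullet> y = x \<bullet> z" for x
    proof (rule LIMSEQ_unique)
      show "(\<lambda>N. blinfun_apply A (basis_proj e N x) \<bullet> y) \<longlonglongrightarrow> blinfun_apply A x \<bullet> y"
        by (intro tendsto_intros basis_proj_tendsto)
      have "blinfun_apply A (basis_proj e N x) \<bullet> y = x \<bullet> (\<Sum>k<N. c k *\<^sub>R e k)" for N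
        by (simp add: basis_proj_def blinfun.sum_right blinfun.scaleR_right inner_sum_left
            inner_sum_right c_def mult.commute)
      then show "(\<lambda>N. blinfun_apply A (basis_proj e N x) \<bullet> y) \<longlonglongrightarrow> x \<bullet> z"
        by (simp add: tendsto_inner[OF tendsto_const z])
    qed
    then show ?thesis by blast
  qed
  then obtain f' where f': "\<forall>x y. blinfun_apply A x \<bullet> y = x \<bullet> f' y" by metis
  then have "\<forall>x y. blinfun_apply A x \<bullet> y = x \<bullet> adjoint (blinfun_apply A) y"
    unfolding adjoint_def by (rule someI[of "\<lambda>f'. \<forall>x y. blinfun_apply A x \<bullet> y = x \<bullet> f' y"])
  then show ?thesis by blast
qed

text \<open>Moving \<open>A\<close> across the inner product shows that it acts on coefficients by
  the same real factors \<open>c k\<close>, so it is self-adjoint. From here on the adjoint can be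
  replaced by the operator itself, whose linearity and boundedness come with its type.\<close>

lemma diagonal_adjoint:
  fixes A :: "'v \<Rightarrow>\<^sub>L 'v"
  assumes "\<And>k. adjoint (blinfun_apply A) (e k) = c k *\<^sub>R e k"
  shows "blinfun_apply A v \<bullet> e k = c k * (v \<bullet> e k)"
    and "adjoint (blinfun_apply A) v = blinfun_apply A v"
proof -
  show *: "blinfun_apply A v \<bullet> e k = c k * (v \<bullet> e k)" for v k
    using adjoint_blinfun[of A v "e k"] assms by simp
  have "blinfun_apply A (e k) = c k *\<^sub>R e k" for k
    by (rule eqI_coeffs) (simp add: * inner_basis)
  then show "adjoint (blinfun_apply A) v = blinfun_apply A v"
    using adjoint_blinfun[of A "e _" v]
    by (intro eqI_coeffs) (simp add: *, simp add: inner_commute)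
qed

end

subsection \<open>Elementary inequalities\<close>

lemma one_minus_cos_le: "1 - cos (y::real) \<le> y\<^sup>2 / 2"
proof -
  have "1 - cos y = 2 * (sin (y / 2))\<^sup>2"
    using cos_double_sin[of "y / 2"] by simp
  also have "\<dots> \<le> 2 * (y / 2)\<^sup>2"
    using abs_sin_x_le_abs_x[of "y / 2"] by (simp only: mult_le_cancel_left_pos abs_le_square_iff)
  finally show ?thesis by (simp add: power2_eq_square)
qed

lemma one_minus_cos_double_le: "1 - cos (2 * x) \<le> 4 * (1 - cos (x::real))"
proof -
  have "1 - cos (2 * x) = 2 * ((1 - cos x) * (1 + cos x))"
    unfolding cos_double_cos by (simp add: power2_eq_square algebra_simps)
  also have "\<dots> \<le> 2 * ((1 - cos x) * 2)"
    by (intro mult_left_mono) auto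
  finally show ?thesis by simp
qed

text \<open>For small \<open>y\<close> the left side is at most \<open>u^2 * y^2 / 2\<close>, for
  large \<open>y\<close> at most 2, and \<open>2 * (1 + u^2)\<close> covers both. The growth in
  \<open>u\<close> is polynomial, so the bound and its square are integrable for a Gaussian
  frequency.\<close>

lemma one_minus_cos_scaled_le: "1 - cos (u * y) \<le> 2 * (1 + u\<^sup>2) * min (y\<^sup>2) (1::real)"
proof (cases "y\<^sup>2 \<le> 1")
  case True
  have "1 - cos (u * y) \<le> u\<^sup>2 * y\<^sup>2 / 2"
    using one_minus_cos_le[of "u * y"] by (simp add: power_mult_distrib)
  also have "\<dots> \<le> 2 * (1 + u\<^sup>2) * y\<^sup>2" by (simp add: algebra_simps)
  finally show ?thesis using True by simp
next
  case False
  have "1 - cos (u * y) \<le> 2 * (1 + u\<^sup>2)"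
    using cos_ge_minus_one[of "u * y"] zero_le_power2[of u] unfolding distrib_left by linarith
  then show ?thesis using False by simp
qed

lemma one_minus_exp_gauss_le: "1 - exp (- (y\<^sup>2) / 2) \<le> min (y\<^sup>2) (1::real)"
proof -
  have "1 - exp (- (y\<^sup>2) / 2) \<le> y\<^sup>2 / 2"
    using exp_ge_add_one_self[of "- (y\<^sup>2) / 2"] by simp
  then have "1 - exp (- (y\<^sup>2) / 2) \<le> y\<^sup>2" using zero_le_power2[of y] by linarith
  then show ?thesis by simp
qed

lemma min_one_le_gauss: "min (y\<^sup>2) (1::real) \<le> 3 * (1 - exp (- (y\<^sup>2) / 2))"
proof -
  define m where "m = min (y\<^sup>2) (1::real)"
  have m: "0 \<le> m" "m \<le> 1" "m \<le> y\<^sup>2" by (auto simp: m_def)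
  have "(1 + m / 2) * exp (- (m / 2)) \<le> 1"
    using exp_ge_add_one_self[of "m / 2"] by (simp add: exp_minus field_simps)
  then have "exp (- (m / 2)) \<le> 1 / (1 + m / 2)"
    using m by (simp add: field_simps)
  \<comment> \<open>The origin of the constant 3: \<open>1 - 1 / (1 + m / 2)\<close> equals
    \<open>(m / 2) / (1 + m / 2)\<close>, and the denominator is at most 3/2 because
    \<open>m \<le> 1\<close>.\<close>
  also have "\<dots> \<le> 1 - m / 3"
    using m mult_nonneg_nonneg[of m "1 - m"] by (simp add: field_simps)
  finally have "exp (- (m / 2)) \<le> 1 - m / 3" .
  moreover have "exp (- (y\<^sup>2) / 2) \<le> exp (- (m / 2))" using m by simp
  ultimately have "m \<le> 3 * (1 - exp (- (y\<^sup>2) / 2))" by argo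
  then show ?thesis unfolding m_def .
qed

lemma one_minus_exp_ge:
  fixes x :: real assumes "0 \<le> x" shows "x - x\<^sup>2 / 2 \<le> 1 - exp (- x)"
proof -
  have "((\<lambda>t. 1 - exp (- t) - t + t\<^sup>2 / 2) has_real_derivative (exp (- t) - 1 + t)) (at t)" for t :: real
    by (auto intro!: derivative_eq_intros)
  then have "1 - exp (- 0) - 0 + 0\<^sup>2 / 2 \<le> 1 - exp (- x) - x + x\<^sup>2 / 2"
    using exp_ge_add_one_self[of "- t" for t :: real]
    by (intro DERIV_nonneg_imp_nondecreasing[OF assms]) (auto simp: algebra_simps intro!: exI)
  then show ?thesis by simp
qed


subsection \<open>Gaussian averages\<close>

lemma prob_space_std_normal: "prob_space std_normal_distribution"
  using real_dist_normal_dist by (simp add: real_distribution_def)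

lemma gauss_iexp: "(CLINT u|std_normal_distribution. iexp (y * u)) = complex_of_real (exp (- (y\<^sup>2) / 2))"
  using char_std_normal_distribution by (simp add: char_def fun_eq_iff)

lemma gauss_cos: "(LINT u|std_normal_distribution. cos (u * y)) = exp (- (y\<^sup>2) / 2)"
proof -
  interpret G: prob_space std_normal_distribution by (rule prob_space_std_normal)
  have "integrable std_normal_distribution (\<lambda>u. iexp (y * u))"
    by (intro G.integrable_iexp) auto
  then have "Re (CLINT u|std_normal_distribution. iexp (y * u)) = (LINT u|std_normal_distribution. Re (iexp (y * u)))"
    by (rule integral_Re[symmetric])
  then show ?thesis unfolding gauss_iexp by (simp add: Re_exp mult.commute)
qed

lemma gauss_one_minus_cos:
  "(\<integral>\<^sup>+u. ennreal (1 - cos (u * y)) \<partial>std_normal_distribution) = ennreal (1 - exp (- (y\<^sup>2) / 2))"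
proof -
  interpret G: prob_space std_normal_distribution by (rule prob_space_std_normal)
  have int: "integrable std_normal_distribution (\<lambda>u. cos (u * y))"
    by (rule G.integrable_const_bound[of _ 1]) auto
  then have "(\<integral>\<^sup>+u. ennreal (1 - cos (u * y)) \<partial>std_normal_distribution)
      = ennreal (LINT u|std_normal_distribution. 1 - cos (u * y))"
    by (intro nn_integral_eq_integral) auto
  also have "(LINT u|std_normal_distribution. 1 - cos (u * y)) = 1 - exp (- (y\<^sup>2) / 2)"
    using int G.prob_space by (simp add: gauss_cos)
  finally show ?thesis .
qed

text \<open>The second and fourth moments are 1 and 3, so expanding the square gives 1 + 2 +
  3.\<close>

lemma gauss_fourth_moment_bound:
  "integrable std_normal_distribution (\<lambda>u. (1 + u\<^sup>2)\<^sup>2)"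
  "(LINT u|std_normal_distribution. (1 + u\<^sup>2)\<^sup>2) = (6::real)"
proof -
  interpret G: prob_space std_normal_distribution by (rule prob_space_std_normal)
  \<comment> \<open>The exponents keep the shape \<open>2 * k\<close> to match the formula for even
    moments.\<close>
  have *: "(\<lambda>u::real. (1 + u\<^sup>2)\<^sup>2) = (\<lambda>u. 1 + (2 * u ^ (2 * 1) + u ^ (2 * 2)))"
    by (auto simp: power2_eq_square algebra_simps power4_eq_xxxx)
  have i: "integrable std_normal_distribution (\<lambda>u::real. u ^ (2 * 1))"
     "integrable std_normal_distribution (\<lambda>u::real. u ^ (2 * 2))"
    by (rule std_normal_distribution_even_moments(2))+
  show "integrable std_normal_distribution (\<lambda>u::real. (1 + u\<^sup>2)\<^sup>2)"
    unfolding * using i by (intro Bochner_Integration.integrable_add integrable_mult_right) auto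
  have "(LINT u|std_normal_distribution. (1 + u\<^sup>2)\<^sup>2) =
      1 + (2 * (LINT u|std_normal_distribution. u ^ (2 * 1)) + (LINT u|std_normal_distribution. u ^ (2 * 2)))"
    unfolding * using i G.prob_space
    by (subst Bochner_Integration.integral_add) (auto simp del: mult_1_right)
  also have "\<dots> = (6::real)"
    unfolding std_normal_distribution_even_moments(1) by (simp add: fact_numeral)
  finally show "(LINT u|std_normal_distribution. (1 + u\<^sup>2)\<^sup>2) = (6::real)" .
qed


subsection \<open>Convergence in probability\<close>

context prob_space
begin

lemma tendsto_in_prob_AE_cong:
  assumes "\<And>n. AE \<omega> in M. X n \<omega> = X' n \<omega>" "AE \<omega> in M. Y \<omega> = Y' \<omega>"
    and [measurable]: "\<And>n. X n \<in> borel_measurable M" "\<And>n. X' n \<in> borel_measurable M"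
      "Y \<in> borel_measurable M" "Y' \<in> borel_measurable M"
    and "tendsto_in_prob M X Y F"
  shows "tendsto_in_prob M X' Y' F"
proof -
  have "prob {\<omega> \<in> space M. \<epsilon> < \<bar>X n \<omega> - Y \<omega>\<bar>} = prob {\<omega> \<in> space M. \<epsilon> < \<bar>X' n \<omega> - Y' \<omega>\<bar>}" for \<epsilon> n
    using assms(1)[of n] assms(2) by (intro measure_eq_AE) (auto, measurable)
  then show ?thesis using assms(7) by (simp add: tendsto_in_prob_def)
qed

lemma tendsto_in_prob_add:
  assumes [measurable]: "\<And>n. X n \<in> borel_measurable M" "X' \<in> borel_measurable M"
      "\<And>n. Y n \<in> borel_measurable M" "Y' \<in> borel_measurable M"
    and X: "tendsto_in_prob M X X' F" and Y: "tendsto_in_prob M Y Y' F"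
  shows "tendsto_in_prob M (\<lambda>n \<omega>. X n \<omega> + Y n \<omega>) (\<lambda>\<omega>. X' \<omega> + Y' \<omega>) F"
  unfolding tendsto_in_prob_def
proof (intro allI impI)
  fix \<epsilon> :: real assume "\<epsilon> > 0"
  let ?a = "\<lambda>n. prob {\<omega> \<in> space M. \<epsilon> / 2 < \<bar>X n \<omega> - X' \<omega>\<bar>}"
  let ?b = "\<lambda>n. prob {\<omega> \<in> space M. \<epsilon> / 2 < \<bar>Y n \<omega> - Y' \<omega>\<bar>}"
  have lim: "((\<lambda>n. ?a n + ?b n) \<longlongrightarrow> 0 + 0) F"
    using X[unfolded tendsto_in_prob_def, rule_format, of "\<epsilon> / 2"]
      Y[unfolded tendsto_in_prob_def, rule_format, of "\<epsilon> / 2"] \<open>\<epsilon> > 0\<close>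
    by (intro tendsto_add) simp_all
  have le: "prob {\<omega> \<in> space M. \<epsilon> < \<bar>X n \<omega> + Y n \<omega> - (X' \<omega> + Y' \<omega>)\<bar>} \<le> ?a n + ?b n" for n
  proof -
    have "prob {\<omega> \<in> space M. \<epsilon> < \<bar>X n \<omega> + Y n \<omega> - (X' \<omega> + Y' \<omega>)\<bar>}
      \<le> prob ({\<omega> \<in> space M. \<epsilon> / 2 < \<bar>X n \<omega> - X' \<omega>\<bar>} \<union> {\<omega> \<in> space M. \<epsilon> / 2 < \<bar>Y n \<omega> - Y' \<omega>\<bar>})"
      by (intro finite_measure_mono) (auto, argo)
    also have "\<dots> \<le> ?a n + ?b n"
      by (intro measure_Un_le) auto
    finally show ?thesis .
  qed
  show "((\<lambda>n. prob {\<omega> \<in> space M. \<epsilon> < \<bar>X n \<omega> + Y n \<omega> - (X' \<omega> + Y' \<omega>)\<bar>}) \<longlongrightarrow> 0) F"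
    by (rule tendsto_sandwich[where f = "\<lambda>_. 0" and h = "\<lambda>n. ?a n + ?b n"]) (use lim le in auto)
qed

lemma tendsto_in_prob_scale:
  assumes X: "tendsto_in_prob M X X' F"
  shows "tendsto_in_prob M (\<lambda>n \<omega>. a * X n \<omega>) (\<lambda>\<omega>. a * X' \<omega>) F"
proof (cases "a = 0")
  case False
  have "\<epsilon> < \<bar>a * x - a * y\<bar> \<longleftrightarrow> \<epsilon> / \<bar>a\<bar> < \<bar>x - y\<bar>" for \<epsilon> x y :: real
    using False
    by (simp add: right_diff_distrib[symmetric] abs_mult pos_divide_less_eq mult.commute
        del: right_diff_distrib)
  then show ?thesis using X False by (simp add: tendsto_in_prob_def)
qed (simp add: tendsto_in_prob_def)

lemma tendsto_in_prob_AE: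
  fixes X :: "nat \<Rightarrow> 'a \<Rightarrow> real"
  assumes [measurable]: "\<And>n. X n \<in> borel_measurable M" "Y \<in> borel_measurable M"
    and lim: "AE \<omega> in M. (\<lambda>n. X n \<omega>) \<longlonglongrightarrow> Y \<omega>"
  shows "tendsto_in_prob M X Y sequentially"
  unfolding tendsto_in_prob_def
proof (intro allI impI)
  fix \<epsilon> :: real assume "\<epsilon> > 0"
  let ?A = "\<lambda>n. {\<omega> \<in> space M. \<epsilon> < \<bar>X n \<omega> - Y \<omega>\<bar>}"
  have "(\<lambda>n. LINT \<omega>|M. indicator (?A n) \<omega>) \<longlonglongrightarrow> (LINT \<omega>|M. (0::real))"
  proof (rule integral_dominated_convergence[where w="\<lambda>_. 1"])
    show "AE \<omega> in M. (\<lambda>n. indicator (?A n) \<omega>) \<longlonglongrightarrow> (0::real)"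
      using lim
    proof eventually_elim
      case (elim \<omega>)
      then have "\<forall>\<^sub>F n in sequentially. dist (X n \<omega>) (Y \<omega>) < \<epsilon>"
        using \<open>\<epsilon> > 0\<close> by (rule tendstoD)
      then have "\<forall>\<^sub>F n in sequentially. indicator (?A n) \<omega> = (0::real)"
        by eventually_elim (auto simp: dist_real_def)
      then show ?case by (rule tendsto_eventually)
    qed
  qed auto
  then show "(\<lambda>n. prob (?A n)) \<longlonglongrightarrow> 0" by simp
qed

lemma AE_eq_if_small:
  fixes X Y :: "'a \<Rightarrow> real"
  assumes [measurable]: "X \<in> borel_measurable M" "Y \<in> borel_measurable M"
    and small: "\<And>\<epsilon>. \<epsilon> > 0 \<Longrightarrow> prob {\<omega> \<in> space M. \<epsilon> < \<bar>X \<omega> - Y \<omega>\<bar>} = 0"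
  shows "AE \<omega> in M. X \<omega> = Y \<omega>"
proof -
  have "AE \<omega> in M. \<not> inverse (real (Suc n)) < \<bar>X \<omega> - Y \<omega>\<bar>" for n
    using small[of "inverse (real (Suc n))"]
    by (subst AE_iff_measurable[OF _ refl]) (auto simp: emeasure_eq_measure)
  then have "AE \<omega> in M. \<forall>n. \<not> inverse (real (Suc n)) < \<bar>X \<omega> - Y \<omega>\<bar>"
    by (simp add: AE_all_countable)
  then show ?thesis
  proof eventually_elim
    case (elim \<omega>)
    then show ?case using reals_Archimedean[of "\<bar>X \<omega> - Y \<omega>\<bar>"] by auto
  qed
qed

lemma tendsto_in_prob_unique:
  assumes [measurable]: "\<And>n. X n \<in> borel_measurable M" "Y \<in> borel_measurable M" "Z \<in> borel_measurable M"
    and Y: "tendsto_in_prob M X Y sequentially" and Z: "tendsto_in_prob M X Z sequentially"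
  shows "AE \<omega> in M. Y \<omega> = Z \<omega>"
proof (rule AE_eq_if_small)
  \<comment> \<open>The left side is constantly 0, so the probability that \<open>Y\<close> and
    \<open>Z\<close> differ by more than a given bound is a constant sequence tending to 0.\<close>
  have "tendsto_in_prob M (\<lambda>n \<omega>. X n \<omega> + (-1) * X n \<omega>) (\<lambda>\<omega>. Y \<omega> + (-1) * Z \<omega>) sequentially"
    by (intro tendsto_in_prob_add tendsto_in_prob_scale Y Z) measurable
  then show "prob {\<omega> \<in> space M. \<epsilon> < \<bar>Y \<omega> - Z \<omega>\<bar>} = 0" if "\<epsilon> > 0" for \<epsilon>
    using that by (simp add: tendsto_in_prob_def LIMSEQ_const_iff abs_minus_commute)
qed measurable

text \<open>Where the variables are close, \<open>iexp\<close> is Lipschitz with constant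
  \<open>\<bar>u\<bar>\<close>; elsewhere the two values differ by at most 2, on a set of small
  probability. The filter is kept general because continuity in time is needed besides
  sequences.\<close>

lemma char_tendsto_in_prob:
  assumes [measurable]: "\<And>n. X n \<in> borel_measurable M" "Y \<in> borel_measurable M"
    and lim: "tendsto_in_prob M X Y F"
  shows "((\<lambda>n. char (distr M borel (X n)) u) \<longlongrightarrow> char (distr M borel Y) u) F"
proof (rule tendstoI)
  fix r :: real assume "r > 0"
  \<comment> \<open>Chosen so that \<open>\<bar>u\<bar> * \<epsilon> \<le> r / 2\<close>; the added
    1 covers \<open>u = 0\<close>.\<close>
  define \<epsilon> where "\<epsilon> = r / (2 * (\<bar>u\<bar> + 1))"
  have "\<epsilon> > 0" using \<open>r > 0\<close> by (simp add: \<epsilon>_def)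
  let ?A = "\<lambda>n. {\<omega> \<in> space M. \<epsilon> < \<bar>X n \<omega> - Y \<omega>\<bar>}"
  have bound: "dist (char (distr M borel (X n)) u) (char (distr M borel Y) u) \<le> r / 2 + 2 * prob (?A n)" for n
  proof -
    have i: "integrable M (\<lambda>\<omega>. iexp (u * X n \<omega>))" "integrable M (\<lambda>\<omega>. iexp (u * Y \<omega>))"
      by (intro integrable_iexp; simp)+
    have ind: "integrable M (indicat_real (?A n))"
      by (rule integrable_const_bound[of _ 1]) (auto simp: indicator_def)
    have "char (distr M borel (X n)) u - char (distr M borel Y) u
        = (CLINT \<omega>|M. iexp (u * X n \<omega>) - iexp (u * Y \<omega>))"
      using i by (simp add: char_def integral_distr)
    also have "norm \<dots> \<le> (LINT \<omega>|M. r / 2 + 2 * indicator (?A n) \<omega>)"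
    proof (rule order_trans[OF integral_norm_bound integral_mono])
      fix \<omega> assume \<omega>: "\<omega> \<in> space M"
      have "iexp (u * X n \<omega>) - iexp (u * Y \<omega>) = iexp (u * Y \<omega>) * (iexp (u * (X n \<omega> - Y \<omega>)) - 1)"
        by (simp add: right_diff_distrib exp_add[symmetric] algebra_simps)
      then have eq: "norm (iexp (u * X n \<omega>) - iexp (u * Y \<omega>)) = norm (iexp (u * (X n \<omega> - Y \<omega>)) - 1)"
        by (simp add: norm_mult)
      show "norm (iexp (u * X n \<omega>) - iexp (u * Y \<omega>)) \<le> r / 2 + 2 * indicator (?A n) \<omega>"
      proof (cases "\<omega> \<in> ?A n")
        case True
        have "norm (iexp (u * X n \<omega>) - iexp (u * Y \<omega>)) \<le> norm (iexp (u * X n \<omega>)) + norm (iexp (u * Y \<omega>))"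
          by (rule norm_triangle_ineq4)
        then show ?thesis using True \<open>r > 0\<close> by simp
      next
        case False
        then have "\<bar>X n \<omega> - Y \<omega>\<bar> \<le> \<epsilon>" using \<omega> by auto
        then have "\<bar>u\<bar> * \<bar>X n \<omega> - Y \<omega>\<bar> \<le> (\<bar>u\<bar> + 1) * \<epsilon>" using \<open>\<epsilon> > 0\<close> by (intro mult_mono) auto
        also have "\<dots> = r / 2" unfolding \<epsilon>_def by (simp add: field_simps)
        finally have "\<bar>u * (X n \<omega> - Y \<omega>)\<bar> \<le> r / 2" by (simp add: abs_mult)
        with iexp_approx1[of "u * (X n \<omega> - Y \<omega>)" 0] eq False show ?thesis by simp
      qed
    qed (use i ind in \<open>auto intro!: Bochner_Integration.integrable_add integrable_mult_right\<close>)
    also have "\<dots> = r / 2 + 2 * prob (?A n)"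
      using ind by (subst Bochner_Integration.integral_add) (auto simp: prob_space)
    finally show ?thesis by (simp add: dist_norm)
  qed
  have "\<forall>\<^sub>F n in F. prob (?A n) < r / 4"
    using lim \<open>\<epsilon> > 0\<close> \<open>r > 0\<close> unfolding tendsto_in_prob_def by (intro order_tendstoD) auto
  then show "\<forall>\<^sub>F n in F. dist (char (distr M borel (X n)) u) (char (distr M borel Y) u) < r"
  proof eventually_elim
    case (elim n)
    then show ?case using bound[of n] by linarith
  qed
qed

text \<open>Fubini for \<open>1 - cos (u * (a * X))\<close> with an independent standard Gaussian
  \<open>u\<close>: integrating over \<open>u\<close> first produces the left side, over the
  probability space first the right side.\<close>

lemma expectation_gauss_char:
  assumes [measurable]: "X \<in> borel_measurable M"
  shows "expectation (\<lambda>\<omega>. 1 - exp (- ((a * X \<omega>)\<^sup>2) / 2))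
    = (LINT u|std_normal_distribution. 1 - Re (char (distr M borel X) (a * u)))"
proof -
  interpret G: prob_space std_normal_distribution by (rule prob_space_std_normal)
  interpret P: pair_prob_space M std_normal_distribution ..
  have int: "integrable (M \<Otimes>\<^sub>M std_normal_distribution) (case_prod (\<lambda>\<omega> u. 1 - cos (u * (a * X \<omega>))))"
  proof (rule P.integrable_const_bound[of _ 2])
    have "\<bar>1 - cos x\<bar> \<le> 2" for x :: real
      using cos_ge_minus_one[of x] cos_le_one[of x] by linarith
    then show "AE x in M \<Otimes>\<^sub>M std_normal_distribution.
        norm (case x of (\<omega>, u) \<Rightarrow> 1 - cos (u * (a * X \<omega>))) \<le> 2"
      by (auto split: prod.split)
  qed measurable
  have 1: "(LINT u|std_normal_distribution. 1 - cos (u * (a * X \<omega>))) = 1 - exp (- ((a * X \<omega>)\<^sup>2) / 2)" for \<omega>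
  proof -
    have "integrable std_normal_distribution (\<lambda>u. cos (u * (a * X \<omega>)))"
      by (rule G.integrable_const_bound[of _ 1]) auto
    then show ?thesis using G.prob_space by (simp add: gauss_cos)
  qed
  have 2: "(LINT \<omega>|M. 1 - cos (u * (a * X \<omega>))) = 1 - Re (char (distr M borel X) (a * u))" for u
  proof -
    have "integrable M (\<lambda>\<omega>. iexp (a * u * X \<omega>))" by (intro integrable_iexp) auto
    then have "Re (CLINT \<omega>|M. iexp (a * u * X \<omega>)) = (LINT \<omega>|M. Re (iexp (a * u * X \<omega>)))"
      by (rule integral_Re[symmetric])
    then have "Re (char (distr M borel X) (a * u)) = (LINT \<omega>|M. cos (u * (a * X \<omega>)))"
      by (simp add: char_def integral_distr Re_exp mult_ac)
    moreover have "integrable M (\<lambda>\<omega>. cos (u * (a * X \<omega>)))"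
      by (rule integrable_const_bound[of _ 1]) auto
    ultimately show ?thesis by (simp add: prob_space)
  qed
  show ?thesis using P.Fubini_integral[OF int] unfolding 1 2 by simp
qed

text \<open>A truncation inequality: the indicator of the tail is at most
  \<open>min ((X / \<epsilon>)^2) 1\<close>, hence at most three times the Gaussian expression,
  whose expectation is an average of the characteristic function.\<close>

lemma prob_le_gauss_char:
  assumes [measurable]: "X \<in> borel_measurable M" and "\<epsilon> > 0"
  shows "prob {\<omega> \<in> space M. \<epsilon> < \<bar>X \<omega>\<bar>}
    \<le> 3 * (LINT u|std_normal_distribution. 1 - Re (char (distr M borel X) (u / \<epsilon>)))"
proof -
  let ?A = "{\<omega> \<in> space M. \<epsilon> < \<bar>X \<omega>\<bar>}"
  have int: "integrable M (\<lambda>\<omega>. 1 - exp (- ((inverse \<epsilon> * X \<omega>)\<^sup>2) / 2))"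
    by (rule integrable_const_bound[of _ 1]) auto
  have "prob ?A = (LINT \<omega>|M. indicator ?A \<omega>)" by simp
  also have "\<dots> \<le> (LINT \<omega>|M. 3 * (1 - exp (- ((inverse \<epsilon> * X \<omega>)\<^sup>2) / 2)))"
  proof (intro integral_mono integrable_mult_right int)
    fix \<omega>
    have "indicator ?A \<omega> \<le> min ((inverse \<epsilon> * X \<omega>)\<^sup>2) (1::real)"
    proof (cases "\<omega> \<in> ?A")
      case True
      then have "1 \<le> \<bar>inverse \<epsilon> * X \<omega>\<bar>" using \<open>\<epsilon> > 0\<close> by (simp add: abs_mult field_simps)
      then have "1 \<le> (inverse \<epsilon> * X \<omega>)\<^sup>2" using abs_le_square_iff[of 1 "inverse \<epsilon> * X \<omega>"] by simp
      then show ?thesis using True by simp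
    qed auto
    also note min_one_le_gauss
    finally show "indicator ?A \<omega> \<le> 3 * (1 - exp (- ((inverse \<epsilon> * X \<omega>)\<^sup>2) / 2))" .
  next
    show "integrable M (indicator ?A :: 'a \<Rightarrow> real)"
      by (rule integrable_const_bound[of _ 1]) (auto simp: indicator_def)
  qed
  also have "\<dots> = 3 * (LINT u|std_normal_distribution. 1 - Re (char (distr M borel X) (inverse \<epsilon> * u)))"
    unfolding expectation_gauss_char[OF assms(1), symmetric] by (rule integral_mult_right_zero)
  finally show ?thesis by (simp only: divide_inverse mult.commute[of _ "inverse \<epsilon>"])
qed

text \<open>The continuity theorem for the limit 0. The truncation inequality reduces it to
  dominated convergence under the Gaussian law, with the constant 2 as majorant.\<close>

lemma tendsto_zero_if_char_tendsto_1:
  assumes [measurable]: "\<And>n. X n \<in> borel_measurable M"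
    and lim: "\<And>u. (\<lambda>n. char (distr M borel (X n)) u) \<longlonglongrightarrow> 1"
    and "\<epsilon> > 0"
  shows "(\<lambda>n. prob {\<omega> \<in> space M. \<epsilon> < \<bar>X n \<omega>\<bar>}) \<longlonglongrightarrow> 0"
proof -
  interpret G: prob_space std_normal_distribution by (rule prob_space_std_normal)
  have D: "real_distribution (distr M borel (X n))" for n
    by (intro real_distribution_distr) simp
  have [measurable]: "char (distr M borel (X n)) \<in> borel_measurable borel" for n
    by (rule real_distribution.char_measurable[OF D])
  have "(\<lambda>n. LINT u|std_normal_distribution. 1 - Re (char (distr M borel (X n)) (u / \<epsilon>)))
      \<longlonglongrightarrow> (LINT u|std_normal_distribution. (0::real))"
  proof (rule integral_dominated_convergence[where w="\<lambda>_. 2"])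
    have "(\<lambda>n. 1 - Re (char (distr M borel (X n)) (u / \<epsilon>))) \<longlonglongrightarrow> 1 - Re 1" for u
      by (intro tendsto_intros lim)
    then show "AE u in std_normal_distribution. (\<lambda>n. 1 - Re (char (distr M borel (X n)) (u / \<epsilon>))) \<longlonglongrightarrow> 0"
      by simp
    have "\<bar>1 - Re (char (distr M borel (X n)) v)\<bar> \<le> 2" for n v
      using abs_Re_le_cmod[of "char (distr M borel (X n)) v"] real_distribution.cmod_char_le_1[OF D, of n v]
      by linarith
    then show "AE u in std_normal_distribution. norm (1 - Re (char (distr M borel (X n)) (u / \<epsilon>))) \<le> 2" for n
      by simp
  qed auto
  then have "(\<lambda>n. 3 * (LINT u|std_normal_distribution. 1 - Re (char (distr M borel (X n)) (u / \<epsilon>)))) \<longlonglongrightarrow> 3 * 0"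
    by (intro tendsto_mult_left) simp
  then have lim0: "(\<lambda>n. 3 * (LINT u|std_normal_distribution. 1 - Re (char (distr M borel (X n)) (u / \<epsilon>)))) \<longlonglongrightarrow> 0"
    by (simp only: mult_zero_right)
  show ?thesis
  proof (rule tendsto_sandwich[OF always_eventually always_eventually tendsto_const lim0]; intro allI)
    show "prob {\<omega> \<in> space M. \<epsilon> < \<bar>X n \<omega>\<bar>}
      \<le> 3 * (LINT u|std_normal_distribution. 1 - Re (char (distr M borel (X n)) (u / \<epsilon>)))" for n
      by (rule prob_le_gauss_char[OF assms(1) \<open>\<epsilon> > 0\<close>])
  qed simp
qed

text \<open>A subsequence with summable increments converges almost surely, by Borel-Cantelli.\<close>

lemma Cauchy_in_prob_imp_tendsto:
  fixes X :: "nat \<Rightarrow> 'a \<Rightarrow> real"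
  assumes [measurable]: "\<And>n. X n \<in> borel_measurable M"
    and Cauchy: "\<And>\<epsilon>. \<epsilon> > 0 \<Longrightarrow> \<exists>N. \<forall>m\<ge>N. \<forall>n\<ge>N. prob {\<omega> \<in> space M. \<epsilon> < \<bar>X m \<omega> - X n \<omega>\<bar>} \<le> \<epsilon>"
  obtains Z where "Z \<in> borel_measurable M" "tendsto_in_prob M X Z sequentially"
proof -
  have "\<exists>N. \<forall>i. \<forall>m\<ge>N i. \<forall>n\<ge>N i. prob {\<omega> \<in> space M. (1/2) ^ i < \<bar>X m \<omega> - X n \<omega>\<bar>} \<le> (1/2) ^ i"
    by (intro choice allI Cauchy) simp
  then obtain N where N: "\<And>i m n. m \<ge> N i \<Longrightarrow> n \<ge> N i \<Longrightarrow>
      prob {\<omega> \<in> space M. (1/2) ^ i < \<bar>X m \<omega> - X n \<omega>\<bar>} \<le> (1/2) ^ i"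
    by blast
  \<comment> \<open>The sum over \<open>j \<le> i\<close> makes \<open>r\<close> monotone and at
    least \<open>N i\<close>; the extra \<open>i\<close> makes it tend to infinity.\<close>
  define r where "r i = (\<Sum>j\<le>i. N j) + i" for i
  have r_ge: "N i \<le> r i" "r i \<le> r (Suc i)" "i \<le> r i" for i
    using member_le_sum[of i "{..i}" N] by (auto simp: r_def)
  let ?A = "\<lambda>i. {\<omega> \<in> space M. (1/2) ^ i < \<bar>X (r (Suc i)) \<omega> - X (r i) \<omega>\<bar>}"
  have A: "prob (?A i) \<le> (1/2) ^ i" for i
    using r_ge[of i] by (intro N) auto
  have "summable (\<lambda>i. prob (?A i))"
    by (rule summable_comparison_test'[OF summable_geometric[of "1/2::real"]]) (use A in auto)
  then have "AE \<omega> in M. \<forall>\<^sub>F i in sequentially. \<omega> \<in> space M - ?A i"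
    by (intro borel_cantelli_AE1) (auto simp: emeasure_eq_measure)
  then have conv: "AE \<omega> in M. convergent (\<lambda>i. X (r i) \<omega>)"
  proof eventually_elim
    case (elim \<omega>)
    then obtain K where K: "\<And>i. i \<ge> K \<Longrightarrow> \<bar>X (r (Suc i)) \<omega> - X (r i) \<omega>\<bar> \<le> (1/2) ^ i"
      unfolding eventually_sequentially by (auto simp: not_less)
    have "summable (\<lambda>i. X (r (Suc i)) \<omega> - X (r i) \<omega>)"
      by (rule summable_comparison_test'[OF summable_geometric[of "1/2::real"], of K]) (use K in auto)
    then have "convergent (\<lambda>n. X (r n) \<omega> - X (r 0) \<omega>)"
      unfolding summable_iff_convergent sum_lessThan_telescope[of "\<lambda>i. X (r i) \<omega>"] .
    then show ?case
      using convergent_add[OF _ convergent_const[of "X (r 0) \<omega>"]] by fastforce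
  qed
  define Z where "Z \<omega> = lim (\<lambda>i. X (r i) \<omega>)" for \<omega>
  have [measurable]: "Z \<in> borel_measurable M"
    unfolding Z_def by (rule borel_measurable_lim_metric) simp
  have "AE \<omega> in M. (\<lambda>i. X (r i) \<omega>) \<longlonglongrightarrow> Z \<omega>"
    using conv by eventually_elim (simp add: Z_def convergent_LIMSEQ_iff)
  then have sub: "tendsto_in_prob M (\<lambda>i. X (r i)) Z sequentially"
    by (intro tendsto_in_prob_AE) auto
  have "tendsto_in_prob M X Z sequentially"
    unfolding tendsto_in_prob_def
  proof (intro allI impI tendstoI)
    fix \<epsilon> \<delta> :: real assume "\<epsilon> > 0" "\<delta> > 0"
    define \<eta> where "\<eta> = min (\<epsilon> / 2) (\<delta> / 2)"
    have "\<eta> > 0" using \<open>\<epsilon> > 0\<close> \<open>\<delta> > 0\<close> by (simp add: \<eta>_def)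
    from Cauchy[OF this] obtain K where
      K: "\<And>m n. m \<ge> K \<Longrightarrow> n \<ge> K \<Longrightarrow> prob {\<omega> \<in> space M. \<eta> < \<bar>X m \<omega> - X n \<omega>\<bar>} \<le> \<eta>" by blast
    from sub \<open>\<eta> > 0\<close> have "\<forall>\<^sub>F i in sequentially. prob {\<omega> \<in> space M. \<eta> < \<bar>X (r i) \<omega> - Z \<omega>\<bar>} < \<delta> / 2"
      using \<open>\<delta> > 0\<close> unfolding tendsto_in_prob_def by (intro order_tendstoD) auto
    then obtain i0 where i0: "\<And>i. i \<ge> i0 \<Longrightarrow> prob {\<omega> \<in> space M. \<eta> < \<bar>X (r i) \<omega> - Z \<omega>\<bar>} < \<delta> / 2"
      unfolding eventually_sequentially by blast
    define i where "i = max i0 K"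
    have i: "prob {\<omega> \<in> space M. \<eta> < \<bar>X (r i) \<omega> - Z \<omega>\<bar>} < \<delta> / 2" "r i \<ge> K"
      using i0[of i] r_ge(3)[of i] by (auto simp: i_def)
    have "prob {\<omega> \<in> space M. \<epsilon> < \<bar>X n \<omega> - Z \<omega>\<bar>} < \<delta>" if "n \<ge> K" for n
    proof -
      have "prob {\<omega> \<in> space M. \<epsilon> < \<bar>X n \<omega> - Z \<omega>\<bar>}
        \<le> prob ({\<omega> \<in> space M. \<eta> < \<bar>X n \<omega> - X (r i) \<omega>\<bar>} \<union> {\<omega> \<in> space M. \<eta> < \<bar>X (r i) \<omega> - Z \<omega>\<bar>})"
      proof (intro finite_measure_mono subsetI)
        fix \<omega> assume "\<omega> \<in> {\<omega> \<in> space M. \<epsilon> < \<bar>X n \<omega> - Z \<omega>\<bar>}"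
        moreover have "\<eta> + \<eta> \<le> \<epsilon>" by (simp add: \<eta>_def)
        ultimately show "\<omega> \<in> {\<omega> \<in> space M. \<eta> < \<bar>X n \<omega> - X (r i) \<omega>\<bar>} \<union> {\<omega> \<in> space M. \<eta> < \<bar>X (r i) \<omega> - Z \<omega>\<bar>}"
          by auto
      qed measurable
      also have "\<dots> \<le> prob {\<omega> \<in> space M. \<eta> < \<bar>X n \<omega> - X (r i) \<omega>\<bar>} + prob {\<omega> \<in> space M. \<eta> < \<bar>X (r i) \<omega> - Z \<omega>\<bar>}"
        by (intro measure_Un_le) auto
      also have "\<dots> < \<eta> + \<delta> / 2" using K[OF that i(2)] i(1) by linarith
      also have "\<dots> \<le> \<delta>" by (simp add: \<eta>_def)
      finally show ?thesis .
    qed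
    then show "\<forall>\<^sub>F n in sequentially. dist (prob {\<omega> \<in> space M. \<epsilon> < \<bar>X n \<omega> - Z \<omega>\<bar>}) 0 < \<delta>"
      unfolding eventually_sequentially by auto
  qed
  then show ?thesis by (intro that[of Z]) auto
qed

end

subsection \<open>Levy measures and their exponents\<close>

text \<open>The function $\theta$ with $E \exp(i u X(t)) = \exp(-t \theta(u))$ when \<open>X\<close> is a symmetric Levy
  process with characteristics $(0,0,\nu)$.\<close>

definition jump_exponent :: "real measure \<Rightarrow> real \<Rightarrow> real" where
  "jump_exponent \<nu> u = (LINT x|\<nu>. 1 - cos (u * x))"

locale levy_meas =
  fixes \<nu> :: "real measure"
  assumes levy: "levy_measure \<nu>"
begin

lemma sets_nu [measurable_cong, simp]: "sets \<nu> = sets borel"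
  and nu_zero: "emeasure \<nu> {0} = 0"
  and nu_finite: "(\<integral>\<^sup>+x. ennreal (min (x\<^sup>2) 1) \<partial>\<nu>) < \<infinity>"
  using levy by (simp_all add: levy_measure_def)

lemma space_nu [simp]: "space \<nu> = UNIV"
  using sets_eq_imp_space_eq[OF sets_nu] by simp

lemma measurable_nu [simp]: "measurable \<nu> N = measurable borel N"
  by (rule measurable_cong_sets) simp_all

text \<open>A Levy measure may be infinite near 0 but is finite away from it, and 0 itself carries
  no mass. Sigma-finiteness is what the Tonelli arguments rely on.\<close>

sublocale sigma_finite_measure \<nu>
proof
  define B where "B n = {x::real. inverse (real (Suc n)) \<le> \<bar>x\<bar>}" for n
  have [measurable]: "B n \<in> sets borel" for n unfolding B_def by measurable
  have B: "emeasure \<nu> (B n) \<noteq> \<infinity>" for n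
  proof -
    define c where "c = (real (Suc n))\<^sup>2"
    have c: "1 \<le> c * min (x\<^sup>2) 1" if "x \<in> B n" for x
    proof -
      have "1 \<le> real (Suc n) * \<bar>x\<bar>" using that by (simp add: B_def field_simps)
      then have "1 \<le> (real (Suc n) * \<bar>x\<bar>)\<^sup>2" by (simp add: one_le_power)
      moreover have "1 \<le> c" unfolding c_def by (intro one_le_power) simp
      ultimately show ?thesis by (simp add: c_def power_mult_distrib min_def)
    qed
    have "emeasure \<nu> (B n) = (\<integral>\<^sup>+x. indicator (B n) x \<partial>\<nu>)" by simp
    also have "\<dots> \<le> (\<integral>\<^sup>+x. ennreal c * ennreal (min (x\<^sup>2) 1) \<partial>\<nu>)"
    proof (intro nn_integral_mono)
      fix x
      have "1 \<le> ennreal (c * min (x\<^sup>2) 1)" if "x \<in> B n"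
        using c[OF that] by (simp only: ennreal_1[symmetric] ennreal_leI)
      then show "indicator (B n) x \<le> ennreal c * ennreal (min (x\<^sup>2) 1)"
        by (auto simp: indicator_def ennreal_mult[symmetric] c_def)
    qed
    also have "\<dots> = ennreal c * (\<integral>\<^sup>+x. ennreal (min (x\<^sup>2) 1) \<partial>\<nu>)"
      by (intro nn_integral_cmult) simp
    also have "\<dots> < \<infinity>" using nu_finite by (simp add: ennreal_mult_less_top)
    finally show ?thesis by simp
  qed
  have "x = 0 \<or> (\<exists>n. x \<in> B n)" for x
    using reals_Archimedean[of "\<bar>x\<bar>"] by (auto simp: B_def intro: less_imp_le)
  then have "\<Union> (insert {0} (range B)) = space \<nu>" by auto
  then show "\<exists>A. countable A \<and> A \<subseteq> sets \<nu> \<and> \<Union> A = space \<nu> \<and> (\<forall>a\<in>A. emeasure \<nu> a \<noteq> \<infinity>)"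
    using B nu_zero by (intro exI[of _ "insert {0} (range B)"]) auto
qed

lemma integrable_min: "integrable \<nu> (\<lambda>x. min (x\<^sup>2) 1)"
  using nu_finite by (intro integrableI_nonneg) auto

lemma integrable_one_minus_cos: "integrable \<nu> (\<lambda>x. 1 - cos (u * x))"
proof (rule Bochner_Integration.integrable_bound)
  show "integrable \<nu> (\<lambda>x. 2 * (1 + u\<^sup>2) * min (x\<^sup>2) 1)"
    by (intro integrable_mult_right integrable_min)
  show "AE x in \<nu>. norm (1 - cos (u * x)) \<le> norm (2 * (1 + u\<^sup>2) * min (x\<^sup>2) 1)"
    using one_minus_cos_scaled_le[of u] by (intro AE_I2) (auto intro: order_trans)
qed simp

lemma jump_exponent_nonneg: "0 \<le> jump_exponent \<nu> u"
  unfolding jump_exponent_def by (intro Bochner_Integration.integral_nonneg) simp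

lemma jump_exponent_0 [simp]: "jump_exponent \<nu> 0 = 0"
  by (simp add: jump_exponent_def)

lemma ennreal_jump_exponent: "ennreal (jump_exponent \<nu> u) = (\<integral>\<^sup>+x. ennreal (1 - cos (u * x)) \<partial>\<nu>)"
  unfolding jump_exponent_def
  by (rule nn_integral_eq_integral[symmetric, OF integrable_one_minus_cos]) simp

lemma jump_exponent_double_le: "jump_exponent \<nu> (2 * u) \<le> 4 * jump_exponent \<nu> u"
proof -
  have "(LINT x|\<nu>. 1 - cos (2 * u * x)) \<le> (LINT x|\<nu>. 4 * (1 - cos (u * x)))"
    using one_minus_cos_double_le
    by (intro integral_mono integrable_one_minus_cos integrable_mult_right) (simp add: mult.assoc)
  then show ?thesis unfolding jump_exponent_def by (simp only: integral_mult_right_zero)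
qed

lemma borel_measurable_jump_exponent [measurable]: "jump_exponent \<nu> \<in> borel_measurable borel"
  unfolding jump_exponent_def by measurable

text \<open>The compensator is purely imaginary, and the real part of \<open>iexp y - 1\<close> is
  \<open>cos y - 1\<close>. For a symmetric process the real part is enough, since it fixes the
  modulus of the characteristic function.\<close>

lemma Re_levy_exponent:
  "Re (CLINT x|\<nu>. iexp (\<beta> * x) - 1 - \<i> * complex_of_real (\<beta> * x * indicator {-1..1} x)) = - jump_exponent \<nu> \<beta>"
proof -
  let ?f = "\<lambda>x. iexp (\<beta> * x) - 1 - \<i> * complex_of_real (\<beta> * x * indicator {-1..1} x)"
  \<comment> \<open>The real part may be moved inside only after integrability is known. Inside
    [-1,1] the compensator leaves a second order remainder; outside, the integrand is at most 2 in
    modulus.\<close>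
  have bound: "norm (?f x) \<le> (2 + \<beta>\<^sup>2) * min (x\<^sup>2) 1" for x
  proof (cases "\<bar>x\<bar> \<le> 1")
    case True
    then have "x \<in> {-1..1}" "x\<^sup>2 \<le> 1" using abs_le_square_iff[of x 1] by auto
    moreover have "norm (iexp (\<beta> * x) - 1 - \<i> * complex_of_real (\<beta> * x)) \<le> \<beta>\<^sup>2 * x\<^sup>2 / 2"
      using iexp_approx1[of "\<beta> * x" 1] by (simp add: power_mult_distrib diff_diff_eq power2_eq_square mult_ac)
    moreover have "\<beta>\<^sup>2 * x\<^sup>2 / 2 \<le> (2 + \<beta>\<^sup>2) * x\<^sup>2"
      by (simp add: algebra_simps)
    ultimately show ?thesis by simp
  next
    case False
    then have "x \<notin> {-1..1}" "1 \<le> x\<^sup>2" using abs_le_square_iff[of 1 x] by auto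
    moreover have "norm (iexp (\<beta> * x) - 1) \<le> norm (iexp (\<beta> * x)) + norm (1::complex)"
      by (rule norm_triangle_ineq4)
    then have "norm (iexp (\<beta> * x) - 1) \<le> 2" by simp
    then have "norm (iexp (\<beta> * x) - 1) \<le> 2 + \<beta>\<^sup>2" using zero_le_power2[of \<beta>] by linarith
    ultimately show ?thesis by simp
  qed
  have "integrable \<nu> ?f"
  proof (rule Bochner_Integration.integrable_bound)
    show "integrable \<nu> (\<lambda>x. (2 + \<beta>\<^sup>2) * min (x\<^sup>2) 1)"
      by (intro integrable_mult_right integrable_min)
    show "AE x in \<nu>. norm (?f x) \<le> norm ((2 + \<beta>\<^sup>2) * min (x\<^sup>2) 1)"
      using bound by (intro AE_I2) (force intro: order_trans)
  qed simp
  then have "Re (CLINT x|\<nu>. ?f x) = (LINT x|\<nu>. Re (?f x))" by (rule integral_Re[symmetric])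
  also have "\<dots> = (LINT x|\<nu>. - (1 - cos (\<beta> * x)))"
    by (intro Bochner_Integration.integral_cong) (simp_all add: Re_exp)
  also have "\<dots> = - jump_exponent \<nu> \<beta>"
    unfolding jump_exponent_def by (rule integral_minus)
  finally show ?thesis .
qed

end


subsection \<open>Increments of Levy processes\<close>

text \<open>A zero of \<open>f\<close> would propagate by halving to zeros accumulating at 0,
  against \<open>f 0 = 1\<close>, so logarithms exist. Then \<open>h\<close>, the defect from
  linearity, is additive with \<open>h 1 = 0\<close>, hence bounded on the half line by its bound on
  [0,1]; a bounded additive function vanishes because \<open>h (n * t) = n * h t\<close>.\<close>

lemma multiplicative_continuous_imp_exp:
  fixes f :: "real \<Rightarrow> real"
  assumes f0: "f 0 = 1" and mult: "\<And>s t. 0 \<le> s \<Longrightarrow> 0 \<le> t \<Longrightarrow> f (s + t) = f s * f t"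
    and cont: "continuous_on {0..} f"
  shows "0 < f 1" and "0 \<le> t \<Longrightarrow> f t = exp (t * ln (f 1))"
proof -
  have nonneg: "0 \<le> f t" if "0 \<le> t" for t
    using mult[of "t / 2" "t / 2"] that by simp
  have "f t \<noteq> 0" if "0 \<le> t" for t
  proof
    assume z: "f t = 0"
    have half: "f (t / 2 ^ n) = 0" for n
    proof (induction n)
      case (Suc n)
      have "f (t / 2 ^ n) = f (t / 2 ^ Suc n) * f (t / 2 ^ Suc n)"
        using mult[of "t / 2 ^ Suc n" "t / 2 ^ Suc n"] that by simp
      then show ?case using Suc by simp
    qed (use z in simp)
    have "(\<lambda>n. t * (1 / 2) ^ n) \<longlonglongrightarrow> t * 0"
      by (intro tendsto_mult_left LIMSEQ_realpow_zero) auto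
    then have "(\<lambda>n. f (t / 2 ^ n)) \<longlonglongrightarrow> f 0"
      using that by (intro continuous_on_tendsto_compose[OF cont]) (auto simp: power_one_over divide_simps)
    then show False using f0 by (simp add: half LIMSEQ_const_iff)
  qed
  then have pos: "0 < f t" if "0 \<le> t" for t
    using nonneg[OF that] that by (simp add: order_less_le)
  then show "0 < f 1" by simp
  define h where "h t = ln (f t) - t * ln (f 1)" for t
  have h_add: "h (s + t) = h s + h t" if "0 \<le> s" "0 \<le> t" for s t
    using that pos[of s] pos[of t] by (simp add: h_def mult ln_mult algebra_simps)
  have h_mult: "h (real n * t) = real n * h t" if "0 \<le> t" for n t
  proof (induction n)
    case 0
    then show ?case by (simp add: h_def f0)
  next
    case (Suc n)
    then show ?case using h_add[of "real n * t" t] that by (simp add: algebra_simps)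
  qed
  have "h 1 = 0" by (simp add: h_def)
  have "continuous_on {0..1} h"
    unfolding h_def using pos
    by (intro continuous_intros continuous_on_subset[OF cont]) (auto simp: less_imp_neq[symmetric])
  then have "bounded (h ` {0..1})"
    by (intro compact_imp_bounded compact_continuous_image) auto
  then obtain B where "\<And>y. y \<in> h ` {0..1} \<Longrightarrow> norm y \<le> B" unfolding bounded_iff by blast
  then have B: "\<bar>h t\<bar> \<le> B" if "0 \<le> t" "t \<le> 1" for t using that by auto
  have bnd: "\<bar>h t\<bar> \<le> B" if "0 \<le> t" for t
  proof -
    define n where "n = nat \<lfloor>t\<rfloor>"
    have n: "real n \<le> t" "t \<le> real n + 1" using that by (auto simp: n_def)
    have "h t = h (real n * 1) + h (t - real n)"
      using h_add[of "real n" "t - real n"] n by simp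
    also have "h (real n * 1) = 0" using h_mult[of 1 n] \<open>h 1 = 0\<close> by simp
    finally show ?thesis using B[of "t - real n"] n by simp
  qed
  show "f t = exp (t * ln (f 1))" if t: "0 \<le> t"
  proof -
    have "h t = 0"
    proof (rule ccontr)
      assume "h t \<noteq> 0"
      then obtain n :: nat where "B < real n * \<bar>h t\<bar>"
        using reals_Archimedean3[of "\<bar>h t\<bar>"] by auto
      moreover have "real n * \<bar>h t\<bar> \<le> B"
        using bnd[of "real n * t"] h_mult[OF t, of n] t by (simp add: abs_mult)
      ultimately show False by simp
    qed
    then show ?thesis using pos[OF t] exp_ln[of "f t"] by (simp add: h_def)
  qed
qed

lemma distr_borel_cong_AE:
  assumes "X \<in> borel_measurable M" "Y \<in> borel_measurable M" "AE \<omega> in M. X \<omega> = Y \<omega>"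
  shows "distr M borel X = distr M borel Y"
  using assms by (intro distr_cong_AE) auto

context prob_space
begin

text \<open>Each increment may read a coordinate \<open>c j\<close> of its own: in a simple integral
  the vector changes from one interval to the next, and independence has to come from the joint
  process of all these vectors.\<close>

lemma levy_indep_increments:
  assumes L: "levy_process_in M I X" and c: "\<And>j. j < m \<Longrightarrow> c j \<in> I"
    and t: "0 \<le> t 0" "\<And>j. j < m \<Longrightarrow> t j \<le> t (Suc j)"
  shows "indep_vars (\<lambda>_. borel) (\<lambda>j \<omega>. X (c j) (t (Suc j)) \<omega> - X (c j) (t j) \<omega>) {..<m}"
proof -
  have *: "indep_vars (\<lambda>_. \<Pi>\<^sub>M i\<in>I. borel)
          (\<lambda>j \<omega>. \<lambda>i\<in>I. X i (t (Suc j)) \<omega> - X i (t j) \<omega>) {..<m}"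
    using L t unfolding levy_process_in_def by blast
  have "indep_vars (\<lambda>_. borel)
      (\<lambda>j \<omega>. (\<lambda>j x. x (c j)) j (\<lambda>i\<in>I. X i (t (Suc j)) \<omega> - X i (t j) \<omega>)) {..<m}"
    using c by (intro indep_vars_compose2[OF *] measurable_component_singleton) auto
  then show ?thesis by (rule indep_vars_cong[THEN iffD1, rotated -1]) (use c in auto)
qed

lemma levy_measurable:
  "levy_process_in M I X \<Longrightarrow> i \<in> I \<Longrightarrow> 0 \<le> t \<Longrightarrow> X i t \<in> borel_measurable M"
  by (simp add: levy_process_in_def)

lemma levy_increment_distr:
  assumes L: "levy_process_in M I X" and i: "i \<in> I" and t: "0 \<le> s" "s \<le> t"
  shows "distr M borel (\<lambda>\<omega>. X i t \<omega> - X i s \<omega>) = distr M borel (X i (t - s))"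
proof -
  have m: "(\<lambda>\<omega>. \<lambda>i\<in>I. X i b \<omega> - X i a \<omega>) \<in> measurable M (\<Pi>\<^sub>M i\<in>I. borel)" if "0 \<le> a" "0 \<le> b" for a b
    using levy_measurable[OF L] that
    by (intro measurable_PiM_single' borel_measurable_diff) auto
  have eq: "distr M (\<Pi>\<^sub>M i\<in>I. borel) (\<lambda>\<omega>. \<lambda>i\<in>I. X i t \<omega> - X i s \<omega>) =
        distr M (\<Pi>\<^sub>M i\<in>I. borel) (\<lambda>\<omega>. \<lambda>i\<in>I. X i (t - s) \<omega> - X i 0 \<omega>)"
    using L t unfolding levy_process_in_def by blast
  have c: "(\<lambda>x. x i) \<in> measurable (\<Pi>\<^sub>M i\<in>I. (borel :: real measure)) borel"
    using i by (rule measurable_component_singleton)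
  have "distr M borel (\<lambda>\<omega>. X i t \<omega> - X i s \<omega>) = distr M borel (\<lambda>\<omega>. X i (t - s) \<omega> - X i 0 \<omega>)"
    using arg_cong[OF eq, of "\<lambda>D. distr D borel (\<lambda>x. x i)"] t i
    by (simp add: distr_distr[OF c m] comp_def)
  also have "\<dots> = distr M borel (X i (t - s))"
  proof (rule distr_borel_cong_AE)
    have "AE \<omega> in M. X i 0 \<omega> = 0" using L i by (simp add: levy_process_in_def)
    then show "AE \<omega> in M. X i (t - s) \<omega> - X i 0 \<omega> = X i (t - s) \<omega>" by eventually_elim simp
  qed (use levy_measurable[OF L i] t in auto)
  finally show ?thesis .
qed

lemma char_continuous_of_levy:
  assumes L: "levy_process_in M I X" and i: "i \<in> I"
  shows "continuous_on {0..} (\<lambda>t. char (distr M borel (X i t)) u)"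
  unfolding continuous_on_def
proof
  fix t :: real assume t: "t \<in> {0..}"
  have "tendsto_in_prob M (X i) (X i t) (at t within {0..})"
    using L i t by (simp add: levy_process_in_def)
  \<comment> \<open>Measurability is available for nonnegative times only, whereas
    \<open>char_tendsto_in_prob\<close> asks for it at every index. Clamping the time at 0 changes
    nothing along this filter.\<close>
  moreover have ev: "\<forall>\<^sub>F s in at t within {0..}. max s 0 = (s::real)"
    by (auto simp: eventually_at_filter)
  ultimately have "tendsto_in_prob M (\<lambda>s. X i (max s 0)) (X i t) (at t within {0..})"
    unfolding tendsto_in_prob_def
  proof (intro allI impI)
    fix \<epsilon> :: real assume "\<forall>\<epsilon>>0. ((\<lambda>s. prob {\<omega> \<in> space M. \<epsilon> < \<bar>X i s \<omega> - X i t \<omega>\<bar>}) \<longlongrightarrow> 0) (at t within {0..})"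
      and "\<epsilon> > 0"
    then have "((\<lambda>s. prob {\<omega> \<in> space M. \<epsilon> < \<bar>X i s \<omega> - X i t \<omega>\<bar>}) \<longlongrightarrow> 0) (at t within {0..})"
      by blast
    then show "((\<lambda>s. prob {\<omega> \<in> space M. \<epsilon> < \<bar>X i (max s 0) \<omega> - X i t \<omega>\<bar>}) \<longlongrightarrow> 0) (at t within {0..})"
      by (rule Lim_transform_eventually) (use ev in eventually_elim, simp)
  qed
  then have "((\<lambda>s. char (distr M borel (X i (max s 0))) u) \<longlongrightarrow> char (distr M borel (X i t)) u) (at t within {0..})"
    using levy_measurable[OF L i] t by (intro char_tendsto_in_prob) auto
  then show "((\<lambda>s. char (distr M borel (X i s)) u) \<longlongrightarrow> char (distr M borel (X i t)) u) (at t within {0..})"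
    by (rule Lim_transform_eventually) (use ev in eventually_elim, simp)
qed

lemma levy_char_add:
  assumes L: "levy_process_in M I X" and i: "i \<in> I" and st: "0 \<le> s" "0 \<le> t"
  shows "char (distr M borel (X i (s + t))) u = char (distr M borel (X i s)) u * char (distr M borel (X i t)) u"
proof -
  define p where "p j = (if j = 0 then 0 else if j = 1 then s else s + t)" for j :: nat
  have ind: "indep_vars (\<lambda>_. borel) (\<lambda>j \<omega>. X i (p (Suc j)) \<omega> - X i (p j) \<omega>) {..<2}"
    by (rule levy_indep_increments[OF L, of 2 "\<lambda>_. i"]) (use i st in \<open>auto simp: p_def\<close>)
  have "AE \<omega> in M. X i 0 \<omega> = 0" using L i by (simp add: levy_process_in_def)
  then have "AE \<omega> in M. X i (s + t) \<omega> = (\<Sum>j<2. X i (p (Suc j)) \<omega> - X i (p j) \<omega>)"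
    by eventually_elim (simp add: p_def numeral_2_eq_2)
  then have "distr M borel (X i (s + t)) = distr M borel (\<lambda>\<omega>. \<Sum>j<2. X i (p (Suc j)) \<omega> - X i (p j) \<omega>)"
    using levy_measurable[OF L i] st
    by (intro distr_borel_cong_AE borel_measurable_sum borel_measurable_diff) (auto simp: p_def)
  also have "char \<dots> u = (\<Prod>j<2. char (distr M borel (\<lambda>\<omega>. X i (p (Suc j)) \<omega> - X i (p j) \<omega>)) u)"
    by (rule char_distr_sum[OF ind])
  also have "\<dots> = char (distr M borel (X i s)) u * char (distr M borel (X i t)) u"
    using levy_increment_distr[OF L i, of 0 s] levy_increment_distr[OF L i, of s "s + t"] st
    by (simp add: p_def numeral_2_eq_2)
  finally show ?thesis .
qed

text \<open>By symmetry the characteristic function is real, so stationary independent increments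
  and stochastic continuity make it a real exponential in \<open>t\<close>. The value at time 1 is
  positive and is therefore determined by its modulus, that is, by the real part of the given
  exponent.\<close>

lemma levy_char:
  assumes L: "levy_process M X" and symm: "symmetric_process M X"
    and pj: "pure_jump_characteristics M X \<nu>" and t: "0 \<le> t"
  shows "char (distr M borel (X t)) u = complex_of_real (exp (- (t * jump_exponent \<nu> u)))"
proof -
  interpret levy_meas \<nu> using pj by unfold_locales (simp add: pure_jump_characteristics_def)
  define f where "f t = Re (char (distr M borel (X t)) u)" for t
  have meas: "X t \<in> borel_measurable M" if "0 \<le> t" for t
    using levy_measurable[OF L _ that] by simp
  have real: "char (distr M borel (X t)) u = complex_of_real (f t)" if "0 \<le> t" for t
  proof -
    have "char (distr M borel (X t)) u = char (distr M borel (\<lambda>\<omega>. - X t \<omega>)) u"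
      using symm that by (simp add: symmetric_process_def)
    also have "\<dots> = (CLINT \<omega>|M. cnj (iexp (u * X t \<omega>)))"
      using meas[OF that] by (simp add: char_def integral_distr exp_cnj)
    also have "\<dots> = cnj (char (distr M borel (X t)) u)"
      using meas[OF that] by (simp only: Bochner_Integration.integral_cnj) (simp add: char_def integral_distr)
    finally have "char (distr M borel (X t)) u \<in> \<real>" unfolding Reals_cnj_iff by (rule sym)
    then show ?thesis unfolding f_def by (rule of_real_Re[symmetric])
  qed
  have "f 0 = 1"
  proof -
    have "AE \<omega> in M. X 0 \<omega> = 0" using L by (simp add: levy_process_in_def)
    then have "distr M borel (X 0) = distr M borel (\<lambda>_. 0)"
      using meas by (intro distr_borel_cong_AE) auto
    then show ?thesis by (simp add: f_def char_def integral_distr prob_space del: distr_const)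
  qed
  moreover have "f (s + t) = f s * f t" if "0 \<le> s" "0 \<le> t" for s t
  proof -
    have "complex_of_real (f (s + t)) = complex_of_real (f s) * complex_of_real (f t)"
      using levy_char_add[OF L _ that, of "()" u] that by (simp only: real add_nonneg_nonneg singletonI)
    then show ?thesis unfolding of_real_mult[symmetric] of_real_eq_iff .
  qed
  moreover have "continuous_on {0..} f"
    unfolding f_def by (intro continuous_on_Re char_continuous_of_levy[OF L]) simp
  ultimately have f: "0 < f 1" "\<And>t. 0 \<le> t \<Longrightarrow> f t = exp (t * ln (f 1))"
    using multiplicative_continuous_imp_exp[of f] by blast+
  have "norm (char (distr M borel (X 1)) u) = exp (- jump_exponent \<nu> u)"
    using pj Re_levy_exponent[of u] by (simp add: pure_jump_characteristics_def)
  then have "f 1 = exp (- jump_exponent \<nu> u)" using real[of 1] f(1) by simp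
  then show ?thesis using real[OF t] f(2)[OF t] by simp
qed

end

subsection \<open>Diagonal cylindrical Levy processes\<close>

lemma char_distr_scale:
  assumes [measurable]: "X \<in> borel_measurable M"
  shows "char (distr M borel (\<lambda>\<omega>. c * X \<omega>)) u = char (distr M borel X) (u * c)"
  by (simp add: char_def integral_distr mult_ac)

locale diagonal_levy = prob_space M + onb e
  for M :: "'w measure" and e :: "nat \<Rightarrow> 'v::{real_inner, polish_space}" +
  fixes L :: "real \<Rightarrow> 'v \<Rightarrow> 'w \<Rightarrow> real" and l :: "nat \<Rightarrow> real \<Rightarrow> 'w \<Rightarrow> real" and \<nu> :: "nat \<Rightarrow> real measure"
  assumes cyl: "cylindrical_levy_process M L"
    and levy_l: "\<And>k. levy_process M (l k)"
    and sym_l: "\<And>k. symmetric_process M (l k)"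
    and jump_l: "\<And>k. pure_jump_characteristics M (l k) (\<nu> k)"
    and indep_l: "independent_processes M l"
    and L_sums: "\<And>v t. 0 \<le> t \<Longrightarrow> AE \<omega> in M. (\<lambda>k. (e k \<bullet> v) * l k t \<omega>) sums L t v \<omega>"
begin

text \<open>Constants defined inside \<open>levy_meas\<close> receive the index as first argument in
  this locale: \<open>damped_mass k\<close> and \<open>damped_exponent k\<close> refer to the
  measure \<open>\<nu> k\<close>.\<close>

sublocale levy_meas "\<nu> k" for k
  using jump_l[of k] by unfold_locales (simp add: pure_jump_characteristics_def)

text \<open>This is minus the symbol of the cylindrical process: \<open>L t v\<close> has
  characteristic function \<open>exp (- t * cyl_exponent (u v))\<close> at \<open>u\<close>. The
  value of \<open>suminf\<close> carries information once \<open>summable_exponents\<close> is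
  proved.\<close>

definition cyl_exponent :: "'v \<Rightarrow> real" where
  "cyl_exponent v = (\<Sum>k. jump_exponent (\<nu> k) (e k \<bullet> v))"

lemma cyl_rv: "0 \<le> t \<Longrightarrow> cylindrical_rv M (L t)"
  using cyl by (simp add: cylindrical_levy_process_def)

lemma L_levy: "levy_process_in M {..<n::nat} (\<lambda>i t. L t (v i))"
  using cyl by (simp add: cylindrical_levy_process_def)

lemma L_measurable: "0 \<le> t \<Longrightarrow> L t v \<in> borel_measurable M"
  using cyl_rv by (simp add: cylindrical_rv_def)

lemma L_linear:
  "0 \<le> t \<Longrightarrow> AE \<omega> in M. L t (a *\<^sub>R v + b *\<^sub>R w) \<omega> = a * L t v \<omega> + b * L t w \<omega>"
  using cyl_rv by (simp add: cylindrical_rv_def)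

lemma l_measurable: "0 \<le> t \<Longrightarrow> l k t \<in> borel_measurable M"
  using levy_measurable[OF levy_l] by simp

lemma partial_sum_char:
  assumes t: "0 \<le> t"
  shows "char (distr M borel (\<lambda>\<omega>. \<Sum>k<N. (e k \<bullet> v) * l k t \<omega>)) u
    = complex_of_real (exp (- (t * (\<Sum>k<N. jump_exponent (\<nu> k) (e k \<bullet> (u *\<^sub>R v))))))"
proof -
  have "indep_vars (\<lambda>_. \<Pi>\<^sub>M t\<in>{0..}. borel) (\<lambda>k \<omega>. \<lambda>t\<in>{0..}. l k t \<omega>) UNIV"
    using indep_l by (simp add: independent_processes_def)
  then have ind: "indep_vars (\<lambda>_. \<Pi>\<^sub>M t\<in>{0..}. borel) (\<lambda>k \<omega>. \<lambda>t\<in>{0..}. l k t \<omega>) {..<N}"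
    by (rule indep_vars_subset) simp
  have [measurable]: "(\<lambda>x. x t) \<in> measurable (\<Pi>\<^sub>M t\<in>{0::real..}. (borel :: real measure)) borel"
    by (rule measurable_component_singleton) (use t in simp)
  have "indep_vars (\<lambda>_. borel)
      (\<lambda>k \<omega>. (\<lambda>k x. (e k \<bullet> v) * x t) k (\<lambda>t\<in>{0..}. l k t \<omega>)) {..<N}"
    by (rule indep_vars_compose2[OF ind]) measurable
  then have "indep_vars (\<lambda>_. borel) (\<lambda>k \<omega>. (e k \<bullet> v) * l k t \<omega>) {..<N}"
    using t by simp
  then have "char (distr M borel (\<lambda>\<omega>. \<Sum>k<N. (e k \<bullet> v) * l k t \<omega>)) u
    = (\<Prod>k<N. char (distr M borel (\<lambda>\<omega>. (e k \<bullet> v) * l k t \<omega>)) u)"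
    by (rule char_distr_sum)
  also have "\<dots> = (\<Prod>k<N. complex_of_real (exp (- (t * jump_exponent (\<nu> k) (e k \<bullet> (u *\<^sub>R v))))))"
    using l_measurable[OF t] levy_char[OF levy_l sym_l jump_l t]
    by (intro prod.cong) (simp_all add: char_distr_scale)
  also have "\<dots> = complex_of_real (exp (- (t * (\<Sum>k<N. jump_exponent (\<nu> k) (e k \<bullet> (u *\<^sub>R v))))))"
    unfolding of_real_prod[symmetric] by (simp add: exp_sum[symmetric] sum_negf sum_distrib_left)
  finally show ?thesis .
qed

lemma partial_sum_char_tendsto:
  assumes t: "0 \<le> t"
  shows "(\<lambda>N. complex_of_real (exp (- (t * (\<Sum>k<N. jump_exponent (\<nu> k) (e k \<bullet> (u *\<^sub>R v)))))))
    \<longlonglongrightarrow> char (distr M borel (L t v)) u"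
proof -
  have [measurable]: "L t v \<in> borel_measurable M" "\<And>k. l k t \<in> borel_measurable M"
    using t by (auto intro: L_measurable l_measurable)
  have "tendsto_in_prob M (\<lambda>N \<omega>. \<Sum>k<N. (e k \<bullet> v) * l k t \<omega>) (L t v) sequentially"
    using L_sums[OF t, of v] unfolding sums_def by (intro tendsto_in_prob_AE) auto
  then have "(\<lambda>N. char (distr M borel (\<lambda>\<omega>. \<Sum>k<N. (e k \<bullet> v) * l k t \<omega>)) u)
      \<longlonglongrightarrow> char (distr M borel (L t v)) u"
    by (intro char_tendsto_in_prob) auto
  then show ?thesis unfolding partial_sum_char[OF t] .
qed

text \<open>If the exponents were not summable, then the characteristic functions of all \<open>L t v\<close> with
  \<open>t > 0\<close> would vanish at 1, in contradiction to stochastic continuity at 0.\<close>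

lemma summable_exponents: "summable (\<lambda>k. jump_exponent (\<nu> k) (e k \<bullet> v))"
proof -
  let ?P = "\<lambda>N. \<Sum>k<N. jump_exponent (\<nu> k) (e k \<bullet> v)"
  have L: "levy_process_in M {..<1::nat} (\<lambda>i t. L t v)" using L_levy[of 1 "\<lambda>_. v"] by simp
  have "AE \<omega> in M. L 0 v \<omega> = 0" using L by (simp add: levy_process_in_def)
  then have "distr M borel (L 0 v) = distr M borel (\<lambda>_. 0)"
    by (intro distr_borel_cong_AE L_measurable) auto
  then have L0: "char (distr M borel (L 0 v)) 1 = 1"
    by (simp add: char_def integral_distr prob_space del: distr_const)
  have "(\<lambda>n. char (distr M borel (L (inverse (real (Suc n))) v)) 1) \<longlonglongrightarrow> char (distr M borel (L 0 v)) 1"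
    by (rule continuous_on_tendsto_compose[OF char_continuous_of_levy[OF L, of 0 1] LIMSEQ_inverse_real_of_nat])
       simp_all
  then have "(\<lambda>n. Re (char (distr M borel (L (inverse (real (Suc n))) v)) 1)) \<longlonglongrightarrow> 1"
    unfolding L0 by (metis tendsto_Re one_complex.simps(1))
  then have "\<forall>\<^sub>F n in sequentially. 0 < Re (char (distr M borel (L (inverse (real (Suc n))) v)) 1)"
    by (rule order_tendstoD) simp
  then obtain n where n: "0 < Re (char (distr M borel (L (inverse (real (Suc n))) v)) 1)"
    unfolding eventually_sequentially by blast
  define t where "t = inverse (real (Suc n))"
  define c where "c = Re (char (distr M borel (L t v)) 1)"
  have t: "0 < t" and c: "0 < c" using n by (auto simp: t_def c_def)
  have "(\<lambda>N. exp (- (t * ?P N))) \<longlonglongrightarrow> c"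
    using tendsto_Re[OF partial_sum_char_tendsto[of t 1 v]] t unfolding c_def by simp
  moreover have "decseq (\<lambda>N. exp (- (t * ?P N)))"
    unfolding decseq_Suc_iff using t jump_exponent_nonneg by (auto intro!: mult_left_mono)
  \<comment> \<open>A decreasing sequence stays above its limit, and the positive limit
    \<open>c\<close> turns this into a bound on all partial sums of the exponents.\<close>
  ultimately have "c \<le> exp (- (t * ?P N))" for N
    using decseq_ge by blast
  then have "ln c \<le> - (t * ?P N)" for N
    using c by (metis exp_gt_zero ln_exp ln_le_cancel_iff)
  then have "?P N \<le> - ln c / t" for N
    using t by (simp add: field_simps) (metis add.commute le_minus_iff neg_0_le_iff_le add_le_same_cancel1 le_add_same_cancel1 minus_le_iff)
  then show ?thesis
    by (intro summableI_nonneg_bounded jump_exponent_nonneg) auto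
qed

lemma L_char:
  assumes t: "0 \<le> t"
  shows "char (distr M borel (L t v)) u = complex_of_real (exp (- (t * cyl_exponent (u *\<^sub>R v))))"
proof (rule LIMSEQ_unique[OF partial_sum_char_tendsto[OF t]])
  have "(\<lambda>N. \<Sum>k<N. jump_exponent (\<nu> k) (e k \<bullet> (u *\<^sub>R v))) \<longlonglongrightarrow> cyl_exponent (u *\<^sub>R v)"
    unfolding cyl_exponent_def by (rule summable_LIMSEQ[OF summable_exponents])
  then show "(\<lambda>N. complex_of_real (exp (- (t * (\<Sum>k<N. jump_exponent (\<nu> k) (e k \<bullet> (u *\<^sub>R v)))))))
    \<longlonglongrightarrow> complex_of_real (exp (- (t * cyl_exponent (u *\<^sub>R v))))"
    by (intro tendsto_intros)
qed

lemma cyl_exponent_nonneg: "0 \<le> cyl_exponent v"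
  unfolding cyl_exponent_def by (intro suminf_nonneg summable_exponents jump_exponent_nonneg)

lemma cyl_exponent_0 [simp]: "cyl_exponent 0 = 0"
  by (simp add: cyl_exponent_def)

lemma cyl_exponent_double_le: "cyl_exponent (2 *\<^sub>R v) \<le> 4 * cyl_exponent v"
proof -
  have "cyl_exponent (2 *\<^sub>R v) \<le> (\<Sum>k. 4 * jump_exponent (\<nu> k) (e k \<bullet> v))"
    unfolding cyl_exponent_def
    by (intro suminf_le summable_exponents summable_mult) (simp add: jump_exponent_double_le)
  also have "\<dots> = 4 * cyl_exponent v"
    unfolding cyl_exponent_def by (rule suminf_mult[OF summable_exponents])
  finally show ?thesis .
qed

text \<open>Continuity is inherited from that of \<open>L 1\<close> as a map into random variables:
  the characteristic functions at frequency 1 converge, they are positive, and the logarithm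
  recovers the exponent.\<close>

lemma cyl_exponent_tendsto:
  assumes "u \<longlonglongrightarrow> v"
  shows "(\<lambda>n. cyl_exponent (u n)) \<longlonglongrightarrow> cyl_exponent v"
proof -
  have "tendsto_in_prob M (\<lambda>n. L 1 (u n)) (L 1 v) sequentially"
    using cyl_rv[of 1] assms by (simp add: cylindrical_rv_def)
  then have "(\<lambda>n. char (distr M borel (L 1 (u n))) 1) \<longlonglongrightarrow> char (distr M borel (L 1 v)) 1"
    by (intro char_tendsto_in_prob L_measurable) auto
  then have "(\<lambda>n. Re (char (distr M borel (L 1 (u n))) 1)) \<longlonglongrightarrow> Re (char (distr M borel (L 1 v)) 1)"
    by (rule tendsto_Re)
  then have "(\<lambda>n. exp (- cyl_exponent (u n))) \<longlonglongrightarrow> exp (- cyl_exponent v)"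
    by (simp add: L_char)
  then have "(\<lambda>n. - ln (exp (- cyl_exponent (u n)))) \<longlonglongrightarrow> - ln (exp (- cyl_exponent v))"
    by (intro tendsto_minus tendsto_ln) auto
  then show ?thesis by simp
qed

lemma isCont_cyl_exponent: "isCont cyl_exponent v"
  unfolding continuous_at_sequentially by (simp add: comp_def cyl_exponent_tendsto)

text \<open>Balls need not be compact, so continuity alone does not suffice. It gives the bound 1
  near the origin, and each doubling of the radius costs at most a factor 4.\<close>

lemma cyl_exponent_bounded:
  obtains B where "\<And>v. norm v \<le> K \<Longrightarrow> cyl_exponent v \<le> B"
proof -
  have "(cyl_exponent \<longlongrightarrow> 0) (at 0)"
    using isCont_cyl_exponent[of 0] by (simp add: isCont_def)
  then obtain d where d: "d > 0" "\<And>v. v \<noteq> 0 \<Longrightarrow> norm v < d \<Longrightarrow> \<bar>cyl_exponent v\<bar> < 1"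
    using LIM_D[of cyl_exponent 0 0 1] by auto
  have base: "cyl_exponent v \<le> 1" if "norm v < d" for v
    using d(2)[of v] that by (cases "v = 0") auto
  have "cyl_exponent v \<le> 4 ^ n" if "norm v < 2 ^ n * d" for n v
    using that
  proof (induction n arbitrary: v)
    case 0
    then show ?case using base by simp
  next
    case (Suc n)
    have "cyl_exponent ((1 / 2) *\<^sub>R v) \<le> 4 ^ n" using Suc by simp
    then show ?case using cyl_exponent_double_le[of "(1 / 2) *\<^sub>R v"] by simp
  qed
  moreover obtain n :: nat where "K / d < 2 ^ n"
    using real_arch_pow[of 2 "K / d"] by auto
  then have "K < 2 ^ n * d" using d(1) by (simp add: field_simps)
  ultimately show ?thesis by (intro that[of "4 ^ n"]) force
qed

end

subsection \<open>Characteristic functions of cylindrical integrals\<close>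

text \<open>With the gauge integral, integrability of the limit comes out as a conclusion, and no
  measurability of \<open>g\<close> has to be tracked. Setting all functions to 0 on
  \<open>N\<close> reduces the claim to convergence everywhere.\<close>

lemma dominated_convergence_off_negligible:
  fixes f :: "nat \<Rightarrow> real \<Rightarrow> real"
  assumes f: "\<And>k. f k integrable_on S" and h: "h integrable_on S"
    and le: "\<And>k x. x \<in> S \<Longrightarrow> norm (f k x) \<le> h x"
    and N: "negligible N" and conv: "\<And>x. x \<in> S - N \<Longrightarrow> (\<lambda>k. f k x) \<longlonglongrightarrow> g x"
  shows "g integrable_on S" and "(\<lambda>k. integral S (f k)) \<longlonglongrightarrow> integral S g"
proof -
  let ?z = "\<lambda>f x. if x \<in> N then 0 else f x :: real"
  have eq: "?z (f k) integrable_on S" "integral S (?z (f k)) = integral S (f k)" for k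
    using integrable_spike[OF f N, of "?z (f k)" k] integral_spike[OF N, of S "?z (f k)" "f k"] by auto
  have h0: "0 \<le> h x" if "x \<in> S" for x
    using le[OF that, of 0] norm_ge_zero order_trans by blast
  have z: "norm (?z (f k) x) \<le> h x" "(\<lambda>k. ?z (f k) x) \<longlonglongrightarrow> ?z g x" if "x \<in> S" for k x
    using le[OF that, of k] h0[OF that] conv[of x] that by auto
  note * = dominated_convergence[OF eq(1) h z]
  show "g integrable_on S"
    using integrable_spike[OF *(1) N, of g] by simp
  show "(\<lambda>k. integral S (f k)) \<longlonglongrightarrow> integral S g"
    using *(2) integral_spike[OF N, of S "?z g" g] by (simp add: eq(2))
qed

lemma is_simple_mono:
  assumes "is_simple T m t v h" "k \<le> m"
  shows "0 \<le> t k" "t k \<le> T"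
proof -
  have "k \<le> m \<longrightarrow> 0 \<le> t k" for k
    using assms(1) by (induction k) (auto simp: is_simple_def intro: order_trans Suc_leD)
  then show "0 \<le> t k" using assms(2) by blast
  have "t k \<le> t m" using assms(2)
  proof (induction rule: inc_induct)
    case (step j)
    then show ?case using assms(1) by (auto simp: is_simple_def intro: order_trans)
  qed simp
  then show "t k \<le> T" using assms(1) by (simp add: is_simple_def)
qed

lemma has_integral_simple:
  fixes F :: "'v \<Rightarrow> real"
  assumes h: "is_simple T m t v h"
  shows "((\<lambda>s. F (h s)) has_integral (\<Sum>k<m. (t (Suc k) - t k) * F (v k))) {0..T}"
proof -
  have "((\<lambda>s. F (h s)) has_integral (\<Sum>k<j. (t (Suc k) - t k) * F (v k))) {0..t j}" if "j \<le> m" for j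
    using that
  proof (induction j)
    case 0
    then show ?case using h has_integral_refl(2)[of "\<lambda>s. F (h s)" 0] by (simp add: is_simple_def)
  next
    case (Suc j)
    have t: "0 \<le> t j" "t j \<le> t (Suc j)"
      using is_simple_mono[OF h, of j] h Suc.prems by (auto simp: is_simple_def)
    have "((\<lambda>s. F (h s)) has_integral ((t (Suc j) - t j) * F (v j))) {t j..t (Suc j)}"
    proof (rule has_integral_spike_finite[of "{t j, t (Suc j)}"])
      show "((\<lambda>_. F (v j)) has_integral ((t (Suc j) - t j) * F (v j))) {t j..t (Suc j)}"
        using has_integral_const_real[of "F (v j)" "t j" "t (Suc j)"] t by simp
      fix x assume "x \<in> {t j..t (Suc j)} - {t j, t (Suc j)}"
      then have "x \<in> {t j<..<t (Suc j)}" by auto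
      moreover have "j < m" using Suc.prems by simp
      ultimately have "h x = v j" using h unfolding is_simple_def by blast
      then show "F (h x) = F (v j)" by simp
    qed simp
    then have "((\<lambda>s. F (h s)) has_integral
        ((\<Sum>k<j. (t (Suc k) - t k) * F (v k)) + (t (Suc j) - t j) * F (v j))) {0..t (Suc j)}"
      using Suc t by (intro has_integral_combine[of 0 "t j"]) auto
    then show ?case by simp
  qed
  from this[of m] show ?thesis using h by (simp add: is_simple_def)
qed

lemma is_simple_bounded:
  fixes h :: "real \<Rightarrow> 'v::real_normed_vector"
  assumes "is_simple T m t v h"
  obtains B where "\<And>s. s \<in> {0..T} \<Longrightarrow> norm (h s) \<le> B"
proof -
  have "bounded (h ` t ` {..m} \<union> v ` {..<m})" by (intro finite_imp_bounded) auto
  then obtain B where "\<And>x. x \<in> h ` t ` {..m} \<union> v ` {..<m} \<Longrightarrow> norm x \<le> B"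
    unfolding bounded_iff by blast
  then show ?thesis using is_simple_cases[OF assms] by (intro that[of B]) blast
qed

context diagonal_levy
begin

lemma simple_integral_measurable:
  assumes h: "is_simple T m t v h"
  shows "simple_integral L m t v \<in> borel_measurable M"
  unfolding simple_integral_def
  by (intro borel_measurable_sum borel_measurable_diff L_measurable is_simple_mono[OF h]) auto

lemma simple_integral_char:
  assumes h: "is_simple T m t v h"
  shows "(\<lambda>s. cyl_exponent (u *\<^sub>R h s)) integrable_on {0..T}"
    and "char (distr M borel (simple_integral L m t v)) u
      = complex_of_real (exp (- integral {0..T} (\<lambda>s. cyl_exponent (u *\<^sub>R h s))))"
proof -
  note I = has_integral_simple[OF h, of "\<lambda>x. cyl_exponent (u *\<^sub>R x)"]
  show "(\<lambda>s. cyl_exponent (u *\<^sub>R h s)) integrable_on {0..T}" using I by blast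
  have t: "0 \<le> t j" "t j \<le> t (Suc j)" if "j < m" for j
    using is_simple_mono[OF h, of j] h that by (auto simp: is_simple_def)
  have "0 \<le> t 0" using h by (simp add: is_simple_def)
  then have "indep_vars (\<lambda>_. borel) (\<lambda>j \<omega>. L (t (Suc j)) (v j) \<omega> - L (t j) (v j) \<omega>) {..<m}"
    using levy_indep_increments[OF L_levy[of m v], of m "\<lambda>j. j" t] t by simp
  then have "char (distr M borel (simple_integral L m t v)) u
      = (\<Prod>j<m. char (distr M borel (\<lambda>\<omega>. L (t (Suc j)) (v j) \<omega> - L (t j) (v j) \<omega>)) u)"
    unfolding simple_integral_def by (rule char_distr_sum)
  also have "\<dots> = (\<Prod>j<m. complex_of_real (exp (- ((t (Suc j) - t j) * cyl_exponent (u *\<^sub>R v j)))))"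
  proof (intro prod.cong refl)
    fix j assume j: "j \<in> {..<m}"
    have "distr M borel (\<lambda>\<omega>. L (t (Suc j)) (v j) \<omega> - L (t j) (v j) \<omega>)
        = distr M borel (L (t (Suc j) - t j) (v j))"
      by (rule levy_increment_distr[OF L_levy[of m v]]) (use j t in auto)
    then show "char (distr M borel (\<lambda>\<omega>. L (t (Suc j)) (v j) \<omega> - L (t j) (v j) \<omega>)) u
        = complex_of_real (exp (- ((t (Suc j) - t j) * cyl_exponent (u *\<^sub>R v j))))"
      using j t by (simp add: L_char)
  qed
  also have "\<dots> = complex_of_real (exp (- (\<Sum>j<m. (t (Suc j) - t j) * cyl_exponent (u *\<^sub>R v j))))"
    by (simp add: exp_sum sum_negf[symmetric] of_real_prod)
  also have "(\<Sum>j<m. (t (Suc j) - t j) * cyl_exponent (u *\<^sub>R v j))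
      = integral {0..T} (\<lambda>s. cyl_exponent (u *\<^sub>R h s))"
    using I by (rule integral_unique[symmetric])
  finally show "char (distr M borel (simple_integral L m t v)) u
      = complex_of_real (exp (- integral {0..T} (\<lambda>s. cyl_exponent (u *\<^sub>R h s))))" .
qed

text \<open>The exponent is continuous and bounded on balls, so uniformly bounded convergence of
  integrands passes through it by dominated convergence with a constant majorant.\<close>

lemma exponent_integral_tendsto:
  fixes h :: "nat \<Rightarrow> real \<Rightarrow> 'v"
  assumes int: "\<And>n. (\<lambda>s. cyl_exponent (u *\<^sub>R h n s)) integrable_on {0..T}"
    and bound: "\<And>n s. s \<in> {0..T} \<Longrightarrow> norm (h n s) \<le> C"
    and N: "negligible N" and conv: "\<And>s. s \<in> {0..T} - N \<Longrightarrow> (\<lambda>n. h n s) \<longlonglongrightarrow> g s"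
  shows "(\<lambda>s. cyl_exponent (u *\<^sub>R g s)) integrable_on {0..T}"
    and "(\<lambda>n. integral {0..T} (\<lambda>s. cyl_exponent (u *\<^sub>R h n s)))
      \<longlonglongrightarrow> integral {0..T} (\<lambda>s. cyl_exponent (u *\<^sub>R g s))"
proof -
  obtain B where B: "\<And>v. norm v \<le> \<bar>u\<bar> * C \<Longrightarrow> cyl_exponent v \<le> B"
    using cyl_exponent_bounded[of "\<bar>u\<bar> * C"] by blast
  have le: "norm (cyl_exponent (u *\<^sub>R h n s)) \<le> B" if "s \<in> {0..T}" for n s
    using bound[OF that, of n] cyl_exponent_nonneg by (auto intro!: B mult_left_mono)
  have conv': "(\<lambda>n. cyl_exponent (u *\<^sub>R h n s)) \<longlonglongrightarrow> cyl_exponent (u *\<^sub>R g s)" if "s \<in> {0..T} - N" for s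
    by (intro cyl_exponent_tendsto tendsto_scaleR tendsto_const conv that)
  show "(\<lambda>s. cyl_exponent (u *\<^sub>R g s)) integrable_on {0..T}"
    and "(\<lambda>n. integral {0..T} (\<lambda>s. cyl_exponent (u *\<^sub>R h n s)))
      \<longlonglongrightarrow> integral {0..T} (\<lambda>s. cyl_exponent (u *\<^sub>R g s))"
    using dominated_convergence_off_negligible[OF int integrable_const_ivl le N conv'] by auto
qed

text \<open>The step common to both extensions of the integral: from simple to regulated integrands,
  and from these to limits almost everywhere.\<close>

lemma char_limit:
  fixes h :: "nat \<Rightarrow> real \<Rightarrow> 'v"
  assumes int: "\<And>n. (\<lambda>s. cyl_exponent (u *\<^sub>R h n s)) integrable_on {0..T}"
    and bound: "\<And>n s. s \<in> {0..T} \<Longrightarrow> norm (h n s) \<le> C"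
    and N: "negligible N" and conv: "\<And>s. s \<in> {0..T} - N \<Longrightarrow> (\<lambda>n. h n s) \<longlonglongrightarrow> g s"
    and Y: "\<And>n. Y n \<in> borel_measurable M" "X \<in> borel_measurable M" "tendsto_in_prob M Y X sequentially"
    and char: "\<And>n. char (distr M borel (Y n)) u
      = complex_of_real (exp (- integral {0..T} (\<lambda>s. cyl_exponent (u *\<^sub>R h n s))))"
  shows "char (distr M borel X) u
      = complex_of_real (exp (- integral {0..T} (\<lambda>s. cyl_exponent (u *\<^sub>R g s))))"
proof (rule LIMSEQ_unique)
  show "(\<lambda>n. char (distr M borel (Y n)) u) \<longlonglongrightarrow> char (distr M borel X) u"
    by (rule char_tendsto_in_prob[OF Y])
  show "(\<lambda>n. char (distr M borel (Y n)) u)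
      \<longlonglongrightarrow> complex_of_real (exp (- integral {0..T} (\<lambda>s. cyl_exponent (u *\<^sub>R g s))))"
    unfolding char
    by (intro tendsto_intros exponent_integral_tendsto(2)[OF int bound N conv])
qed

lemma regulated_integral_char:
  assumes "has_regulated_integral M L T g X"
  shows "(\<lambda>s. cyl_exponent (u *\<^sub>R g s)) integrable_on {0..T}"
    and "char (distr M borel X) u
      = complex_of_real (exp (- integral {0..T} (\<lambda>s. cyl_exponent (u *\<^sub>R g s))))"
proof -
  from assms obtain m t v h where h: "\<And>n::nat. is_simple T (m n) (t n) (v n) (h n)"
    and u: "uniform_limit {0..T} h g sequentially"
    and lim: "tendsto_in_prob M (\<lambda>n. simple_integral L (m n) (t n) (v n)) X sequentially"
    and X: "X \<in> borel_measurable M"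
    unfolding has_regulated_integral_def by blast
  from u have "\<forall>\<^sub>F n in sequentially. \<forall>s\<in>{0..T}. dist (h n s) (g s) < 1"
    by (rule uniform_limitD) simp
  then obtain K where K: "\<And>n s. K \<le> n \<Longrightarrow> s \<in> {0..T} \<Longrightarrow> dist (h n s) (g s) < 1"
    unfolding eventually_sequentially by blast
  obtain B where B: "\<And>s. s \<in> {0..T} \<Longrightarrow> norm (h K s) \<le> B"
    using is_simple_bounded[OF h[of K]] by blast
  \<comment> \<open>Uniform convergence controls a tail of the sequence only. From index
    \<open>K\<close> on, every function is within 2 of the bounded function \<open>h K\<close>; the
    initial terms are removed by the shift.\<close>
  have bound: "norm (h (n + K) s) \<le> B + 2" if "s \<in> {0..T}" for n s
  proof -
    have "dist (h (n + K) s) 0 \<le> dist (h (n + K) s) (g s) + dist (g s) (h K s) + dist (h K s) 0"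
      using dist_triangle[of "h (n + K) s" 0 "g s"] dist_triangle[of "g s" 0 "h K s"] by linarith
    then show ?thesis
      using K[of "n + K" s] K[of K s] B[OF that] that by (simp add: dist_commute)
  qed
  have conv: "(\<lambda>n. h (n + K) s) \<longlonglongrightarrow> g s" if "s \<in> {0..T} - {}" for s
    using tendsto_uniform_limitI[OF u, of s] that by (intro LIMSEQ_ignore_initial_segment) auto
  have lim': "tendsto_in_prob M (\<lambda>n. simple_integral L (m (n + K)) (t (n + K)) (v (n + K))) X sequentially"
    using lim unfolding tendsto_in_prob_def by (auto intro: LIMSEQ_ignore_initial_segment)
  show "(\<lambda>s. cyl_exponent (u *\<^sub>R g s)) integrable_on {0..T}"
    by (rule exponent_integral_tendsto(1)[OF simple_integral_char(1)[OF h] bound negligible_empty conv])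
  show "char (distr M borel X) u
      = complex_of_real (exp (- integral {0..T} (\<lambda>s. cyl_exponent (u *\<^sub>R g s))))"
    by (rule char_limit[OF simple_integral_char(1)[OF h] bound negligible_empty conv
          simple_integral_measurable[OF h] X lim' simple_integral_char(2)[OF h]])
qed

text \<open>The approximating sequences in the definition are existentially quantified; this formula
  shows that the law of the integral depends on the integrand alone.\<close>

lemma cylindrical_integral_char:
  assumes "has_cylindrical_integral M L T g X"
  shows "(\<lambda>s. cyl_exponent (u *\<^sub>R g s)) integrable_on {0..T}"
    and "char (distr M borel X) u
      = complex_of_real (exp (- integral {0..T} (\<lambda>s. cyl_exponent (u *\<^sub>R g s))))"
proof -
  from assms obtain h Y C where hY: "\<And>n::nat. has_regulated_integral M L T (h n) (Y n)"
    and bound: "\<And>n s. s \<in> {0..T} \<Longrightarrow> norm (h n s) \<le> C"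
    and ae: "AE s in lborel. s \<in> {0..T} \<longrightarrow> (\<lambda>n. h n s) \<longlonglongrightarrow> g s"
    and lim: "tendsto_in_prob M Y X sequentially" and X: "X \<in> borel_measurable M"
    unfolding has_cylindrical_integral_def by blast
  have Y: "Y n \<in> borel_measurable M" for n using hY by (simp add: has_regulated_integral_def)
  from ae obtain N where N: "N \<in> null_sets lborel"
    "{s. \<not> (s \<in> {0..T} \<longrightarrow> (\<lambda>n. h n s) \<longlonglongrightarrow> g s)} \<subseteq> N"
    by (auto simp: eventually_ae_filter)
  have neg: "negligible N"
    using N(1) by (simp add: negligible_iff_null_sets null_sets_completionI)
  have conv: "(\<lambda>n. h n s) \<longlonglongrightarrow> g s" if "s \<in> {0..T} - N" for s
    using N(2) that by auto
  show "(\<lambda>s. cyl_exponent (u *\<^sub>R g s)) integrable_on {0..T}"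
    by (rule exponent_integral_tendsto(1)[OF regulated_integral_char(1)[OF hY] bound neg conv])
  show "char (distr M borel X) u
      = complex_of_real (exp (- integral {0..T} (\<lambda>s. cyl_exponent (u *\<^sub>R g s))))"
    by (rule char_limit[OF regulated_integral_char(1)[OF hY] bound neg conv Y X lim
          regulated_integral_char(2)[OF hY]])
qed

end

subsection \<open>Time averages of the exponent\<close>

context levy_meas
begin

definition damped_mass :: "real \<Rightarrow> real \<Rightarrow> ennreal" where
  "damped_mass g T = (\<integral>\<^sup>+s\<in>{0..T}. (\<integral>\<^sup>+\<beta>. ennreal (min (exp (2 * g * s) * \<bar>\<beta>\<bar>\<^sup>2) 1) \<partial>\<nu>) \<partial>lborel)"

text \<open>Minus the logarithm of the characteristic function at \<open>u\<close> of one coordinate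
  of the integral over [0,T], where \<open>g\<close> is the growth rate of the semigroup in that
  coordinate.\<close>

definition damped_exponent :: "real \<Rightarrow> real \<Rightarrow> real \<Rightarrow> real" where
  "damped_exponent g T u = integral {0..T} (\<lambda>s. jump_exponent \<nu> (u * exp (g * s)))"

lemma exp_mult_square: "exp (2 * g * s) * \<bar>\<beta>\<bar>\<^sup>2 = (exp (g * s) * \<beta>)\<^sup>2" for g s \<beta> :: real
  by (simp add: power_mult_distrib exp_double[symmetric] mult.assoc)

text \<open>On [0,T] the factor \<open>exp (2 * g * s)\<close> is at most some
  \<open>c \<ge> 1\<close>, and such a factor can be pulled out of the minimum. So each single term
  of the series is finite, and passing to real numbers by \<open>enn2real\<close> loses
  nothing.\<close>

lemma damped_mass_finite: "damped_mass g T < \<infinity>"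
proof -
  define c where "c = exp (2 * \<bar>g\<bar> * T)"
  let ?K = "\<integral>\<^sup>+x. ennreal (min (x\<^sup>2) 1) \<partial>\<nu>"
  have "(\<integral>\<^sup>+\<beta>. ennreal (min (exp (2 * g * s) * \<bar>\<beta>\<bar>\<^sup>2) 1) \<partial>\<nu>) \<le> ennreal c * ?K" if s: "s \<in> {0..T}" for s
  proof -
    have "2 * g * s \<le> 2 * \<bar>g\<bar> * T"
      by (rule mult_mono) (use s in auto)
    then have c: "exp (2 * g * s) \<le> c" by (simp add: c_def)
    have c1: "1 \<le> c" using s by (simp add: c_def)
    have "min (exp (2 * g * s) * \<bar>\<beta>\<bar>\<^sup>2) 1 \<le> c * min (\<beta>\<^sup>2) 1" for \<beta>
      using c c1 mult_right_mono[OF c, of "\<beta>\<^sup>2"] by (auto simp: min_def)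
    then have "(\<integral>\<^sup>+\<beta>. ennreal (min (exp (2 * g * s) * \<bar>\<beta>\<bar>\<^sup>2) 1) \<partial>\<nu>) \<le> (\<integral>\<^sup>+x. ennreal c * ennreal (min (x\<^sup>2) 1) \<partial>\<nu>)"
      using c1 by (intro nn_integral_mono) (simp add: ennreal_mult[symmetric] ennreal_leI)
    also have "\<dots> = ennreal c * ?K" by (intro nn_integral_cmult) simp
    finally show ?thesis .
  qed
  then have "damped_mass g T \<le> (\<integral>\<^sup>+s. ennreal c * ?K * indicator {0..T} s \<partial>lborel)"
    unfolding damped_mass_def by (intro nn_integral_mono) (auto simp: indicator_def)
  also have "\<dots> = ennreal c * ?K * emeasure lborel {0..T}"
    by (rule nn_integral_cmult_indicator) simp
  also have "\<dots> < \<infinity>"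
    using nu_finite by (simp add: ennreal_mult_less_top emeasure_lborel_Icc_eq)
  finally show ?thesis .
qed

lemma jump_exponent_le_mass:
  "ennreal (jump_exponent \<nu> (u * exp (g * s)))
    \<le> ennreal (2 * (1 + u\<^sup>2)) * (\<integral>\<^sup>+\<beta>. ennreal (min (exp (2 * g * s) * \<bar>\<beta>\<bar>\<^sup>2) 1) \<partial>\<nu>)"
proof -
  have "ennreal (jump_exponent \<nu> (u * exp (g * s))) = (\<integral>\<^sup>+x. ennreal (1 - cos (u * exp (g * s) * x)) \<partial>\<nu>)"
    by (rule ennreal_jump_exponent)
  also have "\<dots> \<le> (\<integral>\<^sup>+\<beta>. ennreal (2 * (1 + u\<^sup>2)) * ennreal (min (exp (2 * g * s) * \<bar>\<beta>\<bar>\<^sup>2) 1) \<partial>\<nu>)"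
  proof (intro nn_integral_mono)
    fix \<beta> :: real
    have "1 - cos (u * (exp (g * s) * \<beta>)) \<le> 2 * (1 + u\<^sup>2) * min (exp (2 * g * s) * \<bar>\<beta>\<bar>\<^sup>2) 1"
      unfolding exp_mult_square by (rule one_minus_cos_scaled_le)
    then show "ennreal (1 - cos (u * exp (g * s) * \<beta>))
        \<le> ennreal (2 * (1 + u\<^sup>2)) * ennreal (min (exp (2 * g * s) * \<bar>\<beta>\<bar>\<^sup>2) 1)"
      by (simp only: ennreal_mult''[symmetric] min.boundedI zero_le_mult_iff exp_ge_zero zero_le_power2
          zero_le_one power2_abs simp_thms mult.assoc ennreal_leI)
  qed
  also have "\<dots> = ennreal (2 * (1 + u\<^sup>2)) * (\<integral>\<^sup>+\<beta>. ennreal (min (exp (2 * g * s) * \<bar>\<beta>\<bar>\<^sup>2) 1) \<partial>\<nu>)"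
    by (intro nn_integral_cmult) simp
  finally show ?thesis .
qed

lemma nn_integral_jump_exponent_le:
  "(\<integral>\<^sup>+s\<in>{0..T}. ennreal (jump_exponent \<nu> (u * exp (g * s))) \<partial>lborel) \<le> ennreal (2 * (1 + u\<^sup>2)) * damped_mass g T"
proof -
  let ?m = "\<lambda>s. \<integral>\<^sup>+\<beta>. ennreal (min (exp (2 * g * s) * \<bar>\<beta>\<bar>\<^sup>2) 1) \<partial>\<nu>"
  have "(\<integral>\<^sup>+s\<in>{0..T}. ennreal (jump_exponent \<nu> (u * exp (g * s))) \<partial>lborel)
      \<le> (\<integral>\<^sup>+s. ennreal (2 * (1 + u\<^sup>2)) * (?m s * indicator {0..T} s) \<partial>lborel)"
    using jump_exponent_le_mass by (intro nn_integral_mono) (simp add: indicator_def)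
  also have "\<dots> = ennreal (2 * (1 + u\<^sup>2)) * damped_mass g T"
    unfolding damped_mass_def by (intro nn_integral_cmult) measurable
  finally show ?thesis .
qed

lemma integrable_jump_exponent_exp:
  "(\<lambda>s. jump_exponent \<nu> (u * exp (g * s))) integrable_on {0..T}"
proof (rule set_borel_integral_eq_integral(1))
  have "(\<integral>\<^sup>+s\<in>{0..T}. ennreal (jump_exponent \<nu> (u * exp (g * s))) \<partial>lborel) < \<infinity>"
    using damped_mass_finite[of g T]
    by (intro le_less_trans[OF nn_integral_jump_exponent_le]) (simp add: ennreal_mult_less_top)
  moreover have "(\<integral>\<^sup>+s. ennreal (indicator {0..T} s *\<^sub>R jump_exponent \<nu> (u * exp (g * s))) \<partial>lborel)
      = (\<integral>\<^sup>+s\<in>{0..T}. ennreal (jump_exponent \<nu> (u * exp (g * s))) \<partial>lborel)"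
    by (intro nn_integral_cong) (simp add: indicator_def)
  ultimately show "set_integrable lborel {0..T} (\<lambda>s. jump_exponent \<nu> (u * exp (g * s)))"
    unfolding set_integrable_def
    by (intro integrableI_nonneg) (auto simp: jump_exponent_nonneg)
qed

text \<open>The bridge between the gauge integrals of the characteristic function formulas and the
  nonnegative Lebesgue integrals to which Tonelli applies.\<close>

lemma ennreal_damped_exponent:
  "ennreal (damped_exponent g T u) = (\<integral>\<^sup>+s\<in>{0..T}. ennreal (jump_exponent \<nu> (u * exp (g * s))) \<partial>lborel)"
  unfolding damped_exponent_def
  by (rule nn_integral_has_integral_lebesgue'[symmetric, OF jump_exponent_nonneg
        integrable_integral[OF integrable_jump_exponent_exp]])

lemma damped_exponent_nonneg: "0 \<le> damped_exponent g T u"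
  unfolding damped_exponent_def
  by (intro Henstock_Kurzweil_Integration.integral_nonneg integrable_jump_exponent_exp jump_exponent_nonneg)

lemma borel_measurable_damped_exponent [measurable]: "damped_exponent g T \<in> borel_measurable borel"
proof -
  have "(\<lambda>u. ennreal (damped_exponent g T u)) \<in> borel_measurable borel"
    unfolding ennreal_damped_exponent by measurable
  then have "(\<lambda>u. enn2real (ennreal (damped_exponent g T u))) \<in> borel_measurable borel"
    by measurable
  then show ?thesis by (simp add: damped_exponent_nonneg)
qed

text \<open>Tonelli twice: the Gaussian integral is moved inside the time integral and then inside
  the integral over \<nu>, where it is explicit.\<close>

lemma gauss_damped_exponent:
  "(\<integral>\<^sup>+u. ennreal (damped_exponent g T u) \<partial>std_normal_distribution)
    = (\<integral>\<^sup>+s\<in>{0..T}. (\<integral>\<^sup>+\<beta>. ennreal (1 - exp (- ((exp (g * s) * \<beta>)\<^sup>2) / 2)) \<partial>\<nu>) \<partial>lborel)"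
proof -
  interpret G: prob_space std_normal_distribution by (rule prob_space_std_normal)
  interpret GL: pair_sigma_finite std_normal_distribution lborel ..
  interpret GN: pair_sigma_finite std_normal_distribution \<nu> ..
  have "(\<integral>\<^sup>+u. ennreal (damped_exponent g T u) \<partial>std_normal_distribution)
      = (\<integral>\<^sup>+s. (\<integral>\<^sup>+u. ennreal (jump_exponent \<nu> (u * exp (g * s))) * indicator {0..T} s \<partial>std_normal_distribution) \<partial>lborel)"
    unfolding ennreal_damped_exponent by (rule GL.Fubini'[symmetric]) measurable
  also have "\<dots> = (\<integral>\<^sup>+s\<in>{0..T}. (\<integral>\<^sup>+\<beta>. ennreal (1 - exp (- ((exp (g * s) * \<beta>)\<^sup>2) / 2)) \<partial>\<nu>) \<partial>lborel)"
  proof (intro nn_integral_cong)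
    fix s :: real
    have "(\<integral>\<^sup>+u. ennreal (jump_exponent \<nu> (u * exp (g * s))) \<partial>std_normal_distribution)
        = (\<integral>\<^sup>+u. (\<integral>\<^sup>+\<beta>. ennreal (1 - cos (u * (exp (g * s) * \<beta>))) \<partial>\<nu>) \<partial>std_normal_distribution)"
      unfolding ennreal_jump_exponent by (simp only: mult.assoc)
    also have "\<dots> = (\<integral>\<^sup>+\<beta>. (\<integral>\<^sup>+u. ennreal (1 - cos (u * (exp (g * s) * \<beta>))) \<partial>std_normal_distribution) \<partial>\<nu>)"
      by (rule GN.Fubini'[symmetric]) measurable
    also have "\<dots> = (\<integral>\<^sup>+\<beta>. ennreal (1 - exp (- ((exp (g * s) * \<beta>)\<^sup>2) / 2)) \<partial>\<nu>)"
      unfolding gauss_one_minus_cos ..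
    finally show "(\<integral>\<^sup>+u. ennreal (jump_exponent \<nu> (u * exp (g * s))) * indicator {0..T} s \<partial>std_normal_distribution)
        = (\<integral>\<^sup>+\<beta>. ennreal (1 - exp (- ((exp (g * s) * \<beta>)\<^sup>2) / 2)) \<partial>\<nu>) * indicator {0..T} s"
      by (simp add: nn_integral_multc)
  qed
  finally show ?thesis .
qed

lemma gauss_damped_exponent_le:
  "(\<integral>\<^sup>+u. ennreal (damped_exponent g T u) \<partial>std_normal_distribution) \<le> damped_mass g T"
  unfolding gauss_damped_exponent damped_mass_def exp_mult_square
  by (intro nn_integral_mono mult_right_mono ennreal_leI one_minus_exp_gauss_le) simp

lemma damped_mass_le_gauss:
  "damped_mass g T \<le> 3 * (\<integral>\<^sup>+u. ennreal (damped_exponent g T u) \<partial>std_normal_distribution)"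
proof -
  let ?h = "\<lambda>s. \<integral>\<^sup>+\<beta>. ennreal (1 - exp (- ((exp (g * s) * \<beta>)\<^sup>2) / 2)) \<partial>\<nu>"
  have le: "(\<integral>\<^sup>+\<beta>. ennreal (min ((exp (g * s) * \<beta>)\<^sup>2) 1) \<partial>\<nu>) \<le> 3 * ?h s" for s
  proof -
    have "(\<integral>\<^sup>+\<beta>. ennreal (min ((exp (g * s) * \<beta>)\<^sup>2) 1) \<partial>\<nu>)
        \<le> (\<integral>\<^sup>+\<beta>. ennreal 3 * ennreal (1 - exp (- ((exp (g * s) * \<beta>)\<^sup>2) / 2)) \<partial>\<nu>)"
      by (intro nn_integral_mono order_trans[OF ennreal_leI[OF min_one_le_gauss]])
         (simp only: ennreal_mult'[OF zero_le_numeral] order_refl)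
    also have "\<dots> = ennreal 3 * ?h s" by (intro nn_integral_cmult) simp
    finally show ?thesis by simp
  qed
  have "damped_mass g T \<le> (\<integral>\<^sup>+s. 3 * (?h s * indicator {0..T} s) \<partial>lborel)"
    unfolding damped_mass_def exp_mult_square using le
    by (intro nn_integral_mono) (simp add: indicator_def)
  also have "\<dots> = 3 * (\<integral>\<^sup>+u. ennreal (damped_exponent g T u) \<partial>std_normal_distribution)"
    unfolding gauss_damped_exponent by (intro nn_integral_cmult) measurable
  finally show ?thesis .
qed

text \<open>Shrinking the exponent by the factor \<open>c\<close> makes the second order term of
  \<open>1 - exp (- x) \<ge> x - x\<^sup>2 / 2\<close> negligible against the first one.\<close>

lemma min_damped_mass_le:
  "min (enn2real (damped_mass g T)) 1
    \<le> 432 * (LINT u|std_normal_distribution. 1 - exp (- damped_exponent g T u))"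
proof -
  interpret G: prob_space std_normal_distribution by (rule prob_space_std_normal)
  define m where "m = enn2real (damped_mass g T)"
  let ?D = "damped_exponent g T"
  have m: "damped_mass g T = ennreal m" "0 \<le> m"
    using damped_mass_finite[of g T] by (auto simp: m_def)
  have int_1: "integrable std_normal_distribution (\<lambda>u. 1 - exp (- ?D u))"
    by (rule G.integrable_const_bound[of _ 1]) (use damped_exponent_nonneg in auto)
  have D_le: "?D u \<le> 2 * (1 + u\<^sup>2) * m" for u
  proof -
    have "ennreal (?D u) \<le> ennreal (2 * (1 + u\<^sup>2)) * ennreal m"
      using nn_integral_jump_exponent_le[of u g T] unfolding ennreal_damped_exponent m .
    also have "\<dots> = ennreal (2 * (1 + u\<^sup>2) * m)" using m(2) by (intro ennreal_mult[symmetric]) auto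
    finally show ?thesis using m(2) by (subst (asm) ennreal_le_iff) auto
  qed
  have fin: "(\<integral>\<^sup>+u. ennreal (?D u) \<partial>std_normal_distribution) < \<infinity>"
    using gauss_damped_exponent_le[of g T] m(1) by (simp add: le_less_trans[OF _ ennreal_less_top])
  have int_D: "integrable std_normal_distribution ?D"
    using fin by (intro integrableI_nonneg) (auto simp: damped_exponent_nonneg)
  have D_ge: "m / 3 \<le> (LINT u|std_normal_distribution. ?D u)"
  proof -
    have "ennreal m \<le> 3 * ennreal (LINT u|std_normal_distribution. ?D u)"
      using damped_mass_le_gauss[of g T] nn_integral_eq_integral[OF int_D] damped_exponent_nonneg
      by (simp add: m(1))
    also have "\<dots> = ennreal (3 * (LINT u|std_normal_distribution. ?D u))"
      by (simp add: ennreal_mult')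
    finally have "m \<le> 3 * (LINT u|std_normal_distribution. ?D u)"
      using damped_exponent_nonneg by (subst (asm) ennreal_le_iff) auto
    then show ?thesis by simp
  qed
  show ?thesis
  proof (cases "m = 0")
    case True
    have "0 \<le> (LINT u|std_normal_distribution. 1 - exp (- ?D u))"
      using damped_exponent_nonneg by (intro Bochner_Integration.integral_nonneg) simp
    then show ?thesis using True by (simp add: m_def[symmetric])
  next
    case False
    then have "0 < m" using m(2) by simp
    \<comment> \<open>The scaling makes \<open>q = min m 1 / 72\<close>. The linear term is at least
      \<open>q / 3\<close>, the quadratic one at most \<open>2 * q^2 * 6\<close>, which is at most
      \<open>q / 6\<close> since \<open>q \<le> 1 / 72\<close>. What remains is
      \<open>q / 6 = min m 1 / 432\<close>.\<close>
    define c where "c = min 1 (1 / m) / 72"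
    define q where "q = c * m"
    have c: "0 \<le> c" "c \<le> 1" using \<open>0 < m\<close> by (auto simp: c_def)
    have q: "min m 1 = 72 * q" "0 \<le> q" "q \<le> 1 / 72"
      using \<open>0 < m\<close> by (auto simp: q_def c_def min_def field_simps)
    have point: "c * ?D u - 2 * q\<^sup>2 * (1 + u\<^sup>2)\<^sup>2 \<le> 1 - exp (- ?D u)" for u
    proof -
      have "c * ?D u \<le> 2 * (1 + u\<^sup>2) * q"
        using mult_left_mono[OF D_le[of u] c(1)] by (simp add: q_def mult_ac)
      then have "(c * ?D u)\<^sup>2 \<le> (2 * (1 + u\<^sup>2) * q)\<^sup>2"
        using c damped_exponent_nonneg[of g T u] by (intro power_mono) auto
      then have "(c * ?D u)\<^sup>2 / 2 \<le> 2 * q\<^sup>2 * (1 + u\<^sup>2)\<^sup>2" 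
        by (simp add: power_mult_distrib mult_ac del: distrib_left_numeral)
      moreover have "c * ?D u - (c * ?D u)\<^sup>2 / 2 \<le> 1 - exp (- (c * ?D u))"
        using c damped_exponent_nonneg[of g T u] by (intro one_minus_exp_ge) auto
      moreover have "1 - exp (- (c * ?D u)) \<le> 1 - exp (- ?D u)"
        using mult_right_mono[OF c(2) damped_exponent_nonneg[of g T u]] by simp
      ultimately show ?thesis by linarith
    qed
    have "c * (LINT u|std_normal_distribution. ?D u) - 2 * q\<^sup>2 * 6
        = (LINT u|std_normal_distribution. c * ?D u - 2 * q\<^sup>2 * (1 + u\<^sup>2)\<^sup>2)"
      using int_D gauss_fourth_moment_bound
      by (subst Bochner_Integration.integral_diff) (auto simp only: integral_mult_right_zero integrable_mult_right)
    also have "\<dots> \<le> (LINT u|std_normal_distribution. 1 - exp (- ?D u))"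
      by (intro integral_mono[OF _ int_1 point] Bochner_Integration.integrable_diff
          integrable_mult_right int_D gauss_fourth_moment_bound(1))
    finally have 1: "c * (LINT u|std_normal_distribution. ?D u) - 12 * q\<^sup>2
        \<le> (LINT u|std_normal_distribution. 1 - exp (- ?D u))" by simp
    have "q / 3 \<le> c * (LINT u|std_normal_distribution. ?D u)"
      using mult_left_mono[OF D_ge c(1)] by (simp add: q_def)
    moreover have "12 * q\<^sup>2 \<le> q / 6"
      using mult_left_mono[OF q(3,2)] by (simp add: power2_eq_square)
    ultimately have "q / 6 \<le> (LINT u|std_normal_distribution. 1 - exp (- ?D u))"
      using 1 by linarith
    then show ?thesis using q(1) by (simp add: m_def[symmetric])
  qed
qed

end


subsection \<open>Gaussian randomisation of a joint characteristic function\<close>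

context prob_space
begin

text \<open>The frequencies are replaced by independent Gaussians one at a time. Averaging over the
  frequency of coordinate \<open>j\<close> turns its oscillating factor into
  \<open>exp (- (X j)^2 / 2)\<close> on one side and produces the factor \<open>a j\<close> on the
  other, so a product measure of \<open>N\<close> Gaussians is avoided.\<close>

lemma gauss_randomisation:
  fixes X :: "nat \<Rightarrow> 'a \<Rightarrow> real" and D :: "nat \<Rightarrow> real \<Rightarrow> real"
  assumes [measurable]: "\<And>k. X k \<in> borel_measurable M" "\<And>k. D k \<in> borel_measurable borel"
    and D_nonneg: "\<And>k u. 0 \<le> D k u"
    and char: "\<And>u. (CLINT \<omega>|M. iexp (\<Sum>k<N. u k * X k \<omega>)) = complex_of_real (exp (- (\<Sum>k<N. D k (u k))))"
  shows "expectation (\<lambda>\<omega>. exp (- (\<Sum>k<N. (X k \<omega>)\<^sup>2) / 2)) = (\<Prod>k<N. LINT u|std_normal_distribution. exp (- D k u))"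
proof -
  interpret G: prob_space std_normal_distribution by (rule prob_space_std_normal)
  interpret P: pair_prob_space M std_normal_distribution ..
  define a where "a k = (LINT u|std_normal_distribution. exp (- D k u))" for k
  define A where "A j \<omega> = exp (- (\<Sum>k<j. (X k \<omega>)\<^sup>2) / 2)" for j \<omega>
  define B where "B j u \<omega> = (\<Sum>k=j..<N. u k * X k \<omega>)" for j and u :: "nat \<Rightarrow> real" and \<omega>
  have [measurable]: "A j \<in> borel_measurable M" "B j u \<in> borel_measurable M" for j u
    unfolding A_def B_def by measurable
  have A_le: "\<bar>A j \<omega>\<bar> \<le> 1" for j \<omega>
    unfolding A_def by (simp add: sum_nonneg)
  \<comment> \<open>In this mixed state the first \<open>j\<close> frequencies are averaged out and
    the others are free. The induction runs for all \<open>u\<close> at once, because the next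
    average uses the hypothesis at every \<open>u(j := x)\<close>.\<close>
  have claim: "(CLINT \<omega>|M. complex_of_real (A j \<omega>) * iexp (B j u \<omega>))
      = complex_of_real ((\<Prod>k<j. a k) * exp (- (\<Sum>k=j..<N. D k (u k))))" if "j \<le> N" for j u
    using that
  proof (induction j arbitrary: u)
    case 0
    then show ?case using char[of u] by (simp add: A_def B_def atLeast0LessThan)
  next
    case (Suc j)
    then have j: "j < N" by simp
    define R where "R = (\<Sum>k=Suc j..<N. D k (u k))"
    have split: "(\<Sum>k=j..<N. f k) = f j + (\<Sum>k=Suc j..<N. f k)" for f :: "nat \<Rightarrow> real"
      using j by (rule sum.atLeast_Suc_lessThan)
    have B: "B j (u(j := x)) \<omega> = X j \<omega> * x + B (Suc j) u \<omega>" for x \<omega>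
      unfolding B_def split by simp
    have A: "A (Suc j) \<omega> = A j \<omega> * exp (- ((X j \<omega>)\<^sup>2) / 2)" for \<omega>
      unfolding A_def by (simp add: exp_add[symmetric] add_divide_distrib diff_divide_distrib)
    let ?F = "\<lambda>\<omega> x. complex_of_real (A j \<omega>) * iexp (X j \<omega> * x + B (Suc j) u \<omega>)"
    have int: "integrable (M \<Otimes>\<^sub>M std_normal_distribution) (case_prod ?F)"
    proof (rule P.integrable_const_bound[of _ 1])
      have "norm (?F \<omega> x) \<le> 1" for \<omega> x using A_le[of j \<omega>] by (simp only: norm_mult norm_exp_i_times norm_of_real mult_1_right)
      then show "AE x in M \<Otimes>\<^sub>M std_normal_distribution. norm (case x of (\<omega>, x) \<Rightarrow> ?F \<omega> x) \<le> 1"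
        by (auto split: prod.split)
    qed measurable
    have inner: "(CLINT x|std_normal_distribution. ?F \<omega> x) = complex_of_real (A (Suc j) \<omega>) * iexp (B (Suc j) u \<omega>)" for \<omega>
    proof -
      have "?F \<omega> x = (complex_of_real (A j \<omega>) * iexp (B (Suc j) u \<omega>)) * iexp (X j \<omega> * x)" for x
        by (simp add: exp_add distrib_left mult_ac)
      then have "(CLINT x|std_normal_distribution. ?F \<omega> x)
          = (complex_of_real (A j \<omega>) * iexp (B (Suc j) u \<omega>)) * (CLINT x|std_normal_distribution. iexp (X j \<omega> * x))"
        by (simp only: integral_mult_right_zero)
      also have "\<dots> = complex_of_real (A (Suc j) \<omega>) * iexp (B (Suc j) u \<omega>)"
        unfolding gauss_iexp A by simp
      finally show ?thesis .
    qed
    have "(CLINT \<omega>|M. complex_of_real (A (Suc j) \<omega>) * iexp (B (Suc j) u \<omega>))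
        = (CLINT x|std_normal_distribution. (CLINT \<omega>|M. ?F \<omega> x))"
      unfolding inner[symmetric] by (rule P.Fubini_integral[OF int, symmetric])
    also have "\<dots> = (CLINT x|std_normal_distribution. complex_of_real (((\<Prod>k<j. a k) * exp (- R)) * exp (- D j x)))"
    proof (intro Bochner_Integration.integral_cong refl)
      fix x
      have "(CLINT \<omega>|M. ?F \<omega> x) = complex_of_real ((\<Prod>k<j. a k) * exp (- (\<Sum>k=j..<N. D k ((u(j := x)) k))))"
        using Suc.IH[of "u(j := x)"] j unfolding B by simp
      also have "(\<Sum>k=j..<N. D k ((u(j := x)) k)) = D j x + R"
        unfolding split R_def by simp
      finally show "(CLINT \<omega>|M. ?F \<omega> x) = complex_of_real (((\<Prod>k<j. a k) * exp (- R)) * exp (- D j x))"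
        by (simp only: minus_add_distrib exp_add mult_ac)
    qed
    also have "\<dots> = complex_of_real (((\<Prod>k<j. a k) * exp (- R)) * a j)"
      unfolding a_def by (simp only: integral_complex_of_real integral_mult_right_zero)
    finally show ?case by (simp add: R_def mult_ac)
  qed
  have "complex_of_real (expectation (A N)) = complex_of_real (\<Prod>k<N. a k)"
    using claim[of N "\<lambda>_. 0"] by (simp add: B_def)
  then show ?thesis unfolding A_def a_def of_real_eq_iff .
qed

end

subsection \<open>Step functions on uniform partitions\<close>

definition grid :: "real \<Rightarrow> nat \<Rightarrow> nat \<Rightarrow> real" where
  "grid T m j = real j * T / real m"

text \<open>Cells are closed on the left, and \<open>s = T\<close> receives the index
  \<open>m\<close>, one beyond the last interval. This is harmless: values at partition points do
  not enter a simple integral.\<close>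

definition grid_index :: "real \<Rightarrow> nat \<Rightarrow> real \<Rightarrow> nat" where
  "grid_index T m s = nat \<lfloor>s * real m / T\<rfloor>"

lemma grid_index_eq:
  assumes "0 < T" "0 < m" "grid T m j \<le> s" "s < grid T m (Suc j)"
  shows "grid_index T m s = j"
proof -
  have "real j \<le> s * real m / T" "s * real m / T < real j + 1"
    using assms by (auto simp: grid_def field_simps)
  then have "\<lfloor>s * real m / T\<rfloor> = int j" by (intro floor_unique) auto
  then show ?thesis by (simp add: grid_index_def)
qed

lemma grid_index_bounds:
  assumes "0 < T" "0 < m" "0 \<le> s"
  shows "grid T m (grid_index T m s) \<le> s" and "s < grid T m (grid_index T m s) + T / real m"
proof -
  have nn: "0 \<le> s * real m / T" using assms by simp
  then have "real (grid_index T m s) \<le> s * real m / T" "s * real m / T < real (grid_index T m s) + 1"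
    unfolding grid_index_def by linarith+
  then show "grid T m (grid_index T m s) \<le> s" "s < grid T m (grid_index T m s) + T / real m"
    using assms by (auto simp: grid_def field_simps)
qed

lemma grid_nonneg: "0 < T \<Longrightarrow> 0 \<le> grid T m j"
  by (simp add: grid_def)

lemma is_simple_grid:
  assumes "0 < T" "0 < m"
  shows "is_simple T m (grid T m) w (\<lambda>s. w (grid_index T m s))"
proof -
  have "grid T m j \<le> grid T m (Suc j)" for j
    using assms by (simp add: grid_def divide_right_mono)
  moreover have "w (grid_index T m s) = w j" if "s \<in> {grid T m j<..<grid T m (Suc j)}" for s j
    using grid_index_eq[OF assms, of j s] that by simp
  ultimately show ?thesis
    unfolding is_simple_def using assms by (intro conjI allI impI ballI) (auto simp: grid_def)
qed

lemma regulated_grid: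
  assumes T: "0 < T" and m: "0 < m"
  shows "regulated T (\<lambda>s. w (grid_index T m s))"
  unfolding regulated_def
proof (intro conjI ballI)
  fix t assume "t \<in> {0..<T}"
  then have t: "0 \<le> t" by simp
  define j where "j = grid_index T m t"
  have j: "grid T m j \<le> t" "t < grid T m (Suc j)"
    using grid_index_bounds[OF T m t] by (auto simp: j_def grid_def add_divide_distrib distrib_right)
  have "\<forall>\<^sub>F s in at_right t. s \<in> {t<..<grid T m (Suc j)}"
    using j(2) by (rule eventually_at_right_real)
  then have "\<forall>\<^sub>F s in at_right t. w (grid_index T m s) = w j"
  proof eventually_elim
    case (elim s)
    then have "grid_index T m s = j" using j by (intro grid_index_eq[OF T m]) auto
    then show ?case by simp
  qed
  then show "\<exists>l. ((\<lambda>s. w (grid_index T m s)) \<longlongrightarrow> l) (at_right t)"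
    by (intro exI tendsto_eventually)
next
  fix t assume "t \<in> {0<..T}"
  then have t: "0 < t" by simp
  \<comment> \<open>The left limit at \<open>t\<close> sees the cell just below \<open>t\<close>. At
    a grid point this is the preceding cell, hence ceiling minus 1 instead of the floor.\<close>
  define i where "i = nat (\<lceil>t * real m / T\<rceil> - 1)"
  have "0 < t * real m / T" using t T m by simp
  then have "real i < t * real m / T" "t * real m / T \<le> real i + 1"
    unfolding i_def by linarith+
  then have i: "grid T m i < t" "t \<le> grid T m (Suc i)"
    using T m by (auto simp: grid_def field_simps)
  have "\<forall>\<^sub>F s in at_left t. s \<in> {grid T m i<..<t}"
    using i(1) by (rule eventually_at_left_real)
  then have "\<forall>\<^sub>F s in at_left t. w (grid_index T m s) = w i"
  proof eventually_elim
    case (elim s)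
    then have "grid_index T m s = i" using i by (intro grid_index_eq[OF T m]) auto
    then show ?case by simp
  qed
  then show "\<exists>l. ((\<lambda>s. w (grid_index T m s)) \<longlongrightarrow> l) (at_left t)"
    by (intro exI tendsto_eventually)
qed

lemma grid_index_refine:
  assumes "0 < T" "0 < m" "0 < r" "0 \<le> s"
  shows "grid_index T (m * r) s div r = grid_index T m s"
proof -
  have "\<lfloor>s * real m / T\<rfloor> = \<lfloor>(s * real (m * r) / T) / real_of_int (int r)\<rfloor>"
    using assms by (simp add: field_simps)
  also have "\<dots> = \<lfloor>s * real (m * r) / T\<rfloor> div int r"
    by (rule floor_divide_real_eq_div) simp
  finally show ?thesis
    using assms by (simp add: grid_index_def nat_div_distrib)
qed

text \<open>The increments telescope within each block of \<open>r\<close> fine cells. Two step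
  functions on different meshes can thus be compared on the grid whose number of cells is the
  product.\<close>

lemma simple_integral_refine:
  assumes "0 < m" "0 < r"
  shows "simple_integral L (m * r) (grid T (m * r)) (\<lambda>i. w (i div r)) \<omega> = simple_integral L m (grid T m) w \<omega>"
proof -
  let ?f = "\<lambda>i. L (grid T (m * r) (Suc i)) (w (i div r)) \<omega> - L (grid T (m * r) i) (w (i div r)) \<omega>"
  have g: "grid T (m * r) (j * r) = grid T m j" for j
    using assms by (simp add: grid_def)
  have "(\<Sum>i<m * r. ?f i) = (\<Sum>j<m. \<Sum>i=j * r..<j * r + r. ?f i)"
    by (rule sum.nat_group[symmetric])
  also have "\<dots> = (\<Sum>j<m. L (grid T m (Suc j)) (w j) \<omega> - L (grid T m j) (w j) \<omega>)"
  proof (intro sum.cong refl)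
    fix j
    have "(\<Sum>i=j * r..<j * r + r. ?f i)
        = (\<Sum>i=j * r..<j * r + r. L (grid T (m * r) (Suc i)) (w j) \<omega> - L (grid T (m * r) i) (w j) \<omega>)"
    proof (intro sum.cong refl)
      fix i assume "i \<in> {j * r..<j * r + r}"
      then have "i div r = j" by (intro div_nat_eqI) (auto simp: mult.commute)
      then show "?f i = L (grid T (m * r) (Suc i)) (w j) \<omega> - L (grid T (m * r) i) (w j) \<omega>" by simp
    qed
    also have "\<dots> = L (grid T (m * r) (j * r + r)) (w j) \<omega> - L (grid T (m * r) (j * r)) (w j) \<omega>"
      by (rule sum_Suc_diff'[of "j * r" "j * r + r" "\<lambda>i. L (grid T (m * r) i) (w j) \<omega>"]) simp
    also have "\<dots> = L (grid T m (Suc j)) (w j) \<omega> - L (grid T m j) (w j) \<omega>"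
      using g[of j] g[of "Suc j"] by (simp add: add.commute)
    finally show "(\<Sum>i=j * r..<j * r + r. ?f i) = L (grid T m (Suc j)) (w j) \<omega> - L (grid T m j) (w j) \<omega>" .
  qed
  finally show ?thesis unfolding simple_integral_def .
qed

context diagonal_levy
begin

lemma simple_integral_linear:
  assumes "0 < T"
  shows "AE \<omega> in M. simple_integral L m (grid T m) (\<lambda>j. a *\<^sub>R v j + b *\<^sub>R w j) \<omega>
    = a * simple_integral L m (grid T m) v \<omega> + b * simple_integral L m (grid T m) w \<omega>"
proof -
  have "AE \<omega> in M. \<forall>j\<in>{..<m}. \<forall>i\<in>{j, Suc j}.
      L (grid T m i) (a *\<^sub>R v j + b *\<^sub>R w j) \<omega> = a * L (grid T m i) (v j) \<omega> + b * L (grid T m i) (w j) \<omega>"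
    using assms by (intro AE_finite_allI L_linear grid_nonneg) auto
  then show ?thesis
  proof eventually_elim
    case (elim \<omega>)
    then have "simple_integral L m (grid T m) (\<lambda>j. a *\<^sub>R v j + b *\<^sub>R w j) \<omega>
      = (\<Sum>j<m. (a * L (grid T m (Suc j)) (v j) \<omega> + b * L (grid T m (Suc j)) (w j) \<omega>)
          - (a * L (grid T m j) (v j) \<omega> + b * L (grid T m j) (w j) \<omega>))"
      unfolding simple_integral_def by (intro sum.cong) auto
    also have "\<dots> = a * simple_integral L m (grid T m) v \<omega> + b * simple_integral L m (grid T m) w \<omega>"
      unfolding simple_integral_def
      by (simp add: sum_distrib_left sum.distrib[symmetric] algebra_simps)
    finally show ?case .
  qed
qed

lemma has_regulated_integral_grid:
  assumes "0 < T" "0 < m"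
  shows "has_regulated_integral M L T (\<lambda>s. w (grid_index T m s)) (simple_integral L m (grid T m) w)"
  unfolding has_regulated_integral_def
proof (intro conjI)
  show "\<exists>m' t v h. (\<forall>n. is_simple T (m' n) (t n) (v n) (h n)) \<and>
      uniform_limit {0..T} h (\<lambda>s. w (grid_index T m s)) sequentially \<and>
      tendsto_in_prob M (\<lambda>n. simple_integral L (m' n) (t n) (v n)) (simple_integral L m (grid T m) w) sequentially"
    using is_simple_grid[OF assms, of w]
    by (intro exI[of _ "\<lambda>_. m"] exI[of _ "\<lambda>_. grid T m"] exI[of _ "\<lambda>_. w"]
        exI[of _ "\<lambda>_ s. w (grid_index T m s)"])
       (auto simp: tendsto_in_prob_def intro!: uniform_limitI)
qed (rule regulated_grid[OF assms] simple_integral_measurable[OF is_simple_grid[OF assms]])+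

end

subsection \<open>Approximation of indicator functions\<close>

text \<open>The definition of \<open>measurable_on\<close> itself supplies continuous functions
  converging off a negligible set. Clamping to [0,1] keeps the limit and adds the uniform bound
  demanded of approximations to the cylindrical integral.\<close>

lemma indicator_continuous_approximation:
  assumes "A \<in> sets (borel :: real measure)"
  obtains N c where "negligible N" "\<And>n. continuous_on UNIV (c n)"
    "\<And>n s. 0 \<le> c n s" "\<And>n s. c n s \<le> 1"
    "\<And>s. s \<notin> N \<Longrightarrow> (\<lambda>n. c n s) \<longlonglongrightarrow> (indicator A s :: real)"
proof -
  have "A \<in> sets lebesgue" using assms by simp
  then have "(indicator A :: real \<Rightarrow> real) measurable_on UNIV"
    by (intro lebesgue_measurable_imp_measurable_on_nnreal_UNIV borel_measurable_indicator) auto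
  then obtain N g where N: "negligible N" and g: "\<And>n. continuous_on UNIV (g n)"
    and lim: "\<And>x. x \<notin> N \<Longrightarrow> (\<lambda>n. g n x) \<longlonglongrightarrow> (indicator A x :: real)"
    unfolding measurable_on_def by auto
  have "(\<lambda>n. max 0 (min 1 (g n x))) \<longlonglongrightarrow> (indicator A x :: real)" if "x \<notin> N" for x
  proof -
    have "(\<lambda>n. max 0 (min 1 (g n x))) \<longlonglongrightarrow> max 0 (min 1 (indicator A x :: real))"
      by (intro tendsto_max tendsto_min tendsto_const lim that)
    then show ?thesis by (simp add: indicator_def split: if_splits)
  qed
  then show ?thesis
    using N g by (intro that[of N "\<lambda>n x. max 0 (min 1 (g n x))"]) (auto intro!: continuous_intros)
qed

text \<open>The mesh is chosen after the continuous function, so that sampling it at the left grid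
  points does no harm in the limit.\<close>

lemma indicator_grid_approximation:
  fixes T :: real
  assumes "A \<in> sets (borel :: real measure)" and T: "0 < T"
  obtains N m c where "negligible N" "\<And>n. 0 < m n" "filterlim m at_top sequentially"
    "\<And>n s. 0 \<le> c n s" "\<And>n s. c n s \<le> 1"
    "\<And>s. s \<in> {0..T} - N \<Longrightarrow> (\<lambda>n. c n (grid T (m n) (grid_index T (m n) s))) \<longlonglongrightarrow> (indicator A s :: real)"
proof -
  obtain N c where N: "negligible N" and c: "\<And>n. continuous_on UNIV (c n)"
    "\<And>n s. 0 \<le> c n s" "\<And>n s. c n s \<le> 1"
    and lim: "\<And>s. s \<notin> N \<Longrightarrow> (\<lambda>n. c n s) \<longlonglongrightarrow> (indicator A s :: real)"
    using indicator_continuous_approximation[OF assms(1)] by metis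
  have "\<exists>m. n < m \<and> (\<forall>s\<in>{0..T}. \<forall>s'\<in>{0..T}. \<bar>s - s'\<bar> \<le> T / real m \<longrightarrow> \<bar>c n s - c n s'\<bar> < inverse (real (Suc n)))" for n
  proof -
    have "uniformly_continuous_on {0..T} (c n)"
      by (intro compact_uniformly_continuous continuous_on_subset[OF c(1)]) auto
    then obtain d where d: "0 < d" "\<And>s s'. s \<in> {0..T} \<Longrightarrow> s' \<in> {0..T} \<Longrightarrow> dist s' s < d \<Longrightarrow> dist (c n s') (c n s) < inverse (real (Suc n))"
      unfolding uniformly_continuous_on_def by (metis inverse_positive_iff_positive of_nat_0_less_iff zero_less_Suc)
    obtain k :: nat where k: "T / d < real k" using reals_Archimedean2 by blast
    \<comment> \<open>The part \<open>k\<close> makes the mesh finer than the modulus of continuity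
      \<open>d\<close>; the part \<open>n\<close> forces the number of cells to infinity.\<close>
    define m where "m = Suc (max k n)"
    have "T / real m < d"
    proof -
      have "T / d < real m" using k by (simp add: m_def)
      then show ?thesis using d(1) by (simp add: field_simps m_def)
    qed
    then have "\<forall>s\<in>{0..T}. \<forall>s'\<in>{0..T}. \<bar>s - s'\<bar> \<le> T / real m \<longrightarrow> \<bar>c n s - c n s'\<bar> < inverse (real (Suc n))"
      using d(2) by (auto simp: dist_real_def)
    moreover have "n < m" by (simp add: m_def)
    ultimately show ?thesis by blast
  qed
  then obtain m where m: "\<And>n. n < m n"
    "\<And>n s s'. s \<in> {0..T} \<Longrightarrow> s' \<in> {0..T} \<Longrightarrow> \<bar>s - s'\<bar> \<le> T / real (m n) \<Longrightarrow> \<bar>c n s - c n s'\<bar> < inverse (real (Suc n))"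
    by metis
  have m_pos: "0 < m n" for n using m(1)[of n] by simp
  have "filterlim m at_top sequentially"
    by (rule filterlim_at_top_mono[OF filterlim_ident]) (use m(1) in \<open>auto intro!: always_eventually less_imp_le\<close>)
  moreover have "(\<lambda>n. c n (grid T (m n) (grid_index T (m n) s))) \<longlonglongrightarrow> (indicator A s :: real)"
    if s: "s \<in> {0..T} - N" for s
  proof -
    let ?t = "\<lambda>n. grid T (m n) (grid_index T (m n) s)"
    have "\<bar>c n (?t n) - c n s\<bar> \<le> inverse (real (Suc n))" for n
      using s grid_index_bounds[OF T m_pos[of n], of s] grid_nonneg[OF T, of "m n"]
      by (intro less_imp_le m(2)) auto
    then have "(\<lambda>n. c n (?t n) - c n s) \<longlonglongrightarrow> 0"
      by (intro Lim_null_comparison[OF _ LIMSEQ_inverse_real_of_nat] always_eventually) auto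
    from tendsto_add[OF this lim[of s]] s show ?thesis by simp
  qed
  ultimately show ?thesis using N m_pos c by (intro that[of N m c]) auto
qed

subsection \<open>Diagonal semigroups\<close>

locale diagonal_semigroup = diagonal_levy M e L l \<nu>
  for M :: "'w measure" and e :: "nat \<Rightarrow> 'v::{real_inner, polish_space}"
    and L :: "real \<Rightarrow> 'v \<Rightarrow> 'w \<Rightarrow> real" and l :: "nat \<Rightarrow> real \<Rightarrow> 'w \<Rightarrow> real" and \<nu> :: "nat \<Rightarrow> real measure" +
  fixes S :: "real \<Rightarrow> 'v \<Rightarrow>\<^sub>L 'v" and \<gamma> :: "nat \<Rightarrow> real" and T :: real
  assumes T: "0 < T"
    and S_semigroup: "strongly_continuous_semigroup_on T S"
    and S_eigen: "\<And>t k. t \<in> {0..T} \<Longrightarrow> adjoint (blinfun_apply (S t)) (e k) = exp (\<gamma> k * t) *\<^sub>R e k"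
begin

lemma S_coeff: "s \<in> {0..T} \<Longrightarrow> blinfun_apply (S s) v \<bullet> e k = exp (\<gamma> k * s) * (v \<bullet> e k)"
  and adjoint_S: "s \<in> {0..T} \<Longrightarrow> adjoint (blinfun_apply (S s)) v = blinfun_apply (S s) v"
  using diagonal_adjoint[OF S_eigen] by blast+

lemma S_continuous: "continuous_on {0..T} (\<lambda>s. blinfun_apply (S s) v)"
  using S_semigroup by (simp add: strongly_continuous_semigroup_on_def)

lemma S_bounded:
  obtains C where "\<And>s. s \<in> {0..T} \<Longrightarrow> norm (blinfun_apply (S s) v) \<le> C"
proof -
  have "bounded ((\<lambda>s. blinfun_apply (S s) v) ` {0..T})"
    by (intro compact_imp_bounded compact_continuous_image S_continuous) simp
  then show ?thesis using that unfolding bounded_iff by blast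
qed

lemma S_basis_proj: "s \<in> {0..T} \<Longrightarrow> blinfun_apply (S s) (basis_proj e N v) = basis_proj e N (blinfun_apply (S s) v)"
  by (rule eqI_coeffs) (simp add: S_coeff inner_basis_proj_left)

lemma weakly_regulated_S: "weakly_regulated T S"
  unfolding weakly_regulated_def regulated_def
proof (intro allI conjI ballI)
  fix v t assume t: "t \<in> {0..<T}"
  have "((\<lambda>s. blinfun_apply (S s) v) \<longlongrightarrow> blinfun_apply (S t) v) (at t within {0..T})"
    using S_continuous[of v] t by (simp add: continuous_on_def)
  \<comment> \<open>Adjoint and operator are known to agree on [0,T] only, so they are exchanged
    within {t..T}, which near \<open>t\<close> describes the same filter as
    \<open>at_right t\<close>.\<close>
  then have "((\<lambda>s. blinfun_apply (S s) v) \<longlongrightarrow> blinfun_apply (S t) v) (at t within {t..T})"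
    by (rule tendsto_within_subset) (use t in auto)
  then have "((\<lambda>s. adjoint (blinfun_apply (S s)) v) \<longlongrightarrow> blinfun_apply (S t) v) (at t within {t..T})"
    using t by (subst tendsto_cong[of _ "\<lambda>s. blinfun_apply (S s) v"])
      (auto simp: eventually_at_filter adjoint_S)
  then show "\<exists>l. ((\<lambda>s. adjoint (blinfun_apply (S s)) v) \<longlongrightarrow> l) (at_right t)"
    using t by (auto simp: at_within_Icc_at_right)
next
  fix v t assume t: "t \<in> {0<..T}"
  have "((\<lambda>s. blinfun_apply (S s) v) \<longlongrightarrow> blinfun_apply (S t) v) (at t within {0..T})"
    using S_continuous[of v] t by (simp add: continuous_on_def)
  then have "((\<lambda>s. blinfun_apply (S s) v) \<longlongrightarrow> blinfun_apply (S t) v) (at t within {0..t})"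
    by (rule tendsto_within_subset) (use t in auto)
  then have "((\<lambda>s. adjoint (blinfun_apply (S s)) v) \<longlongrightarrow> blinfun_apply (S t) v) (at t within {0..t})"
    using t by (subst tendsto_cong[of _ "\<lambda>s. blinfun_apply (S s) v"])
      (auto simp: eventually_at_filter adjoint_S)
  then show "\<exists>l. ((\<lambda>s. adjoint (blinfun_apply (S s)) v) \<longlongrightarrow> l) (at_left t)"
    using t by (auto simp: at_within_Icc_at_left)
qed

text \<open>Coordinates from \<open>N\<close> on are 0 and contribute nothing. The additive form,
  with one frequency \<open>u k\<close> per summand, is what makes the joint characteristic function
  of the coordinates factorise.\<close>

lemma cyl_exponent_S_finite:
  assumes "s \<in> {0..T}"
  shows "cyl_exponent (blinfun_apply (S s) (\<Sum>k<N. u k *\<^sub>R e k)) = (\<Sum>k<N. jump_exponent (\<nu> k) (u k * exp (\<gamma> k * s)))"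
proof -
  have "blinfun_apply (S s) (\<Sum>k<N. u k *\<^sub>R e k) \<bullet> e k = (if k < N then u k * exp (\<gamma> k * s) else 0)" for k
    by (simp add: S_coeff[OF assms] inner_sum_basis)
  then have "e k \<bullet> blinfun_apply (S s) (\<Sum>k<N. u k *\<^sub>R e k) = (if k < N then u k * exp (\<gamma> k * s) else 0)" for k
    by (simp only: inner_commute[of "e k"])
  then have "cyl_exponent (blinfun_apply (S s) (\<Sum>k<N. u k *\<^sub>R e k))
      = (\<Sum>k. jump_exponent (\<nu> k) (if k < N then u k * exp (\<gamma> k * s) else 0))"
    unfolding cyl_exponent_def by simp
  also have "\<dots> = (\<Sum>k<N. jump_exponent (\<nu> k) (if k < N then u k * exp (\<gamma> k * s) else 0))"
    by (rule suminf_finite) auto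
  finally show ?thesis by simp
qed

subsection \<open>Necessity\<close>

text \<open>What integrability provides is a vector \<open>I\<close> of finite norm, so that
  \<open>c\<close>, the expectation of \<open>exp (- (norm I)^2 / 2)\<close>, is positive. By Bessel
  it bounds from below all products of the Gaussian averages \<open>a k\<close>.\<close>

lemma integrable_imp_sum_finite:
  assumes "stochastically_integrable M L T S"
  shows "(\<Sum>k. damped_mass k (\<gamma> k) T) < \<infinity>"
proof -
  from assms obtain I where I[measurable]: "I \<in> borel_measurable M"
    and cyl_I: "\<And>v. has_cylindrical_integral M L T
         (\<lambda>s. indicator {0..T} s *\<^sub>R adjoint (blinfun_apply (S s)) v) (\<lambda>\<omega>. I \<omega> \<bullet> v)"
    unfolding stochastically_integrable_def by (metis atLeastAtMost_borel order_refl)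
  interpret G: prob_space std_normal_distribution by (rule prob_space_std_normal)
  define X where "X k \<omega> = I \<omega> \<bullet> e k" for k \<omega>
  define D where "D k = damped_exponent k (\<gamma> k) T" for k
  have [measurable]: "X k \<in> borel_measurable M" "D k \<in> borel_measurable borel" for k
    unfolding X_def D_def by measurable
  have D_nonneg: "0 \<le> D k u" for k u unfolding D_def by (rule damped_exponent_nonneg)
  have char: "(CLINT \<omega>|M. iexp (\<Sum>k<N. u k * X k \<omega>)) = complex_of_real (exp (- (\<Sum>k<N. D k (u k))))" for N u
  proof -
    \<comment> \<open>Pairing \<open>I\<close> with this vector and taking the characteristic
      function at 1 yields the joint characteristic function of the first \<open>N\<close>
      coordinates at \<open>u\<close>.\<close>
    let ?v = "\<Sum>k<N. u k *\<^sub>R e k"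
    have "char (distr M borel (\<lambda>\<omega>. I \<omega> \<bullet> ?v)) 1 = complex_of_real (exp (- integral {0..T}
        (\<lambda>s. cyl_exponent (1 *\<^sub>R indicator {0..T} s *\<^sub>R adjoint (blinfun_apply (S s)) ?v))))"
      by (rule cylindrical_integral_char(2)[OF cyl_I])
    also have "integral {0..T} (\<lambda>s. cyl_exponent (1 *\<^sub>R indicator {0..T} s *\<^sub>R adjoint (blinfun_apply (S s)) ?v))
        = integral {0..T} (\<lambda>s. \<Sum>k<N. jump_exponent (\<nu> k) (u k * exp (\<gamma> k * s)))"
      by (rule Henstock_Kurzweil_Integration.integral_cong) (simp add: adjoint_S cyl_exponent_S_finite)
    also have "\<dots> = (\<Sum>k<N. D k (u k))"
      unfolding D_def damped_exponent_def
      by (rule Henstock_Kurzweil_Integration.integral_sum) (auto intro: integrable_jump_exponent_exp)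
    finally show ?thesis
      by (simp add: char_def integral_distr X_def inner_sum_right del: of_real_sum)
  qed
  define a where "a k = (LINT u|std_normal_distribution. exp (- D k u))" for k
  have int_exp: "integrable std_normal_distribution (\<lambda>u. exp (- D k u))" for k
    by (rule G.integrable_const_bound[of _ 1]) (use D_nonneg in auto)
  define c where "c = expectation (\<lambda>\<omega>. exp (- ((norm (I \<omega>))\<^sup>2) / 2))"
  have int_c: "integrable M (\<lambda>\<omega>. exp (- ((norm (I \<omega>))\<^sup>2) / 2))"
    by (rule integrable_const_bound[of _ 1]) auto
  have "c \<noteq> 0"
  proof
    assume "c = 0"
    then have "AE \<omega> in M. exp (- ((norm (I \<omega>))\<^sup>2) / 2) = 0"
      unfolding c_def using integral_nonneg_eq_0_iff_AE[OF int_c] by simp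
    then show False by (simp add: AE_False)
  qed
  moreover have "0 \<le> c" unfolding c_def by (intro Bochner_Integration.integral_nonneg) simp
  ultimately have "0 < c" by simp
  have prod_ge: "c \<le> (\<Prod>k<N. a k)" for N
  proof -
    have "c \<le> expectation (\<lambda>\<omega>. exp (- (\<Sum>k<N. (X k \<omega>)\<^sup>2) / 2))"
      unfolding c_def
    proof (rule integral_mono[OF int_c])
      show "integrable M (\<lambda>\<omega>. exp (- (\<Sum>k<N. (X k \<omega>)\<^sup>2) / 2))"
        by (rule integrable_const_bound[of _ 1]) (auto simp: sum_nonneg)
      show "exp (- ((norm (I \<omega>))\<^sup>2) / 2) \<le> exp (- (\<Sum>k<N. (X k \<omega>)\<^sup>2) / 2)" for \<omega>
        using Bessel[of "I \<omega>" N] by (simp add: X_def)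
    qed
    also have "\<dots> = (\<Prod>k<N. a k)"
      unfolding a_def using D_nonneg char by (intro gauss_randomisation) auto
    finally show ?thesis .
  qed
  have gauss_eq: "(LINT u|std_normal_distribution. 1 - exp (- D k u)) = 1 - a k" for k
    using int_exp[of k] G.prob_space by (simp add: a_def)
  have a_le: "0 \<le> 1 - a k" for k
    unfolding gauss_eq[symmetric] using D_nonneg by (intro Bochner_Integration.integral_nonneg) simp
  have a_nonneg: "0 \<le> a k" for k
    unfolding a_def by (intro Bochner_Integration.integral_nonneg) simp
  have "(\<Sum>k<N. 1 - a k) \<le> - ln c" for N
  proof -
    have "c \<le> (\<Prod>k<N. a k)" by (rule prod_ge)
    \<comment> \<open>The inequality \<open>a \<le> exp (- (1 - a))\<close> converts the lower bound
      on the product into an upper bound on a sum.\<close>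
    also have "\<dots> \<le> (\<Prod>k<N. exp (- (1 - a k)))"
      using exp_ge_add_one_self[of "- (1 - a _)"] a_nonneg by (intro prod_mono) auto
    also have "\<dots> = exp (- (\<Sum>k<N. 1 - a k))" by (simp add: exp_sum[symmetric] sum_negf[symmetric])
    finally have "ln c \<le> ln (exp (- (\<Sum>k<N. 1 - a k)))" using \<open>0 < c\<close> by (subst ln_le_cancel_iff) auto
    then show ?thesis by simp
  qed
  then have summable_a: "summable (\<lambda>k. 1 - a k)"
    by (intro summableI_nonneg_bounded a_le)
  define m where "m k = enn2real (damped_mass k (\<gamma> k) T)" for k
  have m: "damped_mass k (\<gamma> k) T = ennreal (m k)" "0 \<le> m k" for k
    using damped_mass_finite[of k "\<gamma> k" T] by (auto simp: m_def)
  have min_le: "min (m k) 1 \<le> 432 * (1 - a k)" for k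
    using min_damped_mass_le[of k "\<gamma> k" T] gauss_eq[of k] by (simp add: m_def D_def)
  \<comment> \<open>The estimate concerns \<open>min (m k) 1\<close> only. Since its right side
    tends to 0, the truncation is inactive for all large \<open>k\<close>.\<close>
  have "(\<lambda>k. 432 * (1 - a k)) \<longlonglongrightarrow> 432 * 0"
    by (intro tendsto_mult_left summable_LIMSEQ_zero summable_a)
  then have "\<forall>\<^sub>F k in sequentially. 432 * (1 - a k) < 1"
    by (intro order_tendstoD(2)) auto
  then have "\<forall>\<^sub>F k in sequentially. norm (m k) \<le> 432 * (1 - a k)"
  proof eventually_elim
    case (elim k)
    then show ?case using min_le[of k] m(2)[of k] by simp
  qed
  then have "summable m"
    by (rule summable_comparison_test_ev) (intro summable_mult summable_a)
  then have "(\<Sum>k. ennreal (m k)) = ennreal (\<Sum>k. m k)"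
    using m(2) by (intro suminf_ennreal_eq summable_sums)
  then show ?thesis by (simp add: m(1))
qed

subsection \<open>Sufficiency\<close>

text \<open>The integrand is sampled at left grid points, with continuous functions in place of the
  indicator. The grids and these functions do not depend on \<open>v\<close>, so every approximation
  is almost surely linear in \<open>v\<close>, and so is the limit.\<close>

lemma cylindrical_integral_exists:
  assumes A: "A \<in> sets borel"
  obtains Z where "\<And>v. Z v \<in> borel_measurable M"
    "\<And>v. has_cylindrical_integral M L T (\<lambda>s. indicator A s *\<^sub>R blinfun_apply (S s) v) (Z v)"
    "\<And>a b v w. AE \<omega> in M. Z (a *\<^sub>R v + b *\<^sub>R w) \<omega> = a * Z v \<omega> + b * Z w \<omega>"
proof -
  obtain N m c where N: "negligible N" and m: "\<And>n. 0 < m n" "filterlim m at_top sequentially"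
    and c: "\<And>n s. 0 \<le> c n s" "\<And>n s. c n s \<le> 1"
      "\<And>s. s \<in> {0..T} - N \<Longrightarrow> (\<lambda>n. c n (grid T (m n) (grid_index T (m n) s))) \<longlonglongrightarrow> (indicator A s :: real)"
    by (fact indicator_grid_approximation[OF A T])
  define w where "w n v j = c n (grid T (m n) j) *\<^sub>R blinfun_apply (S (grid T (m n) j)) v" for n v j
  define h where "h n v s = w n v (grid_index T (m n) s)" for n v s
  define J where "J n v = simple_integral L (m n) (grid T (m n)) (w n v)" for n v
  have simple: "is_simple T (m n) (grid T (m n)) (w n v) (h n v)" for n v
    unfolding h_def by (rule is_simple_grid[OF T m(1)])
  have J_meas [measurable]: "J n v \<in> borel_measurable M" for n v
    unfolding J_def by (rule simple_integral_measurable[OF simple])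
  have grid_in: "grid T (m n) (grid_index T (m n) s) \<in> {0..T}" if "s \<in> {0..T}" for n s
    using grid_index_bounds(1)[OF T m(1)[of n], of s] grid_nonneg[OF T] that by auto
  have bound: "\<exists>C. \<forall>n. \<forall>s\<in>{0..T}. norm (h n v s) \<le> C" for v
  proof -
    obtain C where C: "\<And>s. s \<in> {0..T} \<Longrightarrow> norm (blinfun_apply (S s) v) \<le> C" using S_bounded by blast
    have "norm (h n v s) \<le> C" if "s \<in> {0..T}" for n s
    proof -
      let ?t = "grid T (m n) (grid_index T (m n) s)"
      have "norm (h n v s) = c n ?t * norm (blinfun_apply (S ?t) v)"
        using c(1) by (simp add: h_def w_def)
      also have "\<dots> \<le> 1 * C"
        using c C[OF grid_in[OF that]] by (intro mult_mono) auto
      finally show ?thesis by simp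
    qed
    then show ?thesis by blast
  qed
  have conv: "(\<lambda>n. h n v s) \<longlonglongrightarrow> indicator A s *\<^sub>R blinfun_apply (S s) v" if s: "s \<in> {0..T} - N" for v s
  proof -
    let ?t = "\<lambda>n. grid T (m n) (grid_index T (m n) s)"
    have "(\<lambda>n. T / real (m n)) \<longlonglongrightarrow> 0"
      by (intro real_tendsto_divide_at_top[OF tendsto_const]
          filterlim_compose[OF filterlim_real_sequentially m(2)])
    then have "(\<lambda>n. ?t n - s) \<longlonglongrightarrow> 0"
    proof (rule Lim_null_comparison[rotated], intro always_eventually allI)
      show "norm (?t n - s) \<le> T / real (m n)" for n
        using grid_index_bounds[OF T m(1)[of n], of s] s by auto
    qed
    then have "?t \<longlonglongrightarrow> s" by (rule LIM_zero_cancel)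
    then have "(\<lambda>n. blinfun_apply (S (?t n)) v) \<longlonglongrightarrow> blinfun_apply (S s) v"
      by (rule continuous_on_tendsto_compose[OF S_continuous]) (use s grid_in in auto)
    then show ?thesis
      unfolding h_def w_def by (intro tendsto_scaleR c(3)[OF s])
  qed
  have Cauchy: "\<exists>K. \<forall>p\<ge>K. \<forall>q\<ge>K. prob {\<omega> \<in> space M. \<epsilon> < \<bar>J p v \<omega> - J q v \<omega>\<bar>} \<le> \<epsilon>" if \<epsilon>: "\<epsilon> > 0" for \<epsilon> v
  proof (rule ccontr)
    assume "\<not> ?thesis"
    then have "\<forall>K. \<exists>p q. K \<le> p \<and> K \<le> q \<and> \<epsilon> < prob {\<omega> \<in> space M. \<epsilon> < \<bar>J p v \<omega> - J q v \<omega>\<bar>}"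
      by (meson not_le)
    \<comment> \<open>A failure of the Cauchy property gives indices \<open>p\<close>,
      \<open>q\<close> tending to infinity along which the integrals stay apart. Both integrands
      have the same limit off \<open>N\<close>, so their difference tends to 0, its integrals have
      characteristic functions tending to 1, and the tail bound yields the contradiction.\<close>
    then obtain p q where pq: "\<And>K. K \<le> p K" "\<And>K. K \<le> q K"
      "\<And>K. \<epsilon> < prob {\<omega> \<in> space M. \<epsilon> < \<bar>J (p K) v \<omega> - J (q K) v \<omega>\<bar>}"
      unfolding choice_iff by blast
    have lims: "filterlim p at_top sequentially" "filterlim q at_top sequentially"
      using pq(1,2) by (auto intro!: filterlim_at_top_mono[OF filterlim_ident] always_eventually)
    define X where "X K \<omega> = J (p K) v \<omega> - J (q K) v \<omega>" for K \<omega>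
    have [measurable]: "X K \<in> borel_measurable M" for K unfolding X_def by measurable
    define d where "d K s = h (p K) v s - h (q K) v s" for K s
    define R where "R K = m (p K) * m (q K)" for K
    \<comment> \<open>Both step functions are written on the common grid of
      \<open>m (p K) * m (q K)\<close> cells: fine cell \<open>i\<close> lies in cell
      \<open>i div m (q K)\<close> of the first and \<open>i div m (p K)\<close> of the
      second.\<close>
    define x where "x K i = w (p K) v (i div m (q K)) - w (q K) v (i div m (p K))" for K i
    have R: "0 < R K" for K using m(1) by (simp add: R_def)
    have d_eq: "x K (grid_index T (R K) s) = d K s" if "0 \<le> s" for K s
      using grid_index_refine[OF T m(1)[of "p K"] m(1)[of "q K"] that]
        grid_index_refine[OF T m(1)[of "q K"] m(1)[of "p K"] that]
      by (simp add: x_def d_def h_def R_def mult.commute)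
    have simple_R: "is_simple T (R K) (grid T (R K)) (x K) (\<lambda>s. x K (grid_index T (R K) s))" for K
      by (rule is_simple_grid[OF T R])
    have X_eq: "AE \<omega> in M. X K \<omega> = simple_integral L (R K) (grid T (R K)) (x K) \<omega>" for K
    proof -
      have Jp: "J (p K) v \<omega> = simple_integral L (R K) (grid T (R K)) (\<lambda>i. w (p K) v (i div m (q K))) \<omega>" for \<omega>
        unfolding J_def R_def by (rule simple_integral_refine[OF m(1) m(1), symmetric])
      have Jq: "J (q K) v \<omega> = simple_integral L (R K) (grid T (R K)) (\<lambda>i. w (q K) v (i div m (p K))) \<omega>" for \<omega>
        unfolding J_def R_def
        by (subst (1 2) mult.commute) (rule simple_integral_refine[OF m(1) m(1), symmetric])
      show ?thesis
        using simple_integral_linear[OF T, of "R K" 1 "\<lambda>i. w (p K) v (i div m (q K))" "-1" "\<lambda>i. w (q K) v (i div m (p K))"]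
        by eventually_elim (simp add: X_def x_def[abs_def] Jp Jq)
    qed
    have char_X: "(\<lambda>s. cyl_exponent (u *\<^sub>R d K s)) integrable_on {0..T}"
      "char (distr M borel (X K)) u = complex_of_real (exp (- integral {0..T} (\<lambda>s. cyl_exponent (u *\<^sub>R d K s))))" for K u
    proof -
      have D: "distr M borel (X K) = distr M borel (simple_integral L (R K) (grid T (R K)) (x K))"
        by (intro distr_borel_cong_AE X_eq simple_integral_measurable[OF simple_R]) measurable
      have E: "cyl_exponent (u *\<^sub>R x K (grid_index T (R K) s)) = cyl_exponent (u *\<^sub>R d K s)" if "s \<in> {0..T}" for s
        using that by (simp add: d_eq)
      show "(\<lambda>s. cyl_exponent (u *\<^sub>R d K s)) integrable_on {0..T}"
        using simple_integral_char(1)[OF simple_R[of K], of u] E by (rule integrable_eq)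
      show "char (distr M borel (X K)) u = complex_of_real (exp (- integral {0..T} (\<lambda>s. cyl_exponent (u *\<^sub>R d K s))))"
        unfolding D simple_integral_char(2)[OF simple_R]
        using Henstock_Kurzweil_Integration.integral_cong[of "{0..T}", OF E] by simp
    qed
    obtain C where C: "\<And>n s. s \<in> {0..T} \<Longrightarrow> norm (h n v s) \<le> C" using bound[of v] by blast
    have d_bound: "norm (d K s) \<le> C + C" if "s \<in> {0..T}" for K s
      unfolding d_def by (rule order_trans[OF norm_triangle_ineq4 add_mono[OF C[OF that] C[OF that]]])
    have d_conv: "(\<lambda>K. d K s) \<longlonglongrightarrow> 0" if "s \<in> {0..T} - N" for s
      using tendsto_diff[OF filterlim_compose[OF conv[OF that, of v] lims(1)]
          filterlim_compose[OF conv[OF that, of v] lims(2)]] by (simp add: d_def)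
    have "(\<lambda>K. char (distr M borel (X K)) u) \<longlonglongrightarrow> 1" for u
    proof -
      have "(\<lambda>K. complex_of_real (exp (- integral {0..T} (\<lambda>s. cyl_exponent (u *\<^sub>R d K s)))))
          \<longlonglongrightarrow> complex_of_real (exp (- integral {0..T} (\<lambda>s. cyl_exponent (u *\<^sub>R 0))))"
        by (intro tendsto_intros exponent_integral_tendsto(2)[OF char_X(1) d_bound N d_conv])
      then show ?thesis by (simp add: char_X(2))
    qed
    then have "(\<lambda>K. prob {\<omega> \<in> space M. \<epsilon> < \<bar>X K \<omega>\<bar>}) \<longlonglongrightarrow> 0"
      using \<epsilon> by (intro tendsto_zero_if_char_tendsto_1) auto
    then have "\<forall>\<^sub>F K in sequentially. prob {\<omega> \<in> space M. \<epsilon> < \<bar>X K \<omega>\<bar>} < \<epsilon>"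
      using \<epsilon> by (rule order_tendstoD)
    then obtain K where "prob {\<omega> \<in> space M. \<epsilon> < \<bar>X K \<omega>\<bar>} < \<epsilon>"
      unfolding eventually_sequentially by blast
    then show False using pq(3)[of K] by (simp add: X_def)
  qed
  have "\<exists>Z. Z \<in> borel_measurable M \<and> tendsto_in_prob M (\<lambda>n. J n v) Z sequentially" for v
    using Cauchy_in_prob_imp_tendsto[of "\<lambda>n. J n v", OF J_meas Cauchy] by blast
  then obtain Z where Z [measurable]: "\<And>v. Z v \<in> borel_measurable M"
    and J_lim: "\<And>v. tendsto_in_prob M (\<lambda>n. J n v) (Z v) sequentially"
    by metis
  have Z_integral: "has_cylindrical_integral M L T (\<lambda>s. indicator A s *\<^sub>R blinfun_apply (S s) v) (Z v)" for v
    unfolding has_cylindrical_integral_def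
  proof (intro conjI exI)
    show "\<forall>n. has_regulated_integral M L T (h n v) (J n v)"
      unfolding J_def h_def by (intro allI has_regulated_integral_grid T m(1))
    show "\<forall>n. \<forall>s\<in>{0..T}. norm (h n v s) \<le> (SOME C. \<forall>n. \<forall>s\<in>{0..T}. norm (h n v s) \<le> C)"
      by (rule someI_ex[OF bound])
    have "AE s in lebesgue. s \<notin> N"
      using N by (simp add: negligible_iff_null_sets AE_not_in)
    then have "AE s in lebesgue. s \<in> {0..T} \<longrightarrow> (\<lambda>n. h n v s) \<longlonglongrightarrow> indicator A s *\<^sub>R blinfun_apply (S s) v"
      by eventually_elim (use conv in auto)
    then show "AE s in lborel. s \<in> {0..T} \<longrightarrow> (\<lambda>n. h n v s) \<longlonglongrightarrow> indicator A s *\<^sub>R blinfun_apply (S s) v"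
      by (simp add: AE_completion_iff)
    show "tendsto_in_prob M (\<lambda>n. J n v) (Z v) sequentially" by (rule J_lim)
  qed measurable
  have Z_linear: "AE \<omega> in M. Z (a *\<^sub>R v + b *\<^sub>R v') \<omega> = a * Z v \<omega> + b * Z v' \<omega>" for a b v v'
  proof (rule tendsto_in_prob_unique)
    have w_lin: "w n (a *\<^sub>R v + b *\<^sub>R v') = (\<lambda>j. a *\<^sub>R w n v j + b *\<^sub>R w n v' j)" for n
      by (simp add: w_def fun_eq_iff blinfun.add_right blinfun.scaleR_right scaleR_add_right mult.commute)
    have lin: "AE \<omega> in M. a * J n v \<omega> + b * J n v' \<omega> = J n (a *\<^sub>R v + b *\<^sub>R v') \<omega>" for n
      using simple_integral_linear[OF T, of "m n" a "w n v" b "w n v'"]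
      by (simp add: J_def w_lin eq_commute)
    have "tendsto_in_prob M (\<lambda>n \<omega>. a * J n v \<omega> + b * J n v' \<omega>) (\<lambda>\<omega>. a * Z v \<omega> + b * Z v' \<omega>) sequentially"
      by (intro tendsto_in_prob_add tendsto_in_prob_scale J_lim) measurable
    then show "tendsto_in_prob M (\<lambda>n. J n (a *\<^sub>R v + b *\<^sub>R v')) (\<lambda>\<omega>. a * Z v \<omega> + b * Z v' \<omega>) sequentially"
      by (rule tendsto_in_prob_AE_cong[OF lin, rotated -1]) auto
    show "tendsto_in_prob M (\<lambda>n. J n (a *\<^sub>R v + b *\<^sub>R v')) (Z (a *\<^sub>R v + b *\<^sub>R v')) sequentially"
      by (rule J_lim)
  qed measurable
  show ?thesis using Z Z_integral Z_linear by (rule that)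
qed

end

section \<open>From square-summable coordinates to a vector-valued integral\<close>

lemma has_cylindrical_integral_cong:
  assumes "prob_space M" and X: "has_cylindrical_integral M L T g X" and X' [measurable]: "X' \<in> borel_measurable M"
    and eq: "AE \<omega> in M. X \<omega> = X' \<omega>" and g: "\<And>s. s \<in> {0..T} \<Longrightarrow> g s = g' s"
  shows "has_cylindrical_integral M L T g' X'"
proof -
  interpret prob_space M by fact
  from X obtain h Y C where hY: "\<And>n::nat. has_regulated_integral M L T (h n) (Y n)"
    and bound: "\<And>n s. s \<in> {0..T} \<Longrightarrow> norm (h n s) \<le> C"
    and ae: "AE s in lborel. s \<in> {0..T} \<longrightarrow> (\<lambda>n. h n s) \<longlonglongrightarrow> g s"
    and lim: "tendsto_in_prob M Y X sequentially" and [measurable]: "X \<in> borel_measurable M"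
    unfolding has_cylindrical_integral_def by blast
  have "AE s in lborel. s \<in> {0..T} \<longrightarrow> (\<lambda>n. h n s) \<longlonglongrightarrow> g' s"
    using ae by eventually_elim (simp add: g)
  moreover have [measurable]: "Y n \<in> borel_measurable M" for n
    using hY by (simp add: has_regulated_integral_def)
  then have "tendsto_in_prob M Y X' sequentially"
    by (intro tendsto_in_prob_AE_cong[OF _ eq _ _ _ _ lim]) auto
  ultimately show ?thesis
    unfolding has_cylindrical_integral_def using hY bound X' by blast
qed

lemma summable_if_summable_min_one:
  fixes f :: "nat \<Rightarrow> real"
  assumes nonneg: "\<And>k. 0 \<le> f k" and min: "summable (\<lambda>k. min (f k) 1)"
  shows "summable f"
proof -
  have "\<forall>\<^sub>F k in sequentially. min (f k) 1 < 1"
    using summable_LIMSEQ_zero[OF min] by (rule order_tendstoD) simp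
  then have "\<forall>\<^sub>F k in sequentially. norm (f k) \<le> min (f k) 1"
    by eventually_elim (use nonneg in auto)
  then show ?thesis by (rule summable_comparison_test_ev[OF _ min])
qed

context diagonal_semigroup
begin

text \<open>Off \<open>A\<close> the exponent is 0 and on \<open>A\<close> it is a nonnegative jump
  exponent, so the integral over [0,T] bounds it for every \<open>A\<close>. With
  \<open>1 - exp (- x) \<le> x\<close> the Gaussian average of this bound is at most the damped
  mass; the factor 3 stems from \<open>min_one_le_gauss\<close>.\<close>

lemma expectation_min_square_le:
  assumes X: "has_cylindrical_integral M L T (\<lambda>s. indicator A s *\<^sub>R blinfun_apply (S s) (e k)) X"
  shows "(\<integral>\<^sup>+\<omega>. ennreal (min ((X \<omega>)\<^sup>2) 1) \<partial>M) \<le> 3 * damped_mass k (\<gamma> k) T"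
proof -
  interpret G: prob_space std_normal_distribution by (rule prob_space_std_normal)
  have [measurable]: "X \<in> borel_measurable M" using X by (simp add: has_cylindrical_integral_def)
  have [measurable]: "char (distr M borel X) \<in> borel_measurable borel"
    by (intro real_distribution.char_measurable real_distribution_distr) simp
  let ?D = "damped_exponent k (\<gamma> k) T"
  have le: "1 - Re (char (distr M borel X) u) \<le> ?D u" "0 \<le> 1 - Re (char (distr M borel X) u)" for u
  proof -
    let ?f = "\<lambda>s. cyl_exponent (u *\<^sub>R indicator A s *\<^sub>R blinfun_apply (S s) (e k))"
    note c = cylindrical_integral_char[OF X, of u]
    have "?f s \<le> jump_exponent (\<nu> k) (u * exp (\<gamma> k * s))" if s: "s \<in> {0..T}" for s
    proof (cases "s \<in> A")
      case True
      have "blinfun_apply (S s) (e k) = exp (\<gamma> k * s) *\<^sub>R e k"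
        by (rule eqI_coeffs) (simp add: S_coeff[OF s] inner_basis)
      then have "?f s = (\<Sum>j. jump_exponent (\<nu> j) (if j = k then u * exp (\<gamma> k * s) else 0))"
        using True unfolding cyl_exponent_def by (auto simp: inner_basis intro!: arg_cong[where f = suminf])
      also have "\<dots> = (\<Sum>j\<in>{k}. jump_exponent (\<nu> j) (if j = k then u * exp (\<gamma> k * s) else 0))"
        by (rule suminf_finite) auto
      finally show ?thesis by simp
    qed (simp add: jump_exponent_nonneg)
    then have "integral {0..T} ?f \<le> ?D u"
      unfolding damped_exponent_def by (intro integral_le c(1) integrable_jump_exponent_exp)
    moreover have "0 \<le> integral {0..T} ?f"
      by (intro Henstock_Kurzweil_Integration.integral_nonneg c(1) cyl_exponent_nonneg)
    ultimately show "1 - Re (char (distr M borel X) u) \<le> ?D u" "0 \<le> 1 - Re (char (distr M borel X) u)"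
      using exp_ge_add_one_self[of "- integral {0..T} ?f"] unfolding c(2) by simp_all
  qed
  have int: "integrable std_normal_distribution (\<lambda>u. 1 - Re (char (distr M borel X) u))"
  proof (rule G.integrable_const_bound[of _ 2])
    have Re_le: "\<bar>Re (char (distr M borel X) u)\<bar> \<le> 1" for u
      using abs_Re_le_cmod[of "char (distr M borel X) u"]
        real_distribution.cmod_char_le_1[OF real_distribution_distr, of X u] by simp
    have "\<bar>1 - Re (char (distr M borel X) u)\<bar> \<le> 2" for u
      using Re_le[of u] by linarith
    then show "AE u in std_normal_distribution. norm (1 - Re (char (distr M borel X) u)) \<le> 2"
      by simp
  qed simp
  have "(\<integral>\<^sup>+\<omega>. ennreal (min ((X \<omega>)\<^sup>2) 1) \<partial>M) \<le> (\<integral>\<^sup>+\<omega>. 3 * ennreal (1 - exp (- ((X \<omega>)\<^sup>2) / 2)) \<partial>M)"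
    by (intro nn_integral_mono order_trans[OF ennreal_leI[OF min_one_le_gauss]])
       (simp only: ennreal_mult'[OF zero_le_numeral] order_refl ennreal_numeral)
  also have "\<dots> = 3 * (\<integral>\<^sup>+\<omega>. ennreal (1 - exp (- ((X \<omega>)\<^sup>2) / 2)) \<partial>M)"
    by (intro nn_integral_cmult) simp
  also have "(\<integral>\<^sup>+\<omega>. ennreal (1 - exp (- ((X \<omega>)\<^sup>2) / 2)) \<partial>M) = ennreal (expectation (\<lambda>\<omega>. 1 - exp (- ((X \<omega>)\<^sup>2) / 2)))"
    by (intro nn_integral_eq_integral integrable_const_bound[of _ 1]) auto
  also have "expectation (\<lambda>\<omega>. 1 - exp (- ((X \<omega>)\<^sup>2) / 2)) = (LINT u|std_normal_distribution. 1 - Re (char (distr M borel X) u))"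
    using expectation_gauss_char[of X 1] by simp
  also have "ennreal \<dots> = (\<integral>\<^sup>+u. ennreal (1 - Re (char (distr M borel X) u)) \<partial>std_normal_distribution)"
    using int le(2) by (intro nn_integral_eq_integral[symmetric]) auto
  also have "\<dots> \<le> (\<integral>\<^sup>+u. ennreal (?D u) \<partial>std_normal_distribution)"
    by (intro nn_integral_mono ennreal_leI le(1))
  also have "\<dots> \<le> damped_mass k (\<gamma> k) T" by (rule gauss_damped_exponent_le)
  finally show ?thesis by (simp add: mult_left_mono)
qed

text \<open>Almost sure square summability of the coordinates makes the expansion in the basis
  converge to a vector \<open>I\<close>. Its pairing with \<open>v\<close> and the integral
  \<open>Z v\<close> are both limits in probability of the same partial sums, hence equal almost
  surely.\<close>

lemma sum_finite_imp_integrable: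
  assumes fin: "(\<Sum>k. damped_mass k (\<gamma> k) T) < \<infinity>"
  shows "stochastically_integrable M L T S"
  unfolding stochastically_integrable_def
proof (intro conjI weakly_regulated_S ballI impI)
  fix A :: "real set" assume A: "A \<in> sets borel" "A \<subseteq> {0..T}"
  obtain Z where Z [measurable]: "\<And>v. Z v \<in> borel_measurable M"
    and Z_int: "\<And>v. has_cylindrical_integral M L T (\<lambda>s. indicator A s *\<^sub>R blinfun_apply (S s) v) (Z v)"
    and Z_lin: "\<And>a b v w. AE \<omega> in M. Z (a *\<^sub>R v + b *\<^sub>R w) \<omega> = a * Z v \<omega> + b * Z w \<omega>"
    using cylindrical_integral_exists[OF A(1)] by blast
  define X where "X k = Z (e k)" for k
  have [measurable]: "X k \<in> borel_measurable M" for k unfolding X_def by measurable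
  have summable_X: "AE \<omega> in M. summable (\<lambda>k. (X k \<omega>)\<^sup>2)"
  proof -
    have "(\<integral>\<^sup>+\<omega>. (\<Sum>k. ennreal (min ((X k \<omega>)\<^sup>2) 1)) \<partial>M) = (\<Sum>k. \<integral>\<^sup>+\<omega>. ennreal (min ((X k \<omega>)\<^sup>2) 1) \<partial>M)"
      by (rule nn_integral_suminf) measurable
    also have "\<dots> \<le> (\<Sum>k. 3 * damped_mass k (\<gamma> k) T)"
      unfolding X_def by (intro suminf_le expectation_min_square_le[OF Z_int]) auto
    also have "\<dots> = 3 * (\<Sum>k. damped_mass k (\<gamma> k) T)" by simp
    also have "\<dots> < \<infinity>" using fin by (simp add: ennreal_mult_less_top)
    finally have "AE \<omega> in M. (\<Sum>k. ennreal (min ((X k \<omega>)\<^sup>2) 1)) \<noteq> \<infinity>"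
      by (intro nn_integral_PInf_AE) auto
    then show ?thesis
    proof eventually_elim
      case (elim \<omega>)
      then have "summable (\<lambda>k. min ((X k \<omega>)\<^sup>2) 1)"
        by (intro summable_suminf_not_top) auto
      then show ?case by (rule summable_if_summable_min_one[rotated]) simp
    qed
  qed
  \<comment> \<open>The series in \<open>ennreal\<close> makes the good event measurable. Putting
    the partial sums to 0 off this event makes them converge at every point, so that the limit
    \<open>I\<close> is measurable.\<close>
  define \<Omega>0 where "\<Omega>0 = {\<omega> \<in> space M. (\<Sum>k. ennreal ((X k \<omega>)\<^sup>2)) \<noteq> \<infinity>}"
  have [measurable]: "\<Omega>0 \<in> sets M" unfolding \<Omega>0_def by measurable
  define P where "P N \<omega> = indicator \<Omega>0 \<omega> *\<^sub>R (\<Sum>k<N. X k \<omega> *\<^sub>R e k)" for N \<omega>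
  define I where "I \<omega> = lim (\<lambda>N. P N \<omega>)" for \<omega>
  have P_lim: "(\<lambda>N. P N \<omega>) \<longlonglongrightarrow> I \<omega>" if "\<omega> \<in> space M" for \<omega>
  proof -
    have "convergent (\<lambda>N. P N \<omega>)"
    proof (cases "\<omega> \<in> \<Omega>0")
      case True
      then have "summable (\<lambda>k. (X k \<omega>)\<^sup>2)"
        by (intro summable_suminf_not_top) (auto simp: \<Omega>0_def)
      then show ?thesis using True square_summable_convergent by (simp add: P_def)
    qed (simp add: P_def convergent_const)
    then show ?thesis unfolding I_def by (simp add: convergent_LIMSEQ_iff)
  qed
  have [measurable]: "P N \<in> borel_measurable M" for N unfolding P_def by measurable
  have I [measurable]: "I \<in> borel_measurable M"
    by (rule borel_measurable_LIMSEQ_metric[OF _ P_lim]) measurable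
  have Z_eq: "AE \<omega> in M. Z v \<omega> = I \<omega> \<bullet> v" for v
  proof (rule tendsto_in_prob_unique)
    let ?S = "\<lambda>N \<omega>. \<Sum>k<N. (v \<bullet> e k) * X k \<omega>"
    have Z_proj: "AE \<omega> in M. Z (basis_proj e N v) \<omega> = ?S N \<omega>" for N
    proof (induction N)
      case 0
      have "AE \<omega> in M. Z 0 \<omega> = 0" using Z_lin[of 0 0 0 0] by simp
      then show ?case by (simp add: basis_proj_def)
    next
      case (Suc N)
      have "AE \<omega> in M. Z (basis_proj e (Suc N) v) \<omega> = Z (basis_proj e N v) \<omega> + (v \<bullet> e N) * X N \<omega>"
        using Z_lin[of 1 "basis_proj e N v" "v \<bullet> e N" "e N"] by (simp add: basis_proj_def X_def)
      with Suc show ?case by eventually_elim simp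
    qed
    \<comment> \<open>Convergence of \<open>Z\<close> along the projections is derived from its law:
      \<open>S s\<close> commutes with the projections, so the residual integrands are bounded by
      \<open>norm (S s v)\<close> and tend to 0 at each time, and their characteristic functions
      tend to 1.\<close>
    define Y where "Y N = Z (v - basis_proj e N v)" for N
    have [measurable]: "Y N \<in> borel_measurable M" for N unfolding Y_def by measurable
    have Y_eq: "AE \<omega> in M. Y N \<omega> = Z v \<omega> - ?S N \<omega>" for N
    proof -
      have "AE \<omega> in M. Y N \<omega> = Z v \<omega> - Z (basis_proj e N v) \<omega>"
        using Z_lin[of 1 v "-1" "basis_proj e N v"] by (simp add: Y_def)
      with Z_proj[of N] show ?thesis by eventually_elim simp
    qed
    obtain C where C: "\<And>s. s \<in> {0..T} \<Longrightarrow> norm (blinfun_apply (S s) v) \<le> C" using S_bounded by blast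
    let ?r = "\<lambda>N s. indicator A s *\<^sub>R blinfun_apply (S s) (v - basis_proj e N v)"
    have S_r: "blinfun_apply (S s) (v - basis_proj e N v) = blinfun_apply (S s) v - basis_proj e N (blinfun_apply (S s) v)"
      if "s \<in> {0..T}" for s N
      by (simp add: blinfun.diff_right S_basis_proj[OF that])
    have r_bound: "norm (?r N s) \<le> C" if "s \<in> {0..T}" for N s
      using norm_residual_le_norm[of "blinfun_apply (S s) v" N] C[OF that]
        order_trans[OF norm_ge_zero C[OF that]]
      by (auto simp: S_r[OF that] indicator_def)
    have r_conv: "(\<lambda>N. ?r N s) \<longlonglongrightarrow> 0" if "s \<in> {0..T} - {}" for s
    proof -
      have "(\<lambda>N. blinfun_apply (S s) v - basis_proj e N (blinfun_apply (S s) v)) \<longlonglongrightarrow> blinfun_apply (S s) v - blinfun_apply (S s) v"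
        by (intro tendsto_diff tendsto_const basis_proj_tendsto)
      then have "(\<lambda>N. blinfun_apply (S s) (v - basis_proj e N v)) \<longlonglongrightarrow> 0" using that by (simp add: S_r)
      from tendsto_scaleR[OF tendsto_const this, of "indicator A s"] show ?thesis by simp
    qed
    have "(\<lambda>N. char (distr M borel (Y N)) u) \<longlonglongrightarrow> 1" for u
    proof -
      have "(\<lambda>N. complex_of_real (exp (- integral {0..T} (\<lambda>s. cyl_exponent (u *\<^sub>R ?r N s)))))
          \<longlonglongrightarrow> complex_of_real (exp (- integral {0..T} (\<lambda>s. cyl_exponent (u *\<^sub>R 0))))"
        by (intro tendsto_intros
            exponent_integral_tendsto(2)[OF cylindrical_integral_char(1)[OF Z_int] r_bound negligible_empty r_conv])
      then show ?thesis
        unfolding Y_def cylindrical_integral_char(2)[OF Z_int] by simp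
    qed
    then have "tendsto_in_prob M Y (\<lambda>_. 0) sequentially"
      unfolding tendsto_in_prob_def by (auto intro!: tendsto_zero_if_char_tendsto_1)
    then have "tendsto_in_prob M (\<lambda>N \<omega>. Z v \<omega> + (-1) * Y N \<omega>) (\<lambda>\<omega>. Z v \<omega> + (-1) * 0) sequentially"
      by (intro tendsto_in_prob_add tendsto_in_prob_scale) (auto simp: tendsto_in_prob_def)
    then show "tendsto_in_prob M ?S (Z v) sequentially"
    proof (rule tendsto_in_prob_AE_cong[rotated -1])
      show "AE \<omega> in M. Z v \<omega> + (-1) * Y N \<omega> = ?S N \<omega>" for N
        using Y_eq[of N] by eventually_elim simp
    qed auto
    have "AE \<omega> in M. (\<lambda>N. ?S N \<omega>) \<longlonglongrightarrow> I \<omega> \<bullet> v"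
      using summable_X AE_space
    proof eventually_elim
      case (elim \<omega>)
      then have "\<omega> \<in> \<Omega>0" by (simp add: \<Omega>0_def suminf_ennreal2)
      then have "P N \<omega> \<bullet> v = ?S N \<omega>" for N
        by (simp add: P_def inner_sum_left inner_commute[of v] mult.commute)
      with tendsto_inner[OF P_lim[OF elim(2)] tendsto_const[of v]] show ?case by simp
    qed
    then show "tendsto_in_prob M ?S (\<lambda>\<omega>. I \<omega> \<bullet> v) sequentially"
      by (intro tendsto_in_prob_AE) measurable
  qed measurable
  show "\<exists>I. I \<in> borel_measurable M \<and>
      (\<forall>v. has_cylindrical_integral M L T (\<lambda>s. indicator A s *\<^sub>R adjoint (blinfun_apply (S s)) v) (\<lambda>\<omega>. I \<omega> \<bullet> v))"
  proof (intro exI[of _ I] conjI I allI)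
    fix v
    show "has_cylindrical_integral M L T (\<lambda>s. indicator A s *\<^sub>R adjoint (blinfun_apply (S s)) v) (\<lambda>\<omega>. I \<omega> \<bullet> v)"
      by (rule has_cylindrical_integral_cong[OF prob_space_axioms Z_int[of v] _ Z_eq]) (simp_all add: adjoint_S)
  qed
qed

end

theorem corollary6p3:
  fixes M :: "'w measure"
    and S :: "real \<Rightarrow> 'v::{real_inner, polish_space} \<Rightarrow>\<^sub>L 'v"
    and T :: real
    and e :: "nat \<Rightarrow> 'v"
    and \<gamma> :: "nat \<Rightarrow> real"
    and L :: "real \<Rightarrow> 'v \<Rightarrow> 'w \<Rightarrow> real"
    and l :: "nat \<Rightarrow> real \<Rightarrow> 'w \<Rightarrow> real"
    and \<nu> :: "nat \<Rightarrow> real measure"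
  assumes "prob_space M"
    and "T > 0"
    and "strongly_continuous_semigroup_on T S"
    and "orthonormal_basis e"
    and "\<And>t k. t \<in> {0..T} \<Longrightarrow> adjoint (blinfun_apply (S t)) (e k) = exp (\<gamma> k * t) *\<^sub>R e k"
    and "cylindrical_levy_process M L"
    and "\<And>k. levy_process M (l k)"
    and "\<And>k. symmetric_process M (l k)"
    and "\<And>k. pure_jump_characteristics M (l k) (\<nu> k)"
    and "independent_processes M l"
    and "\<And>v t. t \<ge> 0 \<Longrightarrow> AE \<omega> in M. (\<lambda>k. (e k \<bullet> v) * l k t \<omega>) sums L t v \<omega>"
  shows "stochastically_integrable M L T S \<longleftrightarrow>
    (\<Sum>k. \<integral>\<^sup>+s\<in>{0..T}. (\<integral>\<^sup>+\<beta>. ennreal (min (exp (2 * \<gamma> k * s) * \<bar>\<beta>\<bar>\<^sup>2) 1) \<partial>\<nu> k) \<partial>lborel) < \<infinity>"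
proof -
  interpret prob_space M by fact
  interpret onb e by unfold_locales fact
  interpret diagonal_semigroup M e L l \<nu> S \<gamma> T
    by unfold_locales fact+
  show ?thesis
    unfolding damped_mass_def[symmetric]
    using integrable_imp_sum_finite sum_finite_imp_integrable by blast
qed

end
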